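(* Let $B$ be a constant and let $\Gamma=(G_1,\dots,G_n)$ be a simple hierarchical specification of a graph $G=E(\Gamma)$ in which every vertex has degree at most $B$. Then one can compute in time $O(N+M)$ (the size of the specification) an independent set $I$ of $G$ (its size $|I|$ and a hierarchical specification of $I$ of size $O(N)$) such that $|I|\ge \alpha(G)/B$, where $\alpha(G)$ is the size of a maximum independent set of $G$.
   Context: A hierarchical specification $\Gamma=(G_1,\dots,G_n)$ is a sequence of undirected simple graphs $G_i$ (cells); $G_i$ has $n_i$ vertices and $m_i$ edges. Some vertices of $G_i$ are designated pins, numbered $1,\dots,p_i$; the others are inner vertices, some of which are designated nonterminals. Each nonterminal $v$ of $G_i$ has a type $G_j$ with $j<i$; all neighbours of $v$ are non-nonterminal vertices, in one-to-one correspondence with the pins of $G_j$. The expansion is defined by $E(\Gamma_1)=G_1$ and, for $i>1$, $E(\Gamma_i)$ is obtained from $G_i$ by deleting every nonterminal $v$ (of type $G_j$) with its incident edges and inserting a copy of $E(\Gamma_j)$, identifying its $l$-th pin with the neighbour of $v$ corresponding to pin $l$; $\Gamma_i=(G_1,\dots,G_i)$ and $E(\Gamma)=E(\Gamma_n)$. $N=\sum_i n_i$, $M=\sum_i m_i$. $\Gamma$ is simple if no cell contains an edge between two of its pins. *)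

theory Defs
  imports Complex_Main
begin

section \<open>Undirected simple graphs\<close>

type_synonym 'a ugraph = "'a set \<times> 'a set set"

abbreviation verts :: "'a ugraph \<Rightarrow> 'a set" where "verts \<equiv> fst"
abbreviation edges :: "'a ugraph \<Rightarrow> 'a set set" where "edges \<equiv> snd"

definition simple_graph :: "'a ugraph \<Rightarrow> bool" where
  "simple_graph G \<longleftrightarrow> finite (verts G) \<and> verts G \<noteq> {} \<and>
     edges G \<subseteq> {{u, v} | u v. u \<in> verts G \<and> v \<in> verts G \<and> u \<noteq> v}"

definition nbrs :: "'a ugraph \<Rightarrow> 'a \<Rightarrow> 'a set" where
  "nbrs G v = {u. {v, u} \<in> edges G}"

definition degree :: "'a ugraph \<Rightarrow> 'a \<Rightarrow> nat" where
  "degree G v = card (nbrs G v)"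

definition independent_set :: "'a ugraph \<Rightarrow> 'a set \<Rightarrow> bool" where
  "independent_set G I \<longleftrightarrow> I \<subseteq> verts G \<and> (\<forall>u\<in>I. \<forall>v\<in>I. {u, v} \<notin> edges G)"

definition independence_number :: "'a ugraph \<Rightarrow> nat" where
  "independence_number G = Max {card I | I. independent_set G I}"

section \<open>Hierarchical specifications\<close>

text \<open>
  The list \<open>pins\<close> numbers the pins. The map \<open>nonterm\<close> is defined exactly on the nonterminals;
  \<open>nonterm v = Some (j, xs)\<close> says that \<open>v\<close> has type \<open>G\<^sub>j\<close> and that \<open>xs ! l\<close> is the neighbour
  of \<open>v\<close> that corresponds to the pin number \<open>l\<close> of \<open>G\<^sub>j\<close>.  Cells and pins are counted from 0.
\<close>

record cell =
  graph :: "nat ugraph"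
  pins :: "nat list"
  nonterm :: "nat \<Rightarrow> (nat \<times> nat list) option"

definition cell_ok :: "cell list \<Rightarrow> nat \<Rightarrow> cell \<Rightarrow> bool" where
  "cell_ok \<Gamma> i c \<longleftrightarrow>
     simple_graph (graph c) \<and>
     distinct (pins c) \<and> set (pins c) \<subseteq> verts (graph c) \<and>
     dom (nonterm c) \<subseteq> verts (graph c) - set (pins c) \<and>
     (\<forall>v j xs. nonterm c v = Some (j, xs) \<longrightarrow>
        j < i \<and> nbrs (graph c) v \<inter> dom (nonterm c) = {} \<and>
        distinct xs \<and> set xs = nbrs (graph c) v \<and> length xs = length (pins (\<Gamma> ! j)))"

definition hier_spec :: "cell list \<Rightarrow> bool" where
  "hier_spec \<Gamma> \<longleftrightarrow> \<Gamma> \<noteq> [] \<and> (\<forall>i < length \<Gamma>. cell_ok \<Gamma> i (\<Gamma> ! i))"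

definition simple_spec :: "cell list \<Rightarrow> bool" where
  "simple_spec \<Gamma> \<longleftrightarrow>
     (\<forall>c \<in> set \<Gamma>. \<forall>u \<in> set (pins c). \<forall>v \<in> set (pins c). {u, v} \<notin> edges (graph c))"

definition vsize :: "cell list \<Rightarrow> nat" where
  "vsize \<Gamma> = (\<Sum>c\<leftarrow>\<Gamma>. card (verts (graph c)))"

definition esize :: "cell list \<Rightarrow> nat" where
  "esize \<Gamma> = (\<Sum>c\<leftarrow>\<Gamma>. card (edges (graph c)))"

subsection \<open>Expansion\<close>

text \<open>
  A vertex of an expansion is named by the nonterminals through which it is reached, followed by
  a vertex of the cell it belongs to.  A vertex \<open>u\<close> of the cell itself is thus \<open>[u]\<close>, and the copy
  inserted for the nonterminal \<open>v\<close> has its vertices prefixed with \<open>v\<close>, except that its \<open>l\<close>-th pin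
  is identified with the vertex \<open>xs ! l\<close> of the surrounding cell.
\<close>

definition glue :: "nat list \<Rightarrow> nat list \<Rightarrow> nat \<Rightarrow> nat list \<Rightarrow> nat list" where
  "glue ps xs v x =
     (case map_of (zip (map (\<lambda>p. [p]) ps) xs) x of Some u \<Rightarrow> [u] | None \<Rightarrow> v # x)"

definition expand_cell ::
  "(nat \<Rightarrow> nat list) \<Rightarrow> (nat \<Rightarrow> nat list ugraph) \<Rightarrow> cell \<Rightarrow> nat list ugraph" where
  "expand_cell ps E c =
     ((\<lambda>u. [u]) ` (verts (graph c) - dom (nonterm c)) \<union>
        \<Union>{glue (ps j) xs v ` verts (E j) | v j xs. nonterm c v = Some (j, xs)},
      {(\<lambda>u. [u]) ` e | e. e \<in> edges (graph c) \<and> e \<inter> dom (nonterm c) = {}} \<union>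
        \<Union>{image (glue (ps j) xs v) ` edges (E j) | v j xs. nonterm c v = Some (j, xs)})"

text \<open>
  \<open>expansion_at \<Gamma> i\<close> is the expansion of the prefix of \<open>\<Gamma>\<close> that ends with cell \<open>i\<close>.  The guard
  \<open>j < i\<close> only serves termination: it holds for all types that occur in cell \<open>i\<close>.
\<close>

fun expansion_at :: "cell list \<Rightarrow> nat \<Rightarrow> nat list ugraph" where
  "expansion_at \<Gamma> i = expand_cell (\<lambda>j. pins (\<Gamma> ! j))
     (\<lambda>j. if j < i then expansion_at \<Gamma> j else ({}, {})) (\<Gamma> ! i)"

declare expansion_at.simps [simp del]

definition expansion :: "cell list \<Rightarrow> nat list ugraph" where
  "expansion \<Gamma> = expansion_at \<Gamma> (length \<Gamma> - 1)"

subsection \<open>Representation as a sequence of numbers\<close>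

text \<open>
  Vertices, nonterminals and edges may be listed in any order, every edge once and in either
  orientation.
\<close>

definition cell_code :: "cell \<Rightarrow> nat list \<Rightarrow> bool" where
  "cell_code c w \<longleftrightarrow> (\<exists>vs ts es.
     distinct vs \<and> set vs = verts (graph c) \<and>
     distinct (map fst ts) \<and> map_of ts = nonterm c \<and>
     distinct (map (\<lambda>(u, v). {u, v}) es) \<and> (\<lambda>(u, v). {u, v}) ` set es = edges (graph c) \<and>
     w = [length vs, length (pins c), length ts, length es] @ vs @ pins c @
         concat (map (\<lambda>(v, j, xs). [v, j, length xs] @ xs) ts) @
         concat (map (\<lambda>(u, v). [u, v]) es))"

definition spec_code :: "cell list \<Rightarrow> nat list \<Rightarrow> bool" where
  "spec_code \<Gamma> w \<longleftrightarrow> (\<exists>ws. list_all2 cell_code \<Gamma> ws \<and> w = length \<Gamma> # concat ws)"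

text \<open>
  The usual convention for inputs.  It is not part of the format, since a specification of a
  subset of the vertices keeps their names.
\<close>

definition numbered :: "cell list \<Rightarrow> bool" where
  "numbered \<Gamma> \<longleftrightarrow> (\<forall>c \<in> set \<Gamma>. verts (graph c) = {..<card (verts (graph c))})"

section \<open>Random access machines with uniform cost\<close>

text \<open>
  Programs are written with structured control flow, which costs a constant factor compared with
  jumps.  A state consists of the registers and the memory, both holding natural numbers.
  A register holds numbers of any size, and every instruction and every test takes one unit of
  time.  As is usual for this cost measure there is no multiplication.
\<close>

datatype ram =
    Skip
  | Const nat nat
  | Add nat nat nat
  | Sub nat nat nat
  | Load nat nat
  | Store nat nat
  | Seq ram ram
  | If nat ram ram
  | While nat ram

type_synonym ram_state = "(nat \<Rightarrow> nat) \<times> (nat \<Rightarrow> nat)"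

inductive exec :: "ram \<Rightarrow> ram_state \<Rightarrow> nat \<Rightarrow> ram_state \<Rightarrow> bool" where
  Skip: "exec Skip s 1 s"
| Const: "exec (Const d k) (r, m) 1 (r(d := k), m)"
| Add: "exec (Add d a b) (r, m) 1 (r(d := r a + r b), m)"
| Sub: "exec (Sub d a b) (r, m) 1 (r(d := r a - r b), m)"
| Load: "exec (Load d a) (r, m) 1 (r(d := m (r a)), m)"
| Store: "exec (Store a b) (r, m) 1 (r, m(r a := r b))"
| Seq: "exec p s t s' \<Longrightarrow> exec q s' t' s'' \<Longrightarrow> exec (Seq p q) s (t + t') s''"
| IfTrue: "fst s b \<noteq> 0 \<Longrightarrow> exec p s t s' \<Longrightarrow> exec (If b p q) s (1 + t) s'"
| IfFalse: "fst s b = 0 \<Longrightarrow> exec q s t s' \<Longrightarrow> exec (If b p q) s (1 + t) s'"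
| WhileTrue: "fst s b \<noteq> 0 \<Longrightarrow> exec p s t s' \<Longrightarrow> exec (While b p) s' t' s'' \<Longrightarrow>
    exec (While b p) s (1 + t + t') s''"
| WhileFalse: "fst s b = 0 \<Longrightarrow> exec (While b p) s 1 s"

text \<open>
  The input occupies the memory cells from 0 on, with its length in register 0; everything else
  is initially 0.  On termination the output starts at the address in register 0 and has the
  length in register 1.
\<close>

definition input_state :: "nat list \<Rightarrow> ram_state" where
  "input_state w = ((\<lambda>_. 0)(0 := length w), \<lambda>k. if k < length w then w ! k else 0)"

definition output_of :: "ram_state \<Rightarrow> nat list" where
  "output_of s = map (\<lambda>k. snd s (fst s 0 + k)) [0..<fst s 1]"

definition computes :: "ram \<Rightarrow> nat list \<Rightarrow> nat \<Rightarrow> nat list \<Rightarrow> bool" where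
  "computes p w t out \<longleftrightarrow> (\<exists>s. exec p (input_state w) t s \<and> output_of s = out)"

text \<open>A run is unique, so asserting that one exists says that the program terminates with it.\<close>

lemma exec_deterministic:
  assumes "exec p s t s'" and "exec p s u s''"
  shows "t = u \<and> s' = s''"
  using assms
proof (induction arbitrary: u s'')
  case (Seq p s t s' q t' s3)
  from Seq.prems obtain t1 s1 t2 where "exec p s t1 s1" "exec q s1 t2 s''" "u = t1 + t2"
    by (cases rule: exec.cases) simp_all
  with Seq.IH show ?case by metis
next
  case (WhileTrue s b p t s' t' s3)
  from WhileTrue.prems WhileTrue.hyps(1) obtain t1 s1 t2
    where "exec p s t1 s1" "exec (While b p) s1 t2 s''" "u = 1 + t1 + t2"
    by (cases rule: exec.cases) simp_all
  with WhileTrue.IH show ?case by metis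
next
  case (IfTrue s b p t s' q)
  from IfTrue.prems IfTrue.hyps(1) obtain t1 where "exec p s t1 s''" "u = 1 + t1"
    by (cases rule: exec.cases) simp_all
  with IfTrue.IH show ?case by metis
next
  case (IfFalse s b q t s' p)
  from IfFalse.prems IfFalse.hyps(1) obtain t1 where "exec q s t1 s''" "u = 1 + t1"
    by (cases rule: exec.cases) simp_all
  with IfFalse.IH show ?case by metis
next
  case (WhileFalse s b p)
  from WhileFalse.prems WhileFalse.hyps show ?case by (cases rule: exec.cases) simp_all
qed (erule exec.cases; simp)+

end

(* Select greedily, cell after cell, a maximal independent set among the inner terminals of the
   cell that no selected vertex of the expansions inserted for its nonterminals is adjacent to; a
   pin is only available in the top cell, and for the other cells one records which pins have
   acquired a selected neighbour.  Every copy of a cell can make the same choice because, by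
   simplicity, no edge of an expansion joins two pins: what happens outside a copy never conflicts
   with a choice inside it.  The selected copies form a maximal independent set of the expansion,
   and if all degrees are at most B, then each of its members accounts for at most B members of any
   other independent set.  No degree enters the algorithm.

   The running time is linear because the neighbours of a vertex are kept in linked lists: an edge
   is inspected only when it is inserted and when one of its endpoints is selected. *)

theory Submission
  imports Defs
begin

section \<open>Arrays on the random access machine\<close>

text \<open>Every cell of a specification must have a vertex, yet a cell may contribute nothing to
  the selection. Such a cell becomes a dummy with one vertex, which keeps the cell numbers
  unchanged, and all nonterminals of its type are dropped, so that the dummy never reaches the
  expansion. The output cells need neither edges nor pins: below the top cell a selected vertex is
  never a pin.

  Linear time has to include the set-up of all tables. The code of a cell at address
  \<open>c\<close> is longer than its number of vertices; with vertices numbered from 0, the entries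
  \<open>c + u\<close> of different cells are therefore disjoint, and those of a new cell still hold
  their initial zeros. List nodes need no allocation either: the address of an endpoint in the code
  of an edge names a node, and 0, where the number of cells is stored, can mark the end of a list.

  The size of the selection can be exponential in the input; it is computed by one addition per
  nonterminal and one per vertex selected in a cell, which relies on registers of unbounded
  size.\<close>

datatype com =
    CSkip
  | CConst nat nat
  | CAdd nat nat nat
  | CSub nat nat nat
  | Ld nat nat nat
  | St nat nat nat
  | CSeq com com (infixr ";;" 60)
  | CIf nat com com
  | CWhile nat com

text \<open>Array \<open>k\<close> occupies the addresses from \<open>k * L\<close> on, where
  \<open>L\<close> is the length of the input. Nothing lies behind the last array, so the output may
  grow without a bound known in advance.\<close>

definition valid_index :: "nat \<Rightarrow> nat \<Rightarrow> nat \<Rightarrow> bool" where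
  "valid_index L k x \<longleftrightarrow> k < 8 \<and> x < L \<or> k = 8"

type_synonym config = "(nat \<Rightarrow> nat) \<times> (nat \<Rightarrow> nat \<Rightarrow> nat)"

text \<open>\<open>Ld\<close> and \<open>St\<close> cost 2 because each becomes an address addition
  and a memory access. An invalid index has no rule, so the existence of a run includes that all
  accesses stay inside their arrays.\<close>

inductive hexec :: "nat \<Rightarrow> com \<Rightarrow> config \<Rightarrow> nat \<Rightarrow> config \<Rightarrow> bool" for L where
  "hexec L CSkip s 1 s"
| "hexec L (CConst d k) (r, A) 1 (r(d := k), A)"
| "hexec L (CAdd d a b) (r, A) 1 (r(d := r a + r b), A)"
| "hexec L (CSub d a b) (r, A) 1 (r(d := r a - r b), A)"
| "valid_index L k (r a) \<Longrightarrow> hexec L (Ld d k a) (r, A) 2 (r(d := A k (r a)), A)"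
| "valid_index L k (r a) \<Longrightarrow> hexec L (St k a b) (r, A) 2 (r, A(k := (A k)(r a := r b)))"
| "hexec L p s t s' \<Longrightarrow> hexec L q s' t' s'' \<Longrightarrow> hexec L (p ;; q) s (t + t') s''"
| "fst s b \<noteq> 0 \<Longrightarrow> hexec L p s t s' \<Longrightarrow> hexec L (CIf b p q) s (1 + t) s'"
| "fst s b = 0 \<Longrightarrow> hexec L q s t s' \<Longrightarrow> hexec L (CIf b p q) s (1 + t) s'"
| "fst s b \<noteq> 0 \<Longrightarrow> hexec L p s t s' \<Longrightarrow> hexec L (CWhile b p) s' t' s'' \<Longrightarrow>
    hexec L (CWhile b p) s (1 + t + t') s''"
| "fst s b = 0 \<Longrightarrow> hexec L (CWhile b p) s 1 s"

section \<open>Simulation of array programs by the machine\<close>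

fun compile :: "com \<Rightarrow> ram" where
  "compile CSkip = Skip"
| "compile (CConst d k) = Const (d + 20) k"
| "compile (CAdd d a b) = Add (d + 20) (a + 20) (b + 20)"
| "compile (CSub d a b) = Sub (d + 20) (a + 20) (b + 20)"
| "compile (Ld d k a) = Seq (Add 0 (k + 1) (a + 20)) (Load (d + 20) 0)"
| "compile (St k a b) = Seq (Add 0 (k + 1) (a + 20)) (Store 0 (b + 20))"
| "compile (p ;; q) = Seq (compile p) (compile q)"
| "compile (CIf b p q) = If (b + 20) (compile p) (compile q)"
| "compile (CWhile b p) = While (b + 20) (compile p)"

text \<open>Machine register 0 is scratch space for addresses and is left unconstrained; registers 1
  to 9 hold the base addresses. Program registers are shifted by 20 to stay clear of them.\<close>

definition represents :: "nat \<Rightarrow> config \<Rightarrow> ram_state \<Rightarrow> bool" where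
  "represents L s z \<longleftrightarrow> (\<forall>d. fst z (d + 20) = fst s d) \<and> (\<forall>k\<le>8. fst z (k + 1) = k * L) \<and>
     (\<forall>k x. valid_index L k x \<longrightarrow> snd z (k * L + x) = snd s k x)"

text \<open>Needed for stores: since arrays do not overlap, writing one entry leaves every other
  represented entry alone.\<close>

lemma valid_index_inj:
  assumes "valid_index L k x" "valid_index L k' x'" "k * L + x = k' * L + x'"
  shows "k = k' \<and> x = x'"
proof -
  have less: "k * L + x < k' * L + x'" if "k < k'" "valid_index L k x" "valid_index L k' x'"
    for k x k' x'
  proof -
    have "x < L" using that by (auto simp: valid_index_def)
    moreover have "Suc k * L \<le> k' * L" using that by (intro mult_le_mono1) simp
    ultimately show ?thesis by simp
  qed
  have "\<not> k < k'" "\<not> k' < k" using less assms by (metis less_irrefl)+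
  then show ?thesis using assms(3) by simp
qed

text \<open>The time carries over exactly, because the cost of each array command is the number of
  steps of its translation.\<close>

lemma compile_correct:
  assumes "hexec L c s t s'" "represents L s z"
  shows "\<exists>z'. exec (compile c) z t z' \<and> represents L s' z'"
  using assms
proof (induction arbitrary: z)
  case (1 s)
  then show ?case by (metis compile.simps(1) exec.Skip)
next
  case (2 d k r A)
  obtain R m where [simp]: "z = (R, m)" by (cases z)
  have "exec (compile (CConst d k)) z 1 (R(d + 20 := k), m)"
    unfolding compile.simps \<open>z = (R, m)\<close> by (rule exec.intros)
  moreover have "represents L (r(d := k), A) (R(d + 20 := k), m)"
    using 2 by (auto simp: represents_def)
  ultimately show ?case by blast
next
  case (3 d a b r A)
  obtain R m where [simp]: "z = (R, m)" by (cases z)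
  have "exec (compile (CAdd d a b)) z 1 (R(d + 20 := R (a + 20) + R (b + 20)), m)"
    unfolding compile.simps \<open>z = (R, m)\<close> by (rule exec.intros)
  moreover have "represents L (r(d := r a + r b), A) (R(d + 20 := R (a + 20) + R (b + 20)), m)"
    using 3 by (auto simp: represents_def)
  ultimately show ?case by blast
next
  case (4 d a b r A)
  obtain R m where [simp]: "z = (R, m)" by (cases z)
  have "exec (compile (CSub d a b)) z 1 (R(d + 20 := R (a + 20) - R (b + 20)), m)"
    unfolding compile.simps \<open>z = (R, m)\<close> by (rule exec.intros)
  moreover have "represents L (r(d := r a - r b), A) (R(d + 20 := R (a + 20) - R (b + 20)), m)"
    using 4 by (auto simp: represents_def)
  ultimately show ?case by blast
next
  case (5 k r a d A)
  obtain R m where [simp]: "z = (R, m)" by (cases z)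
  let ?R = "R(0 := R (k + 1) + R (a + 20))"
  have "exec (compile (Ld d k a)) z (1 + 1) (?R(d + 20 := m (?R 0)), m)"
    unfolding compile.simps \<open>z = (R, m)\<close> by (rule exec.Seq[OF exec.Add exec.Load])
  moreover have "k \<le> 8" using 5 by (auto simp: valid_index_def)
  then have "represents L (r(d := A k (r a)), A) (?R(d + 20 := m (?R 0)), m)"
    using 5 by (auto simp: represents_def)
  ultimately show ?case unfolding one_add_one by blast
next
  case (6 k r a b A)
  obtain R m where z [simp]: "z = (R, m)" by (cases z)
  let ?R = "R(0 := R (k + 1) + R (a + 20))"
  have *: "exec (compile (St k a b)) z (1 + 1) (?R, m(?R 0 := ?R (b + 20)))"
    unfolding compile.simps \<open>z = (R, m)\<close> by (rule exec.Seq[OF exec.Add exec.Store])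
  have "k \<le> 8" using 6 by (auto simp: valid_index_def)
  then have "?R 0 = k * L + r a" "?R (b + 20) = r b" using 6 by (auto simp: represents_def)
  then have "represents L (r, A(k := (A k)(r a := r b))) (?R, m(?R 0 := ?R (b + 20)))"
    using 6 by (auto simp: represents_def dest: valid_index_inj)
  with * show ?case unfolding one_add_one by blast
next
  case (7 p s t s' q t' s'')
  then obtain z1 z2 where "exec (compile p) z t z1" "exec (compile q) z1 t' z2"
    "represents L s'' z2" by blast
  then show ?case unfolding compile.simps by (blast intro: exec.Seq)
next
  case (8 s b p t s' q)
  then obtain z' where "exec (compile p) z t z'" "represents L s' z'" by blast
  moreover have "fst z (b + 20) \<noteq> 0" using 8 by (simp add: represents_def)
  ultimately show ?case unfolding compile.simps by (blast intro: exec.IfTrue)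
next
  case (9 s b q t s' p)
  then obtain z' where "exec (compile q) z t z'" "represents L s' z'" by blast
  moreover have "fst z (b + 20) = 0" using 9 by (simp add: represents_def)
  ultimately show ?case unfolding compile.simps by (blast intro: exec.IfFalse)
next
  case (10 s b p t s' t' s'')
  then obtain z1 z2 where "exec (compile p) z t z1"
    "exec (compile (CWhile b p)) z1 t' z2" "represents L s'' z2" by blast
  moreover have "fst z (b + 20) \<noteq> 0" using 10 by (simp add: represents_def)
  ultimately show ?case unfolding compile.simps by (blast intro: exec.WhileTrue)
next
  case (11 s b p)
  then have "fst z (b + 20) = 0" by (simp add: represents_def)
  with 11 show ?case unfolding compile.simps by (blast intro: exec.WhileFalse)
qed

section \<open>Frames and weakest preconditions with running time\<close>

fun reg_mods :: "com \<Rightarrow> nat set" where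
  "reg_mods (CConst d k) = {d}"
| "reg_mods (CAdd d a b) = {d}"
| "reg_mods (CSub d a b) = {d}"
| "reg_mods (Ld d k a) = {d}"
| "reg_mods (p ;; q) = reg_mods p \<union> reg_mods q"
| "reg_mods (CIf b p q) = reg_mods p \<union> reg_mods q"
| "reg_mods (CWhile b p) = reg_mods p"
| "reg_mods _ = {}"

fun array_mods :: "com \<Rightarrow> nat set" where
  "array_mods (St k a b) = {k}"
| "array_mods (p ;; q) = array_mods p \<union> array_mods q"
| "array_mods (CIf b p q) = array_mods p \<union> array_mods q"
| "array_mods (CWhile b p) = array_mods p"
| "array_mods _ = {}"

text \<open>An array counts as modified as a whole; that part of it survives has to be stated in a
  postcondition.\<close>

definition frame :: "com \<Rightarrow> (nat \<Rightarrow> nat) \<Rightarrow> (nat \<Rightarrow> nat \<Rightarrow> nat) \<Rightarrow> (nat \<Rightarrow> nat) \<Rightarrow>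
    (nat \<Rightarrow> nat \<Rightarrow> nat) \<Rightarrow> bool" where
  "frame p r A r' A' \<longleftrightarrow> (\<forall>x. x \<notin> reg_mods p \<longrightarrow> r' x = r x) \<and>
     (\<forall>k. k \<notin> array_mods p \<longrightarrow> A' k = A k)"

lemma hexec_frame: "hexec L p s t s' \<Longrightarrow> frame p (fst s) (snd s) (fst s') (snd s')"
  by (induction rule: hexec.induct) (auto simp: frame_def)

text \<open>The first argument of a postcondition is the time, counted from the start of the whole run.\<close>

definition wp :: "nat \<Rightarrow> com \<Rightarrow> (nat \<Rightarrow> (nat \<Rightarrow> nat) \<Rightarrow> (nat \<Rightarrow> nat \<Rightarrow> nat) \<Rightarrow> bool) \<Rightarrow>
    nat \<Rightarrow> (nat \<Rightarrow> nat) \<Rightarrow> (nat \<Rightarrow> nat \<Rightarrow> nat) \<Rightarrow> bool" where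
  "wp L c Q t r A \<longleftrightarrow> (\<exists>t' r' A'. hexec L c (r, A) t' (r', A') \<and> Q (t + t') r' A')"

lemma hexec_simps:
  "hexec L CSkip s u s' \<longleftrightarrow> u = 1 \<and> s' = s"
  "hexec L (CConst d k) (r, A) u s' \<longleftrightarrow> u = 1 \<and> s' = (r(d := k), A)"
  "hexec L (CAdd d a b) (r, A) u s' \<longleftrightarrow> u = 1 \<and> s' = (r(d := r a + r b), A)"
  "hexec L (CSub d a b) (r, A) u s' \<longleftrightarrow> u = 1 \<and> s' = (r(d := r a - r b), A)"
  "hexec L (Ld d k a) (r, A) u s' \<longleftrightarrow>
     valid_index L k (r a) \<and> u = 2 \<and> s' = (r(d := A k (r a)), A)"
  "hexec L (St k a b) (r, A) u s' \<longleftrightarrow>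
     valid_index L k (r a) \<and> u = 2 \<and> s' = (r, A(k := (A k)(r a := r b)))"
  "hexec L (p ;; q) (r, A) u s' \<longleftrightarrow>
     (\<exists>u1 s1 u2. hexec L p (r, A) u1 s1 \<and> hexec L q s1 u2 s' \<and> u = u1 + u2)"
  "r b \<noteq> 0 \<Longrightarrow> hexec L (CIf b p q) (r, A) u s' \<longleftrightarrow>
     (\<exists>v. hexec L p (r, A) v s' \<and> u = 1 + v)"
  "r b = 0 \<Longrightarrow> hexec L (CIf b p q) (r, A) u s' \<longleftrightarrow>
     (\<exists>v. hexec L q (r, A) v s' \<and> u = 1 + v)"
  "r b \<noteq> 0 \<Longrightarrow> hexec L (CWhile b p) (r, A) u s' \<longleftrightarrow>
     (\<exists>u1 s1 u2. hexec L p (r, A) u1 s1 \<and> hexec L (CWhile b p) s1 u2 s' \<and> u = 1 + u1 + u2)"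
  "r b = 0 \<Longrightarrow> hexec L (CWhile b p) (r, A) u s' \<longleftrightarrow> u = 1 \<and> s' = (r, A)"
  by ((subst hexec.simps, auto)[1])+

lemma wp_simps [simp]:
  "wp L CSkip Q t r A \<longleftrightarrow> Q (t + 1) r A"
  "wp L (CConst d k) Q t r A \<longleftrightarrow> Q (t + 1) (r(d := k)) A"
  "wp L (CAdd d a b) Q t r A \<longleftrightarrow> Q (t + 1) (r(d := r a + r b)) A"
  "wp L (CSub d a b) Q t r A \<longleftrightarrow> Q (t + 1) (r(d := r a - r b)) A"
  "wp L (Ld d k a) Q t r A \<longleftrightarrow> valid_index L k (r a) \<and> Q (t + 2) (r(d := A k (r a))) A"
  "wp L (St k a b) Q t r A \<longleftrightarrow>
     valid_index L k (r a) \<and> Q (t + 2) r (A(k := (A k)(r a := r b)))"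
  by (simp_all add: wp_def hexec_simps(1-6))

text \<open>Used with \<open>k = 0\<close> for sequencing and with \<open>k = 1\<close> for one pass
  of a loop, whose test costs one unit.\<close>

lemma wp_bind:
  assumes "\<And>u s'. hexec L p (r, A) u s' \<longleftrightarrow>
    (\<exists>u1 s1 u2. hexec L p1 (r, A) u1 s1 \<and> hexec L p2 s1 u2 s' \<and> u = k + u1 + u2)"
  shows "wp L p Q t r A \<longleftrightarrow> wp L p1 (wp L p2 Q) (t + k) r A"
proof
  assume "wp L p Q t r A"
  then obtain u s' where "hexec L p (r, A) u s'" "Q (t + u) (fst s') (snd s')"
    unfolding wp_def by auto
  moreover from this assms obtain u1 s1 u2 where "hexec L p1 (r, A) u1 s1"
    "hexec L p2 s1 u2 s'" "u = k + u1 + u2" by blast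
  ultimately have "hexec L p1 (r, A) u1 s1" "hexec L p2 s1 u2 s'"
    "Q (t + (k + u1 + u2)) (fst s') (snd s')" by auto
  then show "wp L p1 (wp L p2 Q) (t + k) r A"
    unfolding wp_def by (cases s1, cases s') (simp add: add.assoc, blast)
next
  assume "wp L p1 (wp L p2 Q) (t + k) r A"
  then obtain u1 r1 A1 u2 r2 A2 where "hexec L p1 (r, A) u1 (r1, A1)"
    "hexec L p2 (r1, A1) u2 (r2, A2)" and Q: "Q (t + k + u1 + u2) r2 A2"
    unfolding wp_def by blast
  then have "hexec L p (r, A) (k + u1 + u2) (r2, A2)" using assms by blast
  with Q show "wp L p Q t r A" unfolding wp_def by (auto simp: add.assoc)
qed

lemma wp_Seq [simp]: "wp L (p ;; q) Q t r A \<longleftrightarrow> wp L p (wp L q Q) t r A"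
proof -
  have "hexec L (p ;; q) (r, A) u s' \<longleftrightarrow>
    (\<exists>u1 s1 u2. hexec L p (r, A) u1 s1 \<and> hexec L q s1 u2 s' \<and> u = 0 + u1 + u2)" for u s'
    by (simp add: hexec_simps(7))
  from wp_bind[OF this] show ?thesis by simp
qed

lemma wp_If [simp]:
  "wp L (CIf b p q) Q t r A \<longleftrightarrow>
    (if r b \<noteq> 0 then wp L p Q (t + 1) r A else wp L q Q (t + 1) r A)"
  by (cases "r b = 0"; simp only: wp_def hexec_simps refl if_True if_False not_True_eq_False
      not_False_eq_True add.assoc) blast+

lemma wp_While_unfold:
  "wp L (CWhile b p) Q t r A \<longleftrightarrow>
    (if r b \<noteq> 0 then wp L p (wp L (CWhile b p) Q) (t + 1) r A else Q (t + 1) r A)"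
proof (cases "r b = 0")
  case True
  then show ?thesis by (simp add: wp_def hexec_simps)
next
  case False
  from wp_bind[OF hexec_simps(10)[where r = r and b = b, OF this]] False show ?thesis by simp
qed

text \<open>The frame comes for free with every use, so the specification of a loop only has to
  mention what the loop changes.\<close>

lemma wp_mono:
  assumes "wp L p P t r A"
    and "\<And>t' r' A'. P t' r' A' \<Longrightarrow> frame p r A r' A' \<Longrightarrow> Q t' r' A'"
  shows "wp L p Q t r A"
  using assms hexec_frame unfolding wp_def by fastforce

lemma frame_refl: "frame p r A r A"
  by (simp add: frame_def)

lemma frame_trans: "frame p r A r' A' \<Longrightarrow> frame p r' A' r'' A'' \<Longrightarrow> frame p r A r'' A''"
  by (simp add: frame_def)

text \<open>The list consists of the items that the loop has yet to handle.\<close>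

lemma wp_While:
  assumes "I xs t r A"
    and step: "\<And>y ys t' r' A'. I (y # ys) t' r' A' \<Longrightarrow> frame p r A r' A' \<Longrightarrow>
        r' b \<noteq> 0 \<and> wp L p (I ys) (t' + 1) r' A'"
    and exit: "\<And>t' r' A'. I [] t' r' A' \<Longrightarrow> frame p r A r' A' \<Longrightarrow>
        r' b = 0 \<and> Q (t' + 1) r' A'"
  shows "wp L (CWhile b p) Q t r A"
proof -
  \<comment> \<open>The frame is kept relative to the start of the loop; transitivity carries it
    across each pass.\<close>
  have "wp L (CWhile b p) Q t' r' A'" if "I xs t' r' A'" "frame p r A r' A'" for t' r' A'
    using that
  proof (induction xs arbitrary: t' r' A')
    case Nil
    with exit show ?case by (subst wp_While_unfold) simp
  next
    case (Cons y ys)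
    from step[OF Cons.prems] have b: "r' b \<noteq> 0" and "wp L p (I ys) (t' + 1) r' A'" by auto
    from this(2) have "wp L p (wp L (CWhile b p) Q) (t' + 1) r' A'"
      by (rule wp_mono) (use Cons frame_trans in blast)
    with b show ?case by (subst wp_While_unfold) simp
  qed
  with assms(1) show ?thesis using frame_refl by blast
qed

section \<open>Running an array program on an input\<close>

definition start_arrays :: "nat list \<Rightarrow> nat \<Rightarrow> nat \<Rightarrow> nat" where
  "start_arrays w k x = (if k = 0 \<and> x < length w then w ! x else 0)"

text \<open>Register \<open>k + 1\<close> receives the address of array \<open>k\<close>; the last array is the output.\<close>

definition run_on_arrays :: "com \<Rightarrow> nat \<Rightarrow> ram" where
  "run_on_arrays p q = foldr Seq (map (\<lambda>k. Add (k + 2) (k + 1) 0) [0..<8])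
     (Seq (compile p) (Seq (Add 0 9 1) (Add 1 (q + 20) 1)))"

lemma computes_run_on_arrays:
  assumes "wp (length w) p (\<lambda>t r A. t = T \<and> map (A 8) [0..<r q] = out) 0 (\<lambda>_. 0) (start_arrays w)"
  shows "computes (run_on_arrays p q) w (T + 10) out"
proof -
  \<comment> \<open>\<open>z\<close> is the state once all base addresses are computed: registers 1
    to 9 hold the multiples of the length, and all registers from 10 on are still 0.\<close>
  let ?L = "length w"
  define z where "z = ((\<lambda>x. if x = 0 then ?L else if x < 10 then (x - 1) * ?L else 0),
    snd (input_state w))"
  obtain r A where "hexec ?L p (\<lambda>_. 0, start_arrays w) T (r, A)"
    and out: "map (A 8) [0..<r q] = out"
    using assms by (auto simp: wp_def)
  \<comment> \<open>All arrays except the first begin behind the input and thus contain only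
    zeros.\<close>
  moreover have "\<not> k * ?L + x < ?L" if "0 < k" for k x
    using that by (cases k) auto
  then have "represents ?L (\<lambda>_. 0, start_arrays w) z"
    by (auto simp: represents_def z_def start_arrays_def input_state_def valid_index_def)
  ultimately obtain z' where run: "exec (compile p) z T z'" and rep: "represents ?L (r, A) z'"
    using compile_correct by blast
  obtain R m where z': "z' = (R, m)" by (cases z')
  \<comment> \<open>Register 1 holds the base address of array 0, which is 0; the two final
    additions therefore just copy.\<close>
  define R' where "R' = R(0 := R 9 + R 1)"
  define R'' where "R'' = R'(1 := R' (q + 20) + R' 1)"
  have R'': "R'' 0 = 8 * ?L" "R'' 1 = r q"
    using rep unfolding represents_def z' R''_def R'_def
    by (auto dest: spec[of _ 8] spec[of _ 0])
  have "output_of (R'', m) = out"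
    using rep unfolding output_of_def fst_conv snd_conv R'' out[symmetric]
    by (auto simp: represents_def z' valid_index_def)
  moreover have "exec (run_on_arrays p q) (input_state w) (T + 10) (R'', m)"
  proof -
    let ?m = "snd (input_state w)"
    \<comment> \<open>Multiples of the length arise by repeated addition of register 0. In the state
      before instruction \<open>k\<close>, registers 1 to \<open>k + 1\<close> already hold their
      final values.\<close>
    have chain: "exec (foldr Seq (map (\<lambda>k. Add (k + 2) (k + 1) 0) [k..<8]) c)
        (\<lambda>x. if x = 0 then ?L else if x < k + 2 then (x - 1) * ?L else 0, ?m) (8 - k + t) s"
      if "exec c z t s" "k \<le> 8" for k c t s
      using that(2)
    proof (induction rule: inc_induct)
      case base
      have "fst z = (\<lambda>x. if x = 0 then ?L else if x < 8 + 2 then (x - 1) * ?L else 0)"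
        by (simp add: z_def fun_eq_iff)
      then show ?case using that(1) by (simp add: z_def)
    next
      case (step k)
      let ?R = "\<lambda>k x. if x = 0 then ?L else if x < k + 2 then (x - 1) * ?L else 0"
      have "exec (Add (k + 2) (k + 1) 0) (?R k, ?m) 1
          ((?R k)(k + 2 := ?R k (k + 1) + ?R k 0), ?m)"
        by (rule exec.Add)
      moreover have "(?R k)(k + 2 := ?R k (k + 1) + ?R k 0) = ?R (Suc k)"
        by (auto simp: fun_eq_iff)
      ultimately have "exec (Add (k + 2) (k + 1) 0) (?R k, ?m) 1 (?R (Suc k), ?m)" by simp
      from exec.Seq[OF this step.IH]
      have "exec (Seq (Add (k + 2) (k + 1) 0) (foldr Seq (map (\<lambda>k. Add (k + 2) (k + 1) 0) [Suc k..<8]) c))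
          (?R k, ?m) (1 + (8 - Suc k + t)) s" .
      moreover have "8 - k + t = 1 + (8 - Suc k + t)" using step.hyps by simp
      ultimately show ?case
        using step.hyps by (simp only: upt_conv_Cons list.map foldr_Cons o_apply)
    qed
    have "exec (Seq (compile p) (Seq (Add 0 9 1) (Add 1 (q + 20) 1))) z (T + (1 + 1)) (R'', m)"
      unfolding R''_def R'_def using run z' by (blast intro: exec.intros)
    note chain[OF this, of 0]
    moreover have "input_state w = (\<lambda>x. if x = 0 then ?L else if x < 0 + 2 then (x - 1) * ?L else 0, ?m)"
      by (auto simp: input_state_def fun_eq_iff)
    ultimately show ?thesis by (simp add: run_on_arrays_def add.commute)
  qed
  ultimately show ?thesis unfolding computes_def by blast
qed

section \<open>Selections in a hierarchical specification\<close>

text \<open>In each copy of a lower cell its pins are vertices of the surrounding cell, which alone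
  decides about them. Pins of the top cell are identified with nothing.\<close>

definition excluded :: "cell list \<Rightarrow> nat \<Rightarrow> nat set" where
  "excluded \<Gamma> i = (if Suc i = length \<Gamma> then {} else set (pins (\<Gamma> ! i))) \<union> dom (nonterm (\<Gamma> ! i))"

text \<open>Only \<open>Y j\<close> for types \<open>j\<close> of nonterminals in cell
  \<open>i\<close> occurs, and these are smaller than \<open>i\<close>; the equation for
  \<open>Y\<close> in a maximal selection is thus a recursion.\<close>

definition blocked_through :: "cell list \<Rightarrow> (nat \<Rightarrow> nat set) \<Rightarrow> nat \<Rightarrow> nat set" where
  "blocked_through \<Gamma> Y i = {xs ! l | v j xs l. nonterm (\<Gamma> ! i) v = Some (j, xs) \<and>
     l < length xs \<and> pins (\<Gamma> ! j) ! l \<in> Y j}"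

text \<open>
  In cell \<open>i\<close> the set \<open>S i\<close> is selected, and \<open>Y i\<close> consists of the vertices that have a selected
  neighbour in the expansion.
\<close>

definition maximal_selection :: "cell list \<Rightarrow> (nat \<Rightarrow> nat set) \<Rightarrow> (nat \<Rightarrow> nat set) \<Rightarrow> bool" where
  "maximal_selection \<Gamma> S Y \<longleftrightarrow> (\<forall>i < length \<Gamma>.
     S i \<subseteq> verts (graph (\<Gamma> ! i)) - excluded \<Gamma> i \<and>
     Y i = blocked_through \<Gamma> Y i \<union> {x. \<exists>u\<in>S i. {u, x} \<in> edges (graph (\<Gamma> ! i))} \<and>
     S i \<inter> Y i = {} \<and>
     verts (graph (\<Gamma> ! i)) - excluded \<Gamma> i - S i \<subseteq> Y i)"

text \<open>The names agree with those in the expansion: a selected vertex of a copy is not a pin,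
  so gluing merely prepends the nonterminal.\<close>

fun selected :: "cell list \<Rightarrow> (nat \<Rightarrow> nat set) \<Rightarrow> nat \<Rightarrow> nat list set" where
  "selected \<Gamma> S i = (\<lambda>u. [u]) ` S i \<union>
     \<Union>{(#) v ` (if j < i then selected \<Gamma> S j else {}) | v j xs. nonterm (\<Gamma> ! i) v = Some (j, xs)}"

declare selected.simps [simp del]

section \<open>Vertices and edges of an expansion\<close>

lemma cell_okD:
  assumes "hier_spec \<Gamma>" "i < length \<Gamma>"
  shows "simple_graph (graph (\<Gamma> ! i))" "distinct (pins (\<Gamma> ! i))"
    "set (pins (\<Gamma> ! i)) \<subseteq> verts (graph (\<Gamma> ! i))"
    "dom (nonterm (\<Gamma> ! i)) \<subseteq> verts (graph (\<Gamma> ! i))"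
    "set (pins (\<Gamma> ! i)) \<inter> dom (nonterm (\<Gamma> ! i)) = {}"
  using assms unfolding hier_spec_def cell_ok_def by blast+

lemma edge_vertsD:
  assumes "simple_graph G" "{u, v} \<in> edges G"
  shows "u \<in> verts G" "v \<in> verts G" "u \<noteq> v"
proof -
  from assms obtain a b where "{u, v} = {a, b}" "a \<in> verts G" "b \<in> verts G" "a \<noteq> b"
    unfolding simple_graph_def by blast
  then show "u \<in> verts G" "v \<in> verts G" "u \<noteq> v" by (auto simp: doubleton_eq_iff)
qed

lemma nontermD:
  assumes "hier_spec \<Gamma>" "i < length \<Gamma>" "nonterm (\<Gamma> ! i) v = Some (j, xs)"
  shows "j < i" "distinct xs" "length xs = length (pins (\<Gamma> ! j))"
    "set xs \<subseteq> verts (graph (\<Gamma> ! i)) - dom (nonterm (\<Gamma> ! i))"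
proof -
  have *: "j < i \<and> nbrs (graph (\<Gamma> ! i)) v \<inter> dom (nonterm (\<Gamma> ! i)) = {} \<and> distinct xs \<and>
      set xs = nbrs (graph (\<Gamma> ! i)) v \<and> length xs = length (pins (\<Gamma> ! j))"
    using assms unfolding hier_spec_def cell_ok_def by blast
  then show "j < i" "distinct xs" "length xs = length (pins (\<Gamma> ! j))" by auto
  have "nbrs (graph (\<Gamma> ! i)) v \<subseteq> verts (graph (\<Gamma> ! i))"
    using edge_vertsD[OF cell_okD(1)[OF assms(1,2)]] unfolding nbrs_def by blast
  with * show "set xs \<subseteq> verts (graph (\<Gamma> ! i)) - dom (nonterm (\<Gamma> ! i))" by blast
qed

lemma edge_doubleton:
  assumes "simple_graph G" "e \<in> edges G"
  obtains u v where "e = {u, v}"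
  using assms unfolding simple_graph_def by blast

lemma glue_nth:
  assumes "distinct ps" "length xs = length ps" "l < length ps"
  shows "glue ps xs v [ps ! l] = [xs ! l]"
proof -
  have "map_of (zip (map (\<lambda>p. [p]) ps) xs) [ps ! l] = Some (xs ! l)"
    by (rule map_of_is_SomeI)
      (use assms in \<open>auto simp: distinct_map inj_on_def in_set_conv_nth intro!: exI[of _ l]\<close>)
  then show ?thesis by (simp add: glue_def)
qed

lemma glue_other:
  assumes "x \<notin> (\<lambda>p. [p]) ` set ps" "length xs = length ps"
  shows "glue ps xs v x = v # x"
proof -
  have "map_of (zip (map (\<lambda>p. [p]) ps) xs) x = None"
    using assms by (auto simp: map_of_zip_is_None)
  then show ?thesis by (simp add: glue_def)
qed

lemma glue_cases [consumes 2, case_names pin other]: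
  assumes "distinct ps" "length xs = length ps"
  obtains (pin) l where "l < length ps" "x = [ps ! l]" "glue ps xs v x = [xs ! l]"
  | (other) "x \<notin> (\<lambda>p. [p]) ` set ps" "glue ps xs v x = v # x"
proof (cases "x \<in> (\<lambda>p. [p]) ` set ps")
  case True
  then obtain l where "l < length ps" "x = [ps ! l]" by (auto simp: in_set_conv_nth)
  with pin glue_nth[OF assms] show thesis by simp
next
  case False
  with other glue_other[OF _ assms(2)] show thesis by simp
qed

text \<open>The termination guard disappears, since every type occurring in cell \<open>i\<close> is
  smaller than \<open>i\<close>.\<close>

lemma expansion_at_unfold:
  assumes "hier_spec \<Gamma>" "i < length \<Gamma>"
  shows "verts (expansion_at \<Gamma> i) =
      (\<lambda>u. [u]) ` (verts (graph (\<Gamma> ! i)) - dom (nonterm (\<Gamma> ! i))) \<union>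
      \<Union>{glue (pins (\<Gamma> ! j)) xs v ` verts (expansion_at \<Gamma> j) | v j xs.
          nonterm (\<Gamma> ! i) v = Some (j, xs)}"
    and "edges (expansion_at \<Gamma> i) =
      {(\<lambda>u. [u]) ` e | e. e \<in> edges (graph (\<Gamma> ! i)) \<and> e \<inter> dom (nonterm (\<Gamma> ! i)) = {}} \<union>
      \<Union>{image (glue (pins (\<Gamma> ! j)) xs v) ` edges (expansion_at \<Gamma> j) | v j xs.
          nonterm (\<Gamma> ! i) v = Some (j, xs)}"
  by ((subst expansion_at.simps, simp only: expand_cell_def fst_conv snd_conv,
      intro arg_cong2[where f = "(\<union>)"] refl arg_cong[where f = Union] Collect_cong ex_cong1
        rev_conj_cong, auto dest: nontermD(1)[OF assms])[1])+

text \<open>Pins of an inserted copy are neighbours of its nonterminal, hence terminals of the cell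
  itself; only the other vertices of the copy are new.\<close>

lemma vert_expansion_cases [consumes 3, case_names here inner]:
  assumes "hier_spec \<Gamma>" "i < length \<Gamma>" "x \<in> verts (expansion_at \<Gamma> i)"
  obtains (here) u where "u \<in> verts (graph (\<Gamma> ! i)) - dom (nonterm (\<Gamma> ! i))" "x = [u]"
  | (inner) v j xs y where "nonterm (\<Gamma> ! i) v = Some (j, xs)" "y \<in> verts (expansion_at \<Gamma> j)"
      "y \<notin> (\<lambda>p. [p]) ` set (pins (\<Gamma> ! j))" "x = v # y"
proof -
  from assms(3) consider u where "u \<in> verts (graph (\<Gamma> ! i)) - dom (nonterm (\<Gamma> ! i))" "x = [u]"
    | v j xs y where "nonterm (\<Gamma> ! i) v = Some (j, xs)" "y \<in> verts (expansion_at \<Gamma> j)"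
      "x = glue (pins (\<Gamma> ! j)) xs v y"
    unfolding expansion_at_unfold(1)[OF assms(1,2)] by blast
  then show thesis
  proof cases
    case 1
    with here show thesis by blast
  next
    case (2 v j xs y)
    note nt = nontermD[OF assms(1,2) 2(1)]
    then have dist: "distinct (pins (\<Gamma> ! j))" using cell_okD(2)[OF assms(1)] assms(2) by simp
    show thesis
      using dist nt(3)
    proof (cases rule: glue_cases[where x = y and v = v])
      case (pin l)
      with nt 2 have "xs ! l \<in> verts (graph (\<Gamma> ! i)) - dom (nonterm (\<Gamma> ! i))"
        by (metis nth_mem subsetD)
      with pin 2 here show thesis by simp
    next
      case other
      with 2 inner show thesis by simp
    qed
  qed
qed

lemma vert_expansion_here:
  assumes "hier_spec \<Gamma>" "i < length \<Gamma>" "u \<in> verts (graph (\<Gamma> ! i)) - dom (nonterm (\<Gamma> ! i))"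
  shows "[u] \<in> verts (expansion_at \<Gamma> i)"
  using assms(3) unfolding expansion_at_unfold(1)[OF assms(1,2)] by blast

lemma vert_expansion_inner:
  assumes "hier_spec \<Gamma>" "i < length \<Gamma>" "nonterm (\<Gamma> ! i) v = Some (j, xs)"
    "y \<in> verts (expansion_at \<Gamma> j)"
  shows "glue (pins (\<Gamma> ! j)) xs v y \<in> verts (expansion_at \<Gamma> i)"
  using assms(3,4) unfolding expansion_at_unfold(1)[OF assms(1,2)] by blast

lemma finite_verts_expansion:
  assumes "hier_spec \<Gamma>" "i < length \<Gamma>"
  shows "finite (verts (expansion_at \<Gamma> i))"
  using assms(2)
proof (induction i rule: less_induct)
  case (less i)
  let ?T = "dom (nonterm (\<Gamma> ! i))"
  have fin: "finite (verts (graph (\<Gamma> ! i)))"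
    using cell_okD(1)[OF assms(1) less.prems] by (simp add: simple_graph_def)
  then have T: "finite ?T" using cell_okD(4)[OF assms(1) less.prems] by (rule rev_finite_subset)
  have "verts (expansion_at \<Gamma> i) \<subseteq> (\<lambda>u. [u]) ` verts (graph (\<Gamma> ! i)) \<union>
    (\<Union>v\<in>?T. (#) v ` verts (expansion_at \<Gamma> (fst (the (nonterm (\<Gamma> ! i) v)))))"
    (is "_ \<subseteq> ?U")
  proof
    fix x assume "x \<in> verts (expansion_at \<Gamma> i)"
    then show "x \<in> ?U" by (cases rule: vert_expansion_cases[OF assms(1) less.prems]) force+
  qed
  moreover have "finite ?U"
  proof (intro finite_UnI finite_imageI fin finite_UN_I T)
    fix v assume "v \<in> ?T"
    then obtain j xs where nt: "nonterm (\<Gamma> ! i) v = Some (j, xs)" by auto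
    with nontermD(1)[OF assms(1) less.prems nt] less
    show "finite (verts (expansion_at \<Gamma> (fst (the (nonterm (\<Gamma> ! i) v)))))" by simp
  qed
  ultimately show ?case by (rule finite_subset)
qed

lemma verts_expansion_nonempty:
  assumes "hier_spec \<Gamma>" "i < length \<Gamma>"
  shows "verts (expansion_at \<Gamma> i) \<noteq> {}"
  using assms(2)
proof (induction i rule: less_induct)
  case (less i)
  obtain u where u: "u \<in> verts (graph (\<Gamma> ! i))"
    using cell_okD(1)[OF assms(1) less.prems] by (auto simp: simple_graph_def)
  show ?case
  proof (cases "nonterm (\<Gamma> ! i) u")
    case None
    with u vert_expansion_here[OF assms(1) less.prems] show ?thesis by blast
  next
    case (Some a)
    then obtain j xs where nt: "nonterm (\<Gamma> ! i) u = Some (j, xs)" by (cases a) simp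
    have "j < i" by (rule nontermD(1)[OF assms(1) less.prems nt])
    with less have "verts (expansion_at \<Gamma> j) \<noteq> {}" by simp
    with vert_expansion_inner[OF assms(1) less.prems nt] show ?thesis by blast
  qed
qed

lemma edge_expansion_elim [consumes 3, case_names here inner]:
  assumes "hier_spec \<Gamma>" "i < length \<Gamma>" "e \<in> edges (expansion_at \<Gamma> i)"
  obtains (here) e' where "e = (\<lambda>u. [u]) ` e'" "e' \<in> edges (graph (\<Gamma> ! i))"
      "e' \<inter> dom (nonterm (\<Gamma> ! i)) = {}"
  | (inner) v j xs e' where "nonterm (\<Gamma> ! i) v = Some (j, xs)"
      "e' \<in> edges (expansion_at \<Gamma> j)" "e = glue (pins (\<Gamma> ! j)) xs v ` e'"
proof -
  from assms(3) show thesis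
    unfolding expansion_at_unfold(2)[OF assms(1,2)]
  proof (elim UnE UnionE CollectE exE conjE)
    fix X v j xs
    assume nt: "nonterm (\<Gamma> ! i) v = Some (j, xs)"
    assume "e \<in> X" "X = image (glue (pins (\<Gamma> ! j)) xs v) ` edges (expansion_at \<Gamma> j)"
    then have "e \<in> image (glue (pins (\<Gamma> ! j)) xs v) ` edges (expansion_at \<Gamma> j)" by simp
    then obtain e' where "e = glue (pins (\<Gamma> ! j)) xs v ` e'" "e' \<in> edges (expansion_at \<Gamma> j)"
      by (rule imageE)
    with nt inner show thesis by simp
  qed (rule here)
qed

text \<open>Edges are unordered, so the two given endpoints may match the original ones in either
  order; swapping the original edge covers both.\<close>

lemma edge_expansion_cases [consumes 3, case_names here inner]:
  assumes "hier_spec \<Gamma>" "i < length \<Gamma>" "{x, y} \<in> edges (expansion_at \<Gamma> i)"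
  obtains (here) u v where "{u, v} \<in> edges (graph (\<Gamma> ! i))" "u \<notin> dom (nonterm (\<Gamma> ! i))"
      "v \<notin> dom (nonterm (\<Gamma> ! i))" "x = [u]" "y = [v]"
  | (inner) v j xs x' y' where "nonterm (\<Gamma> ! i) v = Some (j, xs)"
      "{x', y'} \<in> edges (expansion_at \<Gamma> j)"
      "x = glue (pins (\<Gamma> ! j)) xs v x'" "y = glue (pins (\<Gamma> ! j)) xs v y'"
proof -
  \<comment> \<open>An edge of an expansion is an image of a set, so that it has the form of a pair
    needs an induction of its own.\<close>
  have two: "\<exists>x y. e = {x, y}" if "e \<in> edges (expansion_at \<Gamma> i)" "i < length \<Gamma>" for e i
    using that
  proof (induction i arbitrary: e rule: less_induct)
    case (less i)
    from assms(1) less.prems(2,1) show ?case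
    proof (cases rule: edge_expansion_elim)
      case (here e')
      obtain u v where "e' = {u, v}"
        using edge_doubleton[OF cell_okD(1)[OF assms(1) less.prems(2)] here(2)] .
      with here have "e = {[u], [v]}" by simp
      then show ?thesis by blast
    next
      case (inner v j xs e')
      have "j < i" by (rule nontermD(1)[OF assms(1) less.prems(2) inner(1)])
      moreover from this have "j < length \<Gamma>" using less.prems(2) by simp
      ultimately obtain x y where "e' = {x, y}" using less.IH[OF _ inner(2)] by blast
      with inner(3) have "e = {glue (pins (\<Gamma> ! j)) xs v x, glue (pins (\<Gamma> ! j)) xs v y}" by simp
      then show ?thesis by blast
    qed
  qed
  from assms show thesis
  proof (cases rule: edge_expansion_elim)
    case (here e)
    obtain u v where "e = {u, v}"
      using edge_doubleton[OF cell_okD(1)[OF assms(1,2)] here(2)] .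
    with here(1) have "{x, y} = {[u], [v]}" by simp
    then have "x = [u] \<and> y = [v] \<or> x = [v] \<and> y = [u]" by (simp add: doubleton_eq_iff)
    moreover have "{u, v} \<in> edges (graph (\<Gamma> ! i))" "{v, u} \<in> edges (graph (\<Gamma> ! i))"
      "u \<notin> dom (nonterm (\<Gamma> ! i))" "v \<notin> dom (nonterm (\<Gamma> ! i))"
      using here \<open>e = {u, v}\<close> by (simp_all add: insert_commute)
    ultimately show thesis using that(1)[of u v] that(1)[of v u] by blast
  next
    case (inner v j xs e)
    have "j < length \<Gamma>" using nontermD(1)[OF assms(1,2) inner(1)] assms(2) by simp
    with inner(2) two obtain x' y' where e: "e = {x', y'}" by blast
    let ?g = "glue (pins (\<Gamma> ! j)) xs v"
    from inner(3) e have "{x, y} = {?g x', ?g y'}" by simp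
    then have "x = ?g x' \<and> y = ?g y' \<or> x = ?g y' \<and> y = ?g x'"
      by (simp add: doubleton_eq_iff)
    moreover have "{x', y'} \<in> edges (expansion_at \<Gamma> j)" "{y', x'} \<in> edges (expansion_at \<Gamma> j)"
      using inner(2) e by (simp_all add: insert_commute)
    ultimately show thesis using that(2)[OF inner(1), of x' y'] that(2)[OF inner(1), of y' x'] by blast
  qed
qed

lemma edge_expansion_here:
  assumes "hier_spec \<Gamma>" "i < length \<Gamma>" "{u, v} \<in> edges (graph (\<Gamma> ! i))"
    "u \<notin> dom (nonterm (\<Gamma> ! i))" "v \<notin> dom (nonterm (\<Gamma> ! i))"
  shows "{[u], [v]} \<in> edges (expansion_at \<Gamma> i)"
  unfolding expansion_at_unfold(2)[OF assms(1,2)]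
  by (rule UnI1) (use assms in \<open>auto intro!: exI[of _ "{u, v}"]\<close>)

lemma edge_expansion_inner:
  assumes "hier_spec \<Gamma>" "i < length \<Gamma>" "nonterm (\<Gamma> ! i) v = Some (j, xs)"
    "{x, y} \<in> edges (expansion_at \<Gamma> j)"
  shows "{glue (pins (\<Gamma> ! j)) xs v x, glue (pins (\<Gamma> ! j)) xs v y} \<in> edges (expansion_at \<Gamma> i)"
proof -
  have "glue (pins (\<Gamma> ! j)) xs v ` {x, y} \<in> edges (expansion_at \<Gamma> i)"
    using assms(3,4) unfolding expansion_at_unfold(2)[OF assms(1,2)] by blast
  then show ?thesis by simp
qed

lemma edge_expansion_verts:
  assumes "hier_spec \<Gamma>" "i < length \<Gamma>" "{x, y} \<in> edges (expansion_at \<Gamma> i)"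
  shows "x \<in> verts (expansion_at \<Gamma> i)" "y \<in> verts (expansion_at \<Gamma> i)"
proof -
  have "x \<in> verts (expansion_at \<Gamma> i) \<and> y \<in> verts (expansion_at \<Gamma> i)"
    using assms(2,3)
  proof (induction i arbitrary: x y rule: less_induct)
    case (less i)
    from assms(1) less.prems show ?case
    proof (cases rule: edge_expansion_cases)
      case (here u v)
      with edge_vertsD[OF cell_okD(1)[OF assms(1) less.prems(1)] here(1)]
      show ?thesis by (auto intro!: vert_expansion_here[OF assms(1) less.prems(1)])
    next
      case (inner v j xs x' y')
      have "j < i" by (rule nontermD(1)[OF assms(1) less.prems(1) inner(1)])
      with less.IH[OF this _ inner(2)] less.prems inner
      show ?thesis by (auto intro!: vert_expansion_inner[OF assms(1) less.prems(1)])
    qed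
  qed
  then show "x \<in> verts (expansion_at \<Gamma> i)" "y \<in> verts (expansion_at \<Gamma> i)" by auto
qed

text \<open>Simplicity passes from cells to expansions: an edge that comes from a copy and joins
  vertices of the cell itself joins two pins of that copy, which the induction hypothesis
  forbids.\<close>

lemma no_edge_between_pins:
  assumes "hier_spec \<Gamma>" "simple_spec \<Gamma>" "i < length \<Gamma>"
    "p \<in> set (pins (\<Gamma> ! i))" "q \<in> set (pins (\<Gamma> ! i))"
  shows "{[p], [q]} \<notin> edges (expansion_at \<Gamma> i)"
  using assms(3-)
proof (induction i arbitrary: p q rule: less_induct)
  case (less i)
  show ?case
  proof
    assume "{[p], [q]} \<in> edges (expansion_at \<Gamma> i)"
    with assms(1) less.prems(1) show False
    proof (cases rule: edge_expansion_cases)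
      case (here u v)
      with less.prems assms(2) show False by (auto simp: simple_spec_def)
    next
      case (inner v j xs x' y')
      note nt = nontermD[OF assms(1) less.prems(1) inner(1)]
      have j: "j < length \<Gamma>" using nt less.prems by simp
      \<comment> \<open>A vertex of the copy that is not a pin is named \<open>v # z\<close>; this
        has length one only for the empty \<open>z\<close>, which names no vertex.\<close>
      have "x' \<in> (\<lambda>p. [p]) ` set (pins (\<Gamma> ! j)) \<and> y' \<in> (\<lambda>p. [p]) ` set (pins (\<Gamma> ! j))"
      proof (rule ccontr)
        assume "\<not> ?thesis"
        then obtain z p' where "z \<in> verts (expansion_at \<Gamma> j)" "[p'] = v # z"
          using inner glue_other[OF _ nt(3)] edge_expansion_verts[OF assms(1) j inner(2)] by metis
        then have "[] \<in> verts (expansion_at \<Gamma> j)" by simp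
        then show False by (cases rule: vert_expansion_cases[OF assms(1) j]) auto
      qed
      with less.IH[OF nt(1) j] inner(2) show False by blast
    qed
  qed
qed

text \<open>This separates the names \<open>[u]\<close> of the vertices of a cell from the names
  \<open>v # x\<close> inside inserted copies.\<close>

lemma Nil_notin_expansion:
  assumes "hier_spec \<Gamma>" "i < length \<Gamma>"
  shows "[] \<notin> verts (expansion_at \<Gamma> i)"
  using vert_expansion_cases[OF assms] by blast

section \<open>A maximal selection yields a maximal independent set of the expansion\<close>

context
  fixes \<Gamma> S Y
  assumes hier: "hier_spec \<Gamma>" and simple: "simple_spec \<Gamma>" and sel: "maximal_selection \<Gamma> S Y"
begin

lemma selectionD:
  assumes "i < length \<Gamma>"
  shows "S i \<subseteq> verts (graph (\<Gamma> ! i)) - excluded \<Gamma> i"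
    "Y i = blocked_through \<Gamma> Y i \<union> {x. \<exists>u\<in>S i. {u, x} \<in> edges (graph (\<Gamma> ! i))}"
    "S i \<inter> Y i = {}" "verts (graph (\<Gamma> ! i)) - excluded \<Gamma> i - S i \<subseteq> Y i"
  using sel assms unfolding maximal_selection_def by blast+

lemma selected_unfold:
  assumes "i < length \<Gamma>"
  shows "selected \<Gamma> S i = (\<lambda>u. [u]) ` S i \<union>
     \<Union>{(#) v ` selected \<Gamma> S j | v j xs. nonterm (\<Gamma> ! i) v = Some (j, xs)}"
  by (subst selected.simps, intro arg_cong2[where f = "(\<union>)"] refl arg_cong[where f = Union]
      Collect_cong ex_cong1 rev_conj_cong, auto dest: nontermD(1)[OF hier assms])

lemma selected_iff:
  assumes "i < length \<Gamma>"
  shows "x \<in> selected \<Gamma> S i \<longleftrightarrow> (\<exists>u. u \<in> S i \<and> x = [u]) \<or>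
    (\<exists>v j xs y. nonterm (\<Gamma> ! i) v = Some (j, xs) \<and> y \<in> selected \<Gamma> S j \<and> x = v # y)"
  unfolding selected_unfold[OF assms] by blast

lemma selected_subset:
  assumes "i < length \<Gamma>"
  shows "selected \<Gamma> S i \<subseteq> verts (expansion_at \<Gamma> i)"
    "Suc i < length \<Gamma> \<Longrightarrow> selected \<Gamma> S i \<inter> (\<lambda>p. [p]) ` set (pins (\<Gamma> ! i)) = {}"
proof -
  have "selected \<Gamma> S i \<subseteq> verts (expansion_at \<Gamma> i) \<and>
    (Suc i < length \<Gamma> \<longrightarrow> selected \<Gamma> S i \<inter> (\<lambda>p. [p]) ` set (pins (\<Gamma> ! i)) = {})"
    using assms
  proof (induction i rule: less_induct)
    case (less i)
    note S = selectionD(1)[OF less.prems]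
    have inner: "v # y \<in> verts (expansion_at \<Gamma> i) \<and> y \<noteq> []"
      if nt: "nonterm (\<Gamma> ! i) v = Some (j, xs)" and y: "y \<in> selected \<Gamma> S j" for v j xs y
    proof -
      note nt' = nontermD[OF hier less.prems nt]
      then have j: "j < length \<Gamma>" "Suc j < length \<Gamma>" using less.prems by auto
      note IH = less.IH[OF nt'(1) j(1)]
      then have "y \<in> verts (expansion_at \<Gamma> j)" "y \<notin> (\<lambda>p. [p]) ` set (pins (\<Gamma> ! j))"
        using y j by blast+
      with vert_expansion_inner[OF hier less.prems nt, of y] glue_other[OF _ nt'(3), of y v]
        Nil_notin_expansion[OF hier j(1)] show ?thesis by auto
    qed
    have here: "[u] \<in> verts (expansion_at \<Gamma> i)" if "u \<in> S i" for u
      using S that by (intro vert_expansion_here[OF hier less.prems]) (auto simp: excluded_def)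
    have pin: "u \<notin> set (pins (\<Gamma> ! i))" if "u \<in> S i" "Suc i < length \<Gamma>" for u
      using S that by (auto simp: excluded_def)
    have "x \<in> verts (expansion_at \<Gamma> i) \<and>
        (Suc i < length \<Gamma> \<longrightarrow> x \<notin> (\<lambda>p. [p]) ` set (pins (\<Gamma> ! i)))"
      if "x \<in> selected \<Gamma> S i" for x
      using that unfolding selected_iff[OF less.prems]
    proof (elim disjE exE conjE)
      fix u assume "u \<in> S i" "x = [u]"
      with here pin show ?thesis by auto
    next
      fix v j xs y
      assume "nonterm (\<Gamma> ! i) v = Some (j, xs)" "y \<in> selected \<Gamma> S j" "x = v # y"
      with inner show ?thesis by auto
    qed
    then show ?case by blast
  qed
  then show "selected \<Gamma> S i \<subseteq> verts (expansion_at \<Gamma> i)"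
    "Suc i < length \<Gamma> \<Longrightarrow> selected \<Gamma> S i \<inter> (\<lambda>p. [p]) ` set (pins (\<Gamma> ! i)) = {}" by auto
qed

lemma Nil_notin_selected: "i < length \<Gamma> \<Longrightarrow> [] \<notin> selected \<Gamma> S i"
  using selected_subset(1) Nil_notin_expansion[OF hier] by blast

lemma singleton_in_selected: 
  assumes "i < length \<Gamma>"
  shows "[u] \<in> selected \<Gamma> S i \<longleftrightarrow> u \<in> S i"
proof -
  have "[] \<notin> selected \<Gamma> S j" if "nonterm (\<Gamma> ! i) v = Some (j, xs)" for v j xs
    using nontermD(1)[OF hier assms that] assms Nil_notin_selected by simp
  then show ?thesis unfolding selected_iff[OF assms] by blast
qed

lemma Cons_in_selected:
  assumes "i < length \<Gamma>" "nonterm (\<Gamma> ! i) v = Some (j, xs)" "x \<noteq> []"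
  shows "v # x \<in> selected \<Gamma> S i \<longleftrightarrow> x \<in> selected \<Gamma> S j"
  using assms(2,3) unfolding selected_iff[OF assms(1)] by auto

lemma glue_in_selected:
  assumes "i < length \<Gamma>" "nonterm (\<Gamma> ! i) v = Some (j, xs)" "x \<in> selected \<Gamma> S j"
  shows "glue (pins (\<Gamma> ! j)) xs v x = v # x" "v # x \<in> selected \<Gamma> S i"
proof -
  note nt = nontermD[OF hier assms(1,2)]
  then have j: "j < length \<Gamma>" "Suc j < length \<Gamma>" using assms(1) by auto
  have "x \<notin> (\<lambda>p. [p]) ` set (pins (\<Gamma> ! j))" using selected_subset(2)[OF j] assms(3) by blast
  from glue_other[OF this nt(3)] show "glue (pins (\<Gamma> ! j)) xs v x = v # x" .
  have "x \<noteq> []" using Nil_notin_selected[OF j(1)] assms(3) by blast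
  with Cons_in_selected[OF assms(1,2)] assms(3) show "v # x \<in> selected \<Gamma> S i" by simp
qed

text \<open>A selected neighbour of \<open>u\<close> lies in the cell itself or in a copy of which
  \<open>u\<close> is a pin. In the second case the induction hypothesis turns it into membership of
  that pin in \<open>Y j\<close>.\<close>

lemma blocked_iff:
  assumes "i < length \<Gamma>" "u \<in> verts (graph (\<Gamma> ! i)) - dom (nonterm (\<Gamma> ! i))"
  shows "u \<in> Y i \<longleftrightarrow> (\<exists>x\<in>selected \<Gamma> S i. {x, [u]} \<in> edges (expansion_at \<Gamma> i))"
  using assms
proof (induction i arbitrary: u rule: less_induct)
  case (less i)
  note i = less.prems(1)
  have pin: "pins (\<Gamma> ! j) ! l \<in> Y j \<longleftrightarrow>
      (\<exists>x\<in>selected \<Gamma> S j. {x, [pins (\<Gamma> ! j) ! l]} \<in> edges (expansion_at \<Gamma> j))"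
    if nt: "nonterm (\<Gamma> ! i) v = Some (j, xs)" and "l < length (pins (\<Gamma> ! j))" for v j xs l
  proof -
    have "j < i" by (rule nontermD(1)[OF hier i nt])
    moreover have "pins (\<Gamma> ! j) ! l \<in> verts (graph (\<Gamma> ! j)) - dom (nonterm (\<Gamma> ! j))"
      using cell_okD(3,5)[OF hier, of j] \<open>j < i\<close> i nth_mem[OF that(2)] by fastforce
    ultimately show ?thesis using less.IH[of j] i by simp
  qed
  show ?case
  proof
    assume "u \<in> Y i"
    then consider v j xs l where "nonterm (\<Gamma> ! i) v = Some (j, xs)" "l < length xs"
        "pins (\<Gamma> ! j) ! l \<in> Y j" "u = xs ! l"
      | a where "a \<in> S i" "{a, u} \<in> edges (graph (\<Gamma> ! i))"
      unfolding selectionD(2)[OF i] blocked_through_def by blast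
    then show "\<exists>x\<in>selected \<Gamma> S i. {x, [u]} \<in> edges (expansion_at \<Gamma> i)"
    proof cases
      case (1 v j xs l)
      note nt = nontermD[OF hier i 1(1)]
      then have j: "j < length \<Gamma>" using i by simp
      obtain x where x: "x \<in> selected \<Gamma> S j"
        "{x, [pins (\<Gamma> ! j) ! l]} \<in> edges (expansion_at \<Gamma> j)"
        using pin[OF 1(1), of l] 1 nt by auto
      have "glue (pins (\<Gamma> ! j)) xs v [pins (\<Gamma> ! j) ! l] = [u]"
        using glue_nth[OF cell_okD(2)[OF hier j] nt(3)] 1 nt(3) by simp
      with edge_expansion_inner[OF hier i 1(1) x(2)] glue_in_selected[OF i 1(1) x(1)]
      show ?thesis by auto
    next
      case (2 a)
      then have "a \<notin> dom (nonterm (\<Gamma> ! i))"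
        using selectionD(1)[OF i] by (auto simp: excluded_def)
      with edge_expansion_here[OF hier i 2(2)] less.prems(2) singleton_in_selected[OF i] 2
      show ?thesis by auto
    qed
  next
    assume "\<exists>x\<in>selected \<Gamma> S i. {x, [u]} \<in> edges (expansion_at \<Gamma> i)"
    then obtain x where x: "x \<in> selected \<Gamma> S i" "{x, [u]} \<in> edges (expansion_at \<Gamma> i)" by blast
    from hier i x(2) show "u \<in> Y i"
    proof (cases rule: edge_expansion_cases)
      case (here a b)
      with x singleton_in_selected[OF i] show ?thesis unfolding selectionD(2)[OF i] by auto
    next
      case (inner v j xs x' y')
      note nt = nontermD[OF hier i inner(1)]
      then have j: "j < length \<Gamma>" using i by simp
      note verts = edge_expansion_verts[OF hier j inner(2)]
      obtain l where l: "l < length (pins (\<Gamma> ! j))" "y' = [pins (\<Gamma> ! j) ! l]" "u = xs ! l"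
        by (rule glue_cases[OF cell_okD(2)[OF hier j] nt(3), of y' v])
          (use inner verts Nil_notin_expansion[OF hier j] in auto)
      \<comment> \<open>This is where simplicity matters: if the selected neighbour were a pin of
        the copy too, it would be selected outside the copy and could not show up in
        \<open>Y j\<close>.\<close>
      have "x' \<notin> (\<lambda>p. [p]) ` set (pins (\<Gamma> ! j))"
        using no_edge_between_pins[OF hier simple j] inner(2) l by force
      then have "x = v # x'" using glue_other[OF _ nt(3)] inner by simp
      moreover have "x' \<noteq> []" using verts Nil_notin_expansion[OF hier j] by blast
      ultimately have "x' \<in> selected \<Gamma> S j" using x Cons_in_selected[OF i inner(1)] by simp
      then have "pins (\<Gamma> ! j) ! l \<in> Y j" using pin[OF inner(1) l(1)] inner(2) l by auto
      then have "u \<in> blocked_through \<Gamma> Y i"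
        unfolding blocked_through_def using inner(1) l nt(3) by force
      then show ?thesis unfolding selectionD(2)[OF i] by blast
    qed
  qed
qed

lemma selected_independent:
  assumes "i < length \<Gamma>" "x \<in> selected \<Gamma> S i" "y \<in> selected \<Gamma> S i"
  shows "{x, y} \<notin> edges (expansion_at \<Gamma> i)"
  using assms
proof (induction i arbitrary: x y rule: less_induct)
  case (less i)
  note i = less.prems(1)
  \<comment> \<open>Settles every edge with an end in the cell itself; what remains is an edge
    between two vertices of one copy that are not pins.\<close>
  have single: False if "{x, [u]} \<in> edges (expansion_at \<Gamma> i)" "x \<in> selected \<Gamma> S i"
    "[u] \<in> selected \<Gamma> S i" for x u
  proof -
    have "u \<in> S i" using that singleton_in_selected[OF i] by simp
    moreover from this have "u \<in> Y i"
      using blocked_iff[OF i, of u] that selectionD(1)[OF i] by (auto simp: excluded_def)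
    ultimately show False using selectionD(3)[OF i] by blast
  qed
  show ?case
  proof
    assume e: "{x, y} \<in> edges (expansion_at \<Gamma> i)"
    with hier i show False
    proof (cases rule: edge_expansion_cases)
      case (here u v)
      with single e less.prems show False by blast
    next
      case (inner v j xs x' y')
      note nt = nontermD[OF hier i inner(1)]
      then have j: "j < length \<Gamma>" using i by simp
      note ok = cell_okD(2)[OF hier j]
      have e': "{y, x} \<in> edges (expansion_at \<Gamma> i)" using e by (simp add: insert_commute)
      have "x = v # x'"
        using ok nt(3)
      proof (cases rule: glue_cases[where x = x' and v = v])
        case (pin l)
        with single[of y "xs ! l"] inner e' less.prems show ?thesis by simp
      qed (use inner in simp)
      moreover have "y = v # y'"
        using ok nt(3)
      proof (cases rule: glue_cases[where x = y' and v = v])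
        case (pin l)
        with single[of x "xs ! l"] inner e less.prems show ?thesis by simp
      qed (use inner in simp)
      moreover have "x' \<noteq> []" "y' \<noteq> []"
        using edge_expansion_verts[OF hier j inner(2)] Nil_notin_expansion[OF hier j] by blast+
      ultimately have "x' \<in> selected \<Gamma> S j" "y' \<in> selected \<Gamma> S j"
        using less.prems Cons_in_selected[OF i inner(1)] by auto
      with less.IH[OF nt(1) j] inner(2) show False by blast
    qed
  qed
qed

text \<open>Pins of lower cells are exempt because their fate is decided further up. The induction
  still works: a vertex that is new in a copy is not a pin there.\<close>

lemma selected_maximal:
  assumes "i < length \<Gamma>" "y \<in> verts (expansion_at \<Gamma> i)"
    "Suc i = length \<Gamma> \<or> y \<notin> (\<lambda>p. [p]) ` set (pins (\<Gamma> ! i))"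
  shows "y \<in> selected \<Gamma> S i \<or> (\<exists>x\<in>selected \<Gamma> S i. {x, y} \<in> edges (expansion_at \<Gamma> i))"
  using assms
proof (induction i arbitrary: y rule: less_induct)
  case (less i)
  note i = less.prems(1)
  from hier i less.prems(2) show ?case
  proof (cases rule: vert_expansion_cases)
    case (here u)
    with less.prems have "u \<notin> excluded \<Gamma> i" by (auto simp: excluded_def)
    with here selectionD(4)[OF i] have "u \<in> S i \<or> u \<in> Y i" by blast
    with blocked_iff[OF i here(1)] singleton_in_selected[OF i] here show ?thesis by auto
  next
    case (inner v j xs y')
    note nt = nontermD[OF hier i inner(1)]
    then have j: "j < length \<Gamma>" using i by simp
    note glue = glue_other[OF inner(3) nt(3), of v]
    from less.IH[OF nt(1) j inner(2)] inner(3) consider "y' \<in> selected \<Gamma> S j"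
      | x where "x \<in> selected \<Gamma> S j" "{x, y'} \<in> edges (expansion_at \<Gamma> j)" by blast
    then show ?thesis
    proof cases
      case 1
      with glue_in_selected[OF i inner(1)] inner show ?thesis by simp
    next
      case (2 x)
      with glue_in_selected[OF i inner(1)] edge_expansion_inner[OF hier i inner(1) 2(2)] inner glue
      show ?thesis by metis
    qed
  qed
qed

text \<open>Names of length one belong to the cell, and the first entry of a longer name tells the
  copy, so the union is disjoint. The program counts by the same recursion.\<close>

lemma card_selected:
  assumes "i < length \<Gamma>"
  shows "card (selected \<Gamma> S i) = card (S i) +
    (\<Sum>v\<in>dom (nonterm (\<Gamma> ! i)). card (selected \<Gamma> S (fst (the (nonterm (\<Gamma> ! i) v)))))"
proof -
  let ?T = "dom (nonterm (\<Gamma> ! i))" and ?J = "\<lambda>v. selected \<Gamma> S (fst (the (nonterm (\<Gamma> ! i) v)))"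
  have J: "?J v \<subseteq> verts (expansion_at \<Gamma> (fst (the (nonterm (\<Gamma> ! i) v)))) \<and> finite (?J v) \<and> [] \<notin> ?J v"
    if "v \<in> ?T" for v
  proof -
    from that obtain a where a: "nonterm (\<Gamma> ! i) v = Some a" by blast
    obtain j xs where "a = (j, xs)" by (cases a)
    with a have nt: "nonterm (\<Gamma> ! i) v = Some (j, xs)" by simp
    then have j: "j < length \<Gamma>" using nontermD(1)[OF hier assms nt] assms by simp
    then have "finite (selected \<Gamma> S j)"
      using selected_subset(1) finite_verts_expansion[OF hier] finite_subset by blast
    then show ?thesis using nt selected_subset(1)[OF j] Nil_notin_selected[OF j] by simp
  qed
  have fin: "finite (verts (graph (\<Gamma> ! i)))"
    using cell_okD(1)[OF hier assms] by (simp add: simple_graph_def)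
  have T: "finite ?T" using cell_okD(4)[OF hier assms] fin by (rule finite_subset)
  have S: "finite (S i)" using selectionD(1)[OF assms] fin by (meson Diff_subset finite_subset)
  have "x \<in> selected \<Gamma> S i \<longleftrightarrow> x \<in> (\<lambda>u. [u]) ` S i \<union> (\<Union>v\<in>?T. (#) v ` ?J v)" for x
    unfolding selected_iff[OF assms] by (cases x) (auto simp: image_iff)
  then have "selected \<Gamma> S i = (\<lambda>u. [u]) ` S i \<union> (\<Union>v\<in>?T. (#) v ` ?J v)" by (rule set_eqI)
  then have "card (selected \<Gamma> S i) = card ((\<lambda>u. [u]) ` S i \<union> (\<Union>v\<in>?T. (#) v ` ?J v))"
    by (rule arg_cong)
  also have "\<dots> = card ((\<lambda>u. [u]) ` S i) + card (\<Union>v\<in>?T. (#) v ` ?J v)"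
    using S T J by (intro card_Un_disjoint) auto
  also have "card (\<Union>v\<in>?T. (#) v ` ?J v) = (\<Sum>v\<in>?T. card ((#) v ` ?J v))"
    using T J by (intro card_UN_disjoint) auto
  also have "card ((\<lambda>u. [u]) ` S i) = card (S i)"
    by (rule card_image) (simp add: inj_on_def)
  finally show ?thesis by (simp add: card_image)
qed

section \<open>The selection in the whole graph and its approximation ratio\<close>

lemma independent_selected: "independent_set (expansion \<Gamma>) (selected \<Gamma> S (length \<Gamma> - 1))"
proof -
  have i: "length \<Gamma> - 1 < length \<Gamma>" using hier by (simp add: hier_spec_def)
  show ?thesis unfolding independent_set_def expansion_def
    using selected_subset(1)[OF i] selected_independent[OF i] by blast
qed

text \<open>Maximality has no exempt vertices in the top cell, and an empty set is not maximal in a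
  graph with vertices. Hence the top cell of the output is never the dummy.\<close>

lemma selected_nonempty: "selected \<Gamma> S (length \<Gamma> - 1) \<noteq> {}"
proof -
  have i: "length \<Gamma> - 1 < length \<Gamma>" using hier by (simp add: hier_spec_def)
  then have "Suc (length \<Gamma> - 1) = length \<Gamma>" by simp
  with selected_maximal[OF i] verts_expansion_nonempty[OF hier i] show ?thesis by blast
qed

text \<open>
  A vertex outside a maximal independent set has a neighbour in it, and a member of the set is so
  charged at most \<open>B\<close> times, or only once if the member is itself in the other set.
\<close>

lemma independence_number_le:
  assumes deg: "\<forall>v \<in> verts (expansion \<Gamma>). degree (expansion \<Gamma>) v \<le> B" and "B \<ge> 1"
  shows "independence_number (expansion \<Gamma>) \<le> B * card (selected \<Gamma> S (length \<Gamma> - 1))"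
proof -
  let ?G = "expansion \<Gamma>" and ?J = "selected \<Gamma> S (length \<Gamma> - 1)"
  have i: "length \<Gamma> - 1 < length \<Gamma>" "Suc (length \<Gamma> - 1) = length \<Gamma>"
    using hier by (auto simp: hier_spec_def)
  have fin: "finite (verts ?G)"
    unfolding expansion_def by (rule finite_verts_expansion[OF hier i(1)])
  have J: "?J \<subseteq> verts ?G" unfolding expansion_def by (rule selected_subset(1)[OF i(1)])
  have bound: "card K \<le> B * card ?J" if K: "independent_set ?G K" for K
  proof -
    have Kv: "K \<subseteq> verts ?G" using K by (simp add: independent_set_def)
    define f where "f y = (if y \<in> ?J then y else SOME x. x \<in> ?J \<and> {x, y} \<in> edges ?G)" for y
    have f: "f y \<in> ?J \<and> (y \<in> ?J \<and> f y = y \<or> {f y, y} \<in> edges ?G)" if "y \<in> K" for y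
    proof (cases "y \<in> ?J")
      case False
      then have "\<exists>x. x \<in> ?J \<and> {x, y} \<in> edges ?G"
        using selected_maximal[OF i(1)] that Kv i(2) unfolding expansion_def by blast
      from someI_ex[OF this] False show ?thesis by (simp add: f_def)
    qed (simp add: f_def)
    have fibre: "card {y \<in> K. f y = x} \<le> B" if x: "x \<in> ?J" for x
    proof (cases "x \<in> K")
      case True
      then have no_edge: "{x, y} \<notin> edges ?G" if "y \<in> K" for y
        using K that by (simp add: independent_set_def)
      \<comment> \<open>Any other \<open>y\<close> charging \<open>x\<close> would be adjacent to
        it, although both lie in \<open>K\<close>.\<close>
      have "{y \<in> K. f y = x} \<subseteq> {x}" using f no_edge by force
      then have "card {y \<in> K. f y = x} \<le> card {x}" by (rule card_mono[rotated]) simp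
      with \<open>B \<ge> 1\<close> show ?thesis by simp
    next
      case False
      \<comment> \<open>Since \<open>x\<close> is not in \<open>K\<close>, no \<open>y\<close>
        charges \<open>x\<close> by being equal to it.\<close>
      have "{y \<in> K. f y = x} \<subseteq> nbrs ?G x"
      proof
        fix y assume "y \<in> {y \<in> K. f y = x}"
        with f[of y] False show "y \<in> nbrs ?G x" by (auto simp: nbrs_def)
      qed
      moreover have "nbrs ?G x \<subseteq> verts ?G"
        unfolding nbrs_def expansion_def using edge_expansion_verts(2)[OF hier i(1)] by blast
      ultimately have "card {y \<in> K. f y = x} \<le> degree ?G x"
        unfolding degree_def by (intro card_mono finite_subset[OF _ fin])
      also have "degree ?G x \<le> B" using deg x J by blast
      finally show ?thesis .
    qed
    have "f y \<in> ?J" if "y \<in> K" for y using f[OF that] ..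
    then have "K = (\<Union>x\<in>?J. {y \<in> K. f y = x})" by blast
    then have "card K = card (\<Union>x\<in>?J. {y \<in> K. f y = x})" by (rule arg_cong)
    also have "\<dots> \<le> (\<Sum>x\<in>?J. card {y \<in> K. f y = x})"
      by (rule card_UN_le[OF finite_subset[OF J fin]])
    also have "\<dots> \<le> (\<Sum>x\<in>?J. B)" by (rule sum_mono) (rule fibre)
    finally show ?thesis by (simp add: mult.commute)
  qed
  have "finite {card K | K. independent_set ?G K}"
    by (rule finite_subset[of _ "{..B * card ?J}"]) (use bound in auto)
  moreover have "independent_set ?G {}" by (simp add: independent_set_def)
  ultimately show ?thesis unfolding independence_number_def
    using bound by (intro Max.boundedI) auto
qed

end

section \<open>Data in memory\<close>

definition seg :: "(nat \<Rightarrow> nat) \<Rightarrow> nat \<Rightarrow> nat list \<Rightarrow> bool" where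
  "seg f a xs \<longleftrightarrow> (\<forall>l < length xs. f (a + l) = xs ! l)"

lemma seg_Nil [simp]: "seg f a []"
  by (simp add: seg_def)

lemma seg_Cons [simp]: "seg f a (x # xs) \<longleftrightarrow> f a = x \<and> seg f (Suc a) xs"
  by (auto simp: seg_def less_Suc_eq_0_disj)

lemma seg_append [simp]: "seg f a (xs @ ys) \<longleftrightarrow> seg f a xs \<and> seg f (a + length xs) ys"
  by (induction xs arbitrary: a) auto

lemma seg_cong: "(\<And>l. l < length xs \<Longrightarrow> f (a + l) = g (a + l)) \<Longrightarrow> seg f a xs = seg g a xs"
  by (simp add: seg_def)

lemma seg_upd [simp]: "a + length xs \<le> b \<Longrightarrow> seg (f(b := v)) a xs = seg f a xs"
  by (rule seg_cong) simp

definition marked :: "(nat \<Rightarrow> nat) \<Rightarrow> nat \<Rightarrow> nat set" where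
  "marked f c = {u. f (c + u) \<noteq> 0}"

lemma marked_upd [simp]: "v \<noteq> 0 \<Longrightarrow> marked (f(c + u := v)) c = insert u (marked f c)"
  by (auto simp: marked_def)

text \<open>A linked list whose nodes are memory addresses; every link leads to a smaller address.\<close>

fun chain :: "(nat \<Rightarrow> nat) \<Rightarrow> (nat \<Rightarrow> nat) \<Rightarrow> nat \<Rightarrow> nat \<Rightarrow> nat list \<Rightarrow> bool" where
  "chain nx nb b h [] \<longleftrightarrow> h = 0"
| "chain nx nb b h (x # xs) \<longleftrightarrow> 0 < h \<and> h < b \<and> nb h = x \<and> chain nx nb h (nx h) xs"

lemma chain_mono: "chain nx nb b h xs \<Longrightarrow> b \<le> b' \<Longrightarrow> chain nx nb b' h xs"
  by (cases xs) auto

text \<open>All nodes lie below \<open>b\<close>, so a node created at \<open>a\<close> cannot be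
  one of them.\<close>

lemma chain_upd: "b \<le> a \<Longrightarrow> chain (nx(a := v)) (nb(a := w)) b h xs = chain nx nb b h xs"
  by (induction xs arbitrary: b h) auto

text \<open>Ranging over all \<open>x\<close>, also beyond the vertices of the cell, the statement
  says as well that the heads belonging to later cells are still 0.\<close>

definition chains :: "(nat \<Rightarrow> nat \<Rightarrow> nat) \<Rightarrow> nat \<Rightarrow> nat \<Rightarrow> (nat \<Rightarrow> nat list) \<Rightarrow> bool" where
  "chains A c b G \<longleftrightarrow> (\<forall>x. chain (A 6) (A 7) b (A 5 (c + x)) (G x))"

lemma chains_insert:
  assumes "chains A c a G" "0 < a" "A' 6 = (A 6)(a := A 5 (c + u))" "A' 7 = (A 7)(a := v)"
    "A' 5 = (A 5)(c + u := a)"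
  shows "chains A' c (Suc a) (G(u := v # G u))"
proof -
  have "chain (A' 6) (A' 7) a (A 5 (c + x)) (G x)" for x
    using assms(1,3,4) by (simp add: chains_def chain_upd)
  moreover from this have "chain (A' 6) (A' 7) (Suc a) (A 5 (c + x)) (G x)" for x
    by (rule chain_mono) simp
  ultimately show ?thesis using assms(2-5) by (simp add: chains_def)
qed

section \<open>The program\<close>

text \<open>
  Array 0 is the input.  Array 1 maps the number of a cell to the address of its code, array 2 to
  the number of selected vertices of its expansion.  A vertex \<open>u\<close> of a cell whose code starts at
  \<open>c\<close> owns the entry \<open>c + u\<close> of the arrays 3 (excluded), 4 (blocked) and 5 (first node of its
  adjacency list).  The arrays 6 and 7 hold the link and the vertex of the list node that is named
  by the address of an endpoint of an edge.  Array 8 is the output.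
\<close>

abbreviation (input) rOne :: nat where "rOne \<equiv> 0"
abbreviation (input) rI :: nat where "rI \<equiv> 26"
abbreviation (input) rP :: nat where "rP \<equiv> 2"
abbreviation (input) rQ :: nat where "rQ \<equiv> 3"
abbreviation (input) rRem :: nat where "rRem \<equiv> 4"
abbreviation (input) rC :: nat where "rC \<equiv> 5"
abbreviation (input) rN :: nat where "rN \<equiv> 6"
abbreviation (input) rNP :: nat where "rNP \<equiv> 7"
abbreviation (input) rNT :: nat where "rNT \<equiv> 8"
abbreviation (input) rM :: nat where "rM \<equiv> 9"
abbreviation (input) rCnt :: nat where "rCnt \<equiv> 10"
abbreviation (input) rVP :: nat where "rVP \<equiv> 11"
abbreviation (input) rTP :: nat where "rTP \<equiv> 12"
abbreviation (input) rH :: nat where "rH \<equiv> 13"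
abbreviation (input) rX :: nat where "rX \<equiv> 14"
abbreviation (input) rKT :: nat where "rKT \<equiv> 15"
abbreviation (input) rU :: nat where "rU \<equiv> 16"
abbreviation (input) rV :: nat where "rV \<equiv> 17"
abbreviation (input) rA :: nat where "rA \<equiv> 18"
abbreviation (input) rB :: nat where "rB \<equiv> 19"
abbreviation (input) rJ :: nat where "rJ \<equiv> 20"
abbreviation (input) rK :: nat where "rK \<equiv> 21"
abbreviation (input) rCJ :: nat where "rCJ \<equiv> 22"
abbreviation (input) rPP :: nat where "rPP \<equiv> 23"
abbreviation (input) rE :: nat where "rE \<equiv> 24"
abbreviation (input) rZ :: nat where "rZ \<equiv> 25"

abbreviation (input) aIN :: nat where "aIN \<equiv> 0"
abbreviation (input) aCP :: nat where "aCP \<equiv> 1"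
abbreviation (input) aCN :: nat where "aCN \<equiv> 2"
abbreviation (input) aEX :: nat where "aEX \<equiv> 3"
abbreviation (input) aBL :: nat where "aBL \<equiv> 4"
abbreviation (input) aHD :: nat where "aHD \<equiv> 5"
abbreviation (input) aNX :: nat where "aNX \<equiv> 6"
abbreviation (input) aNB :: nat where "aNB \<equiv> 7"
abbreviation (input) aOUT :: nat where "aOUT \<equiv> 8"

abbreviation (input) incr :: "nat \<Rightarrow> com" where "incr x \<equiv> CAdd x x rOne"
abbreviation (input) decr :: "nat \<Rightarrow> com" where "decr x \<equiv> CSub x x rOne"
abbreviation (input) copy :: "nat \<Rightarrow> nat \<Rightarrow> com" where "copy x y \<equiv> CAdd x y rZ"

section \<open>Marking excluded and blocked vertices\<close>

definition exclude_loop :: com where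
  "exclude_loop = CWhile rX (Ld rU aIN rPP ;; CAdd rU rU rC ;; St aEX rU rOne ;;
     incr rPP ;; decr rX)"

text \<open>A pass costs 7 units and its test 1; the failing last test adds 1. The invariant bounds
  the elapsed time plus the budget of the remaining items, as in all loops below.\<close>

lemma wp_exclude_loop:
  assumes "seg (A aIN) (r rPP) ps" "r rX = length ps" "r rOne = 1" "r rPP + length ps \<le> L"
    "\<forall>p\<in>set ps. r rC + p < L"
  shows "wp L exclude_loop (\<lambda>t' r' A'. t' \<le> t + 8 * length ps + 1 \<and>
     marked (A' aEX) (r rC) = marked (A aEX) (r rC) \<union> set ps) t r A"
  unfolding exclude_loop_def
  by (rule wp_While[where xs = ps and I = "\<lambda>ys t' r' A'. seg (A aIN) (r' rPP) ys \<and>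
      r' rX = length ys \<and> r' rPP + length ys \<le> L \<and> (\<forall>p\<in>set ys. r rC + p < L) \<and>
      t' + 8 * length ys \<le> t + 8 * length ps \<and>
      marked (A' aEX) (r rC) \<union> set ys = marked (A aEX) (r rC) \<union> set ps"])
    (use assms in \<open>auto simp: frame_def valid_index_def add.commute\<close>)

definition block_loop :: com where
  "block_loop = CWhile rK (Ld rU aIN rPP ;; CAdd rU rCJ rU ;; Ld rB aBL rU ;; Ld rE aIN rP ;;
     incr rPP ;; incr rP ;; decr rK ;; CIf rB (CAdd rE rC rE ;; St aBL rE rOne) CSkip)"

text \<open>Marks are read below \<open>r rC\<close> and written from \<open>r rC\<close> on, so
  each test sees the marks as they were before the loop.\<close>

lemma wp_block_loop:
  assumes "seg (A aIN) (r rP) (map fst zs)" "seg (A aIN) (r rPP) (map snd zs)"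
    "r rK = length zs" "r rOne = 1" "r rP + length zs \<le> L" "r rPP + length zs \<le> L"
    "\<forall>(x, p)\<in>set zs. r rC + x < L \<and> r rCJ + p < r rC \<and> (A aBL (r rCJ + p) \<noteq> 0 \<longleftrightarrow> p \<in> F)"
    "r rC \<le> L"
  shows "wp L block_loop (\<lambda>t' r' A'. t' \<le> t + 15 * length zs + 1 \<and>
     r' rP = r rP + length zs \<and> (\<forall>y < r rC. A' aBL y = A aBL y) \<and>
     marked (A' aBL) (r rC) = marked (A aBL) (r rC) \<union> {x. \<exists>p. (x, p) \<in> set zs \<and> p \<in> F}) t r A"
proof -
  let ?I = "\<lambda>ys t' r' A'.
      seg (A aIN) (r' rP) (map fst ys) \<and> seg (A aIN) (r' rPP) (map snd ys) \<and>
      r' rK = length ys \<and> r' rP + length ys = r rP + length zs \<and> r' rPP + length ys \<le> L \<and>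
      (\<forall>(x, p)\<in>set ys. r rC + x < L \<and> r rCJ + p < r rC \<and> (A aBL (r rCJ + p) \<noteq> 0 \<longleftrightarrow> p \<in> F)) \<and>
      t' + 15 * length ys \<le> t + 15 * length zs \<and> (\<forall>y < r rC. A' aBL y = A aBL y) \<and>
      marked (A' aBL) (r rC) \<union> {x. \<exists>p. (x, p) \<in> set ys \<and> p \<in> F} =
        marked (A aBL) (r rC) \<union> {x. \<exists>p. (x, p) \<in> set zs \<and> p \<in> F}"
  show ?thesis unfolding block_loop_def
  proof (rule wp_While[where xs = zs and I = ?I], goal_cases)
    case 1
    show ?case using assms by simp
  next
    case (2 y ys t' r' A')
    obtain x p where y: "y = (x, p)" by (cases y)
    have "{x'. \<exists>p'. (x', p') \<in> set (y # ys) \<and> p' \<in> F} =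
      (if p \<in> F then insert x {x'. \<exists>p'. (x', p') \<in> set ys \<and> p' \<in> F}
       else {x'. \<exists>p'. (x', p') \<in> set ys \<and> p' \<in> F})" by (auto simp: y)
    with 2 y show ?case using assms(4,5,8)
      by (simp add: frame_def valid_index_def split del: if_split)
        (simp add: valid_index_def split: if_splits)
  next
    case (3 t' r' A')
    then show ?case by simp
  qed
qed


text \<open>
  The facts about the earlier cell \<open>j\<close> that are needed for the cell at address \<open>c\<close>: \<open>qs\<close> are its
  pins, \<open>F\<close> its blocked vertices, and \<open>n\<close> vertices of its expansion are selected.
\<close>

definition finished_cell ::
  "nat \<Rightarrow> nat \<Rightarrow> (nat \<Rightarrow> nat \<Rightarrow> nat) \<Rightarrow> nat \<Rightarrow> nat list \<Rightarrow> nat set \<Rightarrow> nat \<Rightarrow> bool" where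
  "finished_cell L c A j qs F n \<longleftrightarrow> j < L \<and> A aCP j < L \<and> A aCN j = n \<and>
     A aCP j + 4 + A aIN (A aCP j) + length qs \<le> L \<and>
     seg (A aIN) (A aCP j + 4 + A aIN (A aCP j)) qs \<and>
     (\<forall>p\<in>set qs. A aCP j + p < c \<and> (A aBL (A aCP j + p) \<noteq> 0 \<longleftrightarrow> p \<in> F))"

lemma finished_cell_cong:
  "A' aIN = A aIN \<Longrightarrow> A' aCP j = A aCP j \<Longrightarrow> A' aCN j = A aCN j \<Longrightarrow>
    (\<And>y. y < c \<Longrightarrow> A' aBL y = A aBL y) \<Longrightarrow>
    finished_cell L c A' j qs F n = finished_cell L c A j qs F n"
  unfolding finished_cell_def by auto

lemma finished_cell_mono:
  "finished_cell L c A j qs F n \<Longrightarrow> c \<le> c' \<Longrightarrow> finished_cell L c' A j qs F n"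
  unfolding finished_cell_def by auto

section \<open>The nonterminals of a cell\<close>

type_synonym nonterms = "(nat \<times> nat \<times> nat list) list"

definition enc_nonterms :: "nonterms \<Rightarrow> nat list" where
  "enc_nonterms ts = concat (map (\<lambda>(v, j, xs). [v, j, length xs] @ xs) ts)"

lemma enc_nonterms_simps [simp]:
  "enc_nonterms [] = []"
  "enc_nonterms ((v, j, xs) # ts) = v # j # length xs # xs @ enc_nonterms ts"
  by (simp_all add: enc_nonterms_def)

text \<open>This is \<open>blocked_through\<close> in the form in which the program meets it:
  neighbours and pins are scanned in parallel.\<close>

definition blocked_by :: "(nat \<Rightarrow> nat list) \<Rightarrow> (nat \<Rightarrow> nat set) \<Rightarrow> nonterms \<Rightarrow> nat set" where
  "blocked_by qs F ts = (\<Union>(v, j, xs)\<in>set ts. {x. \<exists>p. (x, p) \<in> set (zip xs (qs j)) \<and> p \<in> F j})"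

lemma blocked_by_simps [simp]:
  "blocked_by qs F [] = {}"
  "blocked_by qs F ((v, j, xs) # ts) =
     {x. \<exists>p. (x, p) \<in> set (zip xs (qs j)) \<and> p \<in> F j} \<union> blocked_by qs F ts"
  by (simp_all add: blocked_by_def)

text \<open>The nonterminals that survive in the output. Their neighbour lists become empty because
  output cells have no pins.\<close>

definition kept :: "(nat \<Rightarrow> nat) \<Rightarrow> nonterms \<Rightarrow> nonterms" where
  "kept n ts = map (\<lambda>(v, j, xs). (v, j, [])) (filter (\<lambda>(v, j, xs). n j \<noteq> 0) ts)"

lemma kept_simps [simp]:
  "kept n [] = []"
  "kept n ((v, j, xs) # ts) = (if n j \<noteq> 0 then (v, j, []) # kept n ts else kept n ts)"
  by (simp_all add: kept_def)

definition count_nonterms :: "(nat \<Rightarrow> nat) \<Rightarrow> nonterms \<Rightarrow> nat" where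
  "count_nonterms n ts = (\<Sum>(v, j, xs)\<leftarrow>ts. n j)"

lemma count_nonterms_simps [simp]:
  "count_nonterms n [] = 0"
  "count_nonterms n ((v, j, xs) # ts) = n j + count_nonterms n ts"
  by (simp_all add: count_nonterms_def)

text \<open>The kept nonterminals are written here only as vertices; in the output format their
  types come after all vertices, which forces a second pass in \<open>emit_loop\<close>.\<close>

definition nonterm_loop :: com where
  "nonterm_loop = CWhile rX (Ld rV aIN rP ;; incr rP ;; Ld rJ aIN rP ;; incr rP ;;
     Ld rK aIN rP ;; incr rP ;; CAdd rU rC rV ;; St aEX rU rOne ;;
     Ld rCJ aCP rJ ;; Ld rA aCN rJ ;; CAdd rCnt rCnt rA ;;
     CConst rB 4 ;; Ld rPP aIN rCJ ;; CAdd rPP rCJ rPP ;; CAdd rPP rPP rB ;;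
     block_loop ;; decr rX ;; CIf rA (St aOUT rQ rV ;; incr rQ ;; incr rKT) CSkip)"

text \<open>Each number of the code is charged 15 units: those of the neighbour list pay for
  \<open>block_loop\<close>, and the three in front of it, with 45 units, for the fixed cost of a
  pass.\<close>

lemma wp_nonterm_loop:
  assumes "seg (A aIN) (r rP) (enc_nonterms ts)" "r rP + length (enc_nonterms ts) \<le> L"
    "r rX = length ts" "r rOne = 1" "r rC \<le> L"
    "\<forall>(v, j, xs)\<in>set ts. finished_cell L (r rC) A j (qs j) (F j) (n j) \<and>
       length xs = length (qs j) \<and> r rC + v < L \<and> (\<forall>x\<in>set xs. r rC + x < L)"
  shows "wp L nonterm_loop (\<lambda>t' r' A'. t' \<le> t + 15 * length (enc_nonterms ts) + 1 \<and>
     r' rP = r rP + length (enc_nonterms ts) \<and> (\<forall>y < r rC. A' aBL y = A aBL y) \<and>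
     marked (A' aEX) (r rC) = marked (A aEX) (r rC) \<union> fst ` set ts \<and>
     marked (A' aBL) (r rC) = marked (A aBL) (r rC) \<union> blocked_by qs F ts \<and>
     r' rCnt = r rCnt + count_nonterms n ts \<and>
     r' rKT = r rKT + length (kept n ts) \<and> r' rQ = r rQ + length (kept n ts) \<and>
     seg (A' aOUT) (r rQ) (map fst (kept n ts)) \<and>
     (\<forall>y < r rQ. A' aOUT y = A aOUT y)) t r A"
proof -
  let ?I = "\<lambda>ys t' r' A'.
      seg (A aIN) (r' rP) (enc_nonterms ys) \<and>
      r' rP + length (enc_nonterms ys) = r rP + length (enc_nonterms ts) \<and>
      r' rX = length ys \<and> set ys \<subseteq> set ts \<and>
      t' + 15 * length (enc_nonterms ys) \<le> t + 15 * length (enc_nonterms ts) \<and>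
      (\<forall>y < r rC. A' aBL y = A aBL y) \<and>
      marked (A' aEX) (r rC) \<union> fst ` set ys = marked (A aEX) (r rC) \<union> fst ` set ts \<and>
      marked (A' aBL) (r rC) \<union> blocked_by qs F ys = marked (A aBL) (r rC) \<union> blocked_by qs F ts \<and>
      r' rCnt + count_nonterms n ys = r rCnt + count_nonterms n ts \<and>
      r' rKT + length (kept n ys) = r rKT + length (kept n ts) \<and>
      (\<exists>os. seg (A' aOUT) (r rQ) os \<and> r' rQ = r rQ + length os \<and>
        os @ map fst (kept n ys) = map fst (kept n ts)) \<and>
      (\<forall>y < r rQ. A' aOUT y = A aOUT y)"
  show ?thesis unfolding nonterm_loop_def
  proof (rule wp_While[where xs = ts and I = ?I], goal_cases)
    case 1
    show ?case using assms by (auto intro!: exI[of _ "[]"])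
  next
    case (2 y ys t' r' A')
    obtain v j xs where y: "y = (v, j, xs)" by (cases y)
    have frame: "r' rC = r rC" "r' rOne = r rOne" "A' aIN = A aIN" "A' aCP = A aCP"
      "A' aCN = A aCN"
      using 2(2) by (simp_all add: frame_def block_loop_def)
    note inv = 2(1)[unfolded y]
    then have mem: "(v, j, xs) \<in> set ts" by simp
    then have fin: "finished_cell L (r rC) A j (qs j) (F j) (n j)"
      and len: "length xs = length (qs j)" and bounds: "r rC + v < L" "\<forall>x\<in>set xs. r rC + x < L"
      using assms(6) by auto
    note fin = fin[unfolded finished_cell_def]
    from inv have P: "A aIN (r' rP) = v" "A aIN (Suc (r' rP)) = j"
      "A aIN (Suc (Suc (r' rP))) = length xs" "seg (A aIN) (r' rP + 3) xs"
      "seg (A aIN) (r' rP + 3 + length xs) (enc_nonterms ys)"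
      "r' rP + 3 + length xs + length (enc_nonterms ys) \<le> L"
      using assms(2) by (auto simp: numeral_3_eq_3)
    \<comment> \<open>\<open>r1\<close> and \<open>A1\<close> describe the state in which the inner
      loop is reached; its time is only needed up to the bound 25.\<close>
    define r1 where "r1 = r'(rV := v, rJ := j, rK := length xs, rP := Suc (Suc (Suc (r' rP))),
      rU := r rC + v, rCJ := A aCP j, rA := n j, rCnt := r' rCnt + n j, rB := 4,
      rPP := A aCP j + A aIN (A aCP j) + 4)"
    define A1 where "A1 = A'(aEX := (A' aEX)(r rC + v := 1))"
    have fst_zip: "map fst (zip xs (qs j)) = xs" and snd_zip: "map snd (zip xs (qs j)) = qs j"
      using len by simp_all
    define Q where "Q = ?I ys"
    have "wp L block_loop (wp L (decr rX ;; CIf rA (St aOUT rQ rV ;; incr rQ ;; incr rKT) CSkip)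
        Q) T r1 A1" if T: "T \<le> t' + 25" for T
      unfolding Q_def
    proof (rule wp_mono[OF wp_block_loop[where zs = "zip xs (qs j)" and F = "F j"]], goal_cases)
      case 7
      have "r rC + x < L \<and> A aCP j + p < r rC \<and> (A' aBL (A aCP j + p) \<noteq> 0 \<longleftrightarrow> p \<in> F j)"
        if "(x, p) \<in> set (zip xs (qs j))" for x p
        using that bounds(2) fin inv by (auto dest: set_zip_leftD set_zip_rightD)
      then show ?case using frame by (auto simp: r1_def A1_def)
    next
      case (9 t2 r2 A2)
      have r2: "r2 rX = r' rX" "r2 rOne = 1" "r2 rA = n j" "r2 rQ = r' rQ" "r2 rV = v"
        "r2 rKT = r' rKT" "r2 rC = r rC" "r2 rCnt = r' rCnt + n j"
        "A2 aOUT = A' aOUT" "A2 aEX = (A' aEX)(r rC + v := 1)"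
        using 9(2) frame assms(4) by (simp_all add: frame_def block_loop_def r1_def A1_def)
      from inv obtain os where os: "seg (A' aOUT) (r rQ) os" "r' rQ = r rQ + length os"
        "os @ map fst (kept n ((v, j, xs) # ys)) = map fst (kept n ts)" by blast
      have "\<exists>os'. seg ((A' aOUT)(r' rQ := v)) (r rQ) os' \<and> Suc (r' rQ) = r rQ + length os' \<and>
          os' @ map fst (kept n ys) = map fst (kept n ts)" if "n j \<noteq> 0"
        using os that by (intro exI[of _ "os @ [v]"]) simp
      then show ?case
        using T 9(1) inv P frame os len by (simp add: r2) (auto simp: r2 r1_def A1_def valid_index_def)
    qed (use P fin frame len assms bounds fst_zip snd_zip in
      \<open>auto simp: r1_def A1_def numeral_3_eq_3 add_ac\<close>)
    then show ?case unfolding Q_def[symmetric] using inv P fin frame bounds assms(2,4)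
      by (simp add: y valid_index_def r1_def A1_def)
  next
    case (3 t' r' A')
    then show ?case by auto
  qed
qed

section \<open>Building the adjacency lists\<close>

fun adjacency :: "(nat \<times> nat) list \<Rightarrow> (nat \<Rightarrow> nat list) \<Rightarrow> nat \<Rightarrow> nat list" where
  "adjacency [] G = G"
| "adjacency ((u, v) # es) G =
     adjacency es (let G' = G(u := v # G u) in G'(v := u # G' v))"

definition enc_edges :: "(nat \<times> nat) list \<Rightarrow> nat list" where
  "enc_edges es = concat (map (\<lambda>(u, v). [u, v]) es)"

lemma enc_edges_simps [simp]:
  "enc_edges [] = []" "enc_edges ((u, v) # es) = u # v # enc_edges es"
  by (simp_all add: enc_edges_def)

text \<open>Register \<open>a\<close> holds an address in the code of an edge, and this address
  serves as the new node, put in front of the list of \<open>u\<close>.\<close>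

definition insert_node :: "nat \<Rightarrow> nat \<Rightarrow> nat \<Rightarrow> com" where
  "insert_node a u v = (CAdd rA rC u ;; Ld rB aHD rA ;; St aNX a rB ;; St aNB a v ;; St aHD rA a)"

lemma wp_insert_node:
  assumes "chains A (r rC) (r a) G" "0 < r a" "r a < L" "r rC + r u < L"
    "a \<noteq> rA" "a \<noteq> rB" "v \<noteq> rA" "v \<noteq> rB"
  shows "wp L (insert_node a u v) (\<lambda>t' r' A'. t' = t + 9 \<and>
     chains A' (r rC) (Suc (r a)) (G(r u := r v # G (r u)))) t r A"
  unfolding insert_node_def
  using assms by (simp add: valid_index_def chains_insert[OF assms(1,2)])

definition edge_loop :: com where
  "edge_loop = CWhile rX (CAdd rJ rP rOne ;; Ld rU aIN rP ;; Ld rV aIN rJ ;;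
     insert_node rP rU rV ;; insert_node rJ rV rU ;; CAdd rP rJ rOne ;; decr rX)"

text \<open>An edge takes 26 units, hence 13 per number. Its two addresses exceed those of all
  earlier nodes, as the bound in \<open>chains\<close> requires.\<close>

lemma wp_edge_loop:
  assumes "seg (A aIN) (r rP) (enc_edges es)" "r rP + length (enc_edges es) \<le> L"
    "r rX = length es" "r rOne = 1" "0 < r rP" "chains A (r rC) (r rP) G"
    "\<forall>(u, v)\<in>set es. r rC + u < L \<and> r rC + v < L"
  shows "wp L edge_loop (\<lambda>t' r' A'. t' \<le> t + 13 * length (enc_edges es) + 1 \<and>
     r' rP = r rP + length (enc_edges es) \<and> chains A' (r rC) (r' rP) (adjacency es G)) t r A"
proof -
  let ?I = "\<lambda>ys t' r' A'.
      seg (A aIN) (r' rP) (enc_edges ys) \<and> r' rX = length ys \<and> 0 < r' rP \<and>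
      r' rP + length (enc_edges ys) = r rP + length (enc_edges es) \<and>
      (\<forall>(u, v)\<in>set ys. r rC + u < L \<and> r rC + v < L) \<and>
      t' + 13 * length (enc_edges ys) \<le> t + 13 * length (enc_edges es) \<and>
      (\<exists>H. chains A' (r rC) (r' rP) H \<and> adjacency ys H = adjacency es G)"
  show ?thesis unfolding edge_loop_def
  proof (rule wp_While[where xs = es and I = ?I], goal_cases)
    case 1
    show ?case using assms by auto
  next
    case (2 y ys t' r' A')
    obtain u v where y: "y = (u, v)" by (cases y)
    have frame: "r' rC = r rC" "r' rOne = 1" "A' aIN = A aIN"
      using 2(2) assms(4) by (simp_all add: frame_def insert_node_def)
    note inv = 2(1)[unfolded y]
    then obtain H where H: "chains A' (r rC) (r' rP) H"
      "adjacency ((u, v) # ys) H = adjacency es G" by blast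
    from inv have P: "A aIN (r' rP) = u" "A aIN (Suc (r' rP)) = v"
      "seg (A aIN) (Suc (Suc (r' rP))) (enc_edges ys)"
      "Suc (Suc (r' rP)) + length (enc_edges ys) \<le> L" "r rC + u < L" "r rC + v < L"
      using assms(2) by auto
    define H1 where "H1 = H(u := v # H u)"
    define r1 where "r1 = r'(rJ := Suc (r' rP), rU := u, rV := v)"
    define Q where "Q = ?I ys"
    have "wp L (insert_node rP rU rV) (wp L (insert_node rJ rV rU ;; CAdd rP rJ rOne ;; decr rX) Q)
        T r1 A'" if T: "T \<le> t' + 6" for T
    proof (rule wp_mono[OF wp_insert_node[where G = H]], goal_cases)
      case (9 t2 r2 A2)
      have r2: "r2 rJ = Suc (r' rP)" "r2 rU = u" "r2 rV = v" "r2 rC = r rC" "r2 rOne = 1"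
        "r2 rX = r' rX" "A2 aIN = A aIN"
        using 9(2) frame by (simp_all add: frame_def insert_node_def r1_def)
      have ch: "chains A2 (r2 rC) (r2 rJ) H1" and t2: "t2 \<le> t' + 15"
        using 9(1) T frame by (simp_all add: r2 r1_def H1_def)
      have "wp L (insert_node rJ rV rU) (wp L (CAdd rP rJ rOne ;; decr rX) Q) t2 r2 A2"
      proof (rule wp_mono[OF wp_insert_node[OF ch]], goal_cases)
        case (8 t3 r3 A3)
        have r3: "r3 rJ = Suc (r' rP)" "r3 rC = r rC" "r3 rOne = 1" "r3 rX = r' rX"
          using 8(2) by (simp_all add: frame_def insert_node_def r2)
        have "chains A3 (r rC) (Suc (Suc (r' rP))) (H1(v := u # H1 v))"
          using 8(1) by (simp add: r2)
        moreover have "adjacency ys (H1(v := u # H1 v)) = adjacency es G"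
          using H(2) unfolding H1_def by (simp only: adjacency.simps Let_def)
        ultimately have "\<exists>H. chains A3 (r rC) (Suc (Suc (r' rP))) H \<and> adjacency ys H = adjacency es G"
          by blast
        then show ?case using 8(1) t2 inv P(3,4)
          by (auto simp: r3 Q_def)
      qed (use P in \<open>simp_all add: r2\<close>)
      then show ?case by simp
    qed (use P H inv frame in \<open>simp_all add: r1_def\<close>)
    then show ?case unfolding Q_def[symmetric] using inv P frame
      by (simp add: y valid_index_def r1_def)
  next
    case (3 t' r' A')
    then show ?case by auto
  qed
qed

section \<open>Greedy selection within a cell\<close>

fun greedy :: "(nat \<Rightarrow> nat list) \<Rightarrow> nat set \<Rightarrow> nat list \<Rightarrow> nat set \<Rightarrow> nat list \<times> nat set" where
  "greedy G X [] Y = ([], Y)"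
| "greedy G X (u # us) Y = (if u \<in> X \<union> Y then greedy G X us Y
     else (u # fst (greedy G X us (Y \<union> set (G u))), snd (greedy G X us (Y \<union> set (G u)))))"

definition walk_loop :: com where
  "walk_loop = CWhile rE (Ld rV aNB rE ;; CAdd rV rC rV ;; St aBL rV rOne ;; Ld rE aNX rE)"

text \<open>In each pass the bound on the remaining nodes drops to the current node, which keeps all
  later accesses valid.\<close>

lemma wp_walk_loop:
  assumes "chain (A aNX) (A aNB) b (r rE) zs" "b \<le> L" "r rOne = 1" "\<forall>z\<in>set zs. r rC + z < L"
  shows "wp L walk_loop (\<lambda>t' r' A'. t' \<le> t + 8 * length zs + 1 \<and>
     (\<forall>y < r rC. A' aBL y = A aBL y) \<and>
     marked (A' aBL) (r rC) = marked (A aBL) (r rC) \<union> set zs) t r A"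
proof -
  let ?I = "\<lambda>ys t' r' A'.
      (\<exists>b\<le>L. chain (A aNX) (A aNB) b (r' rE) ys) \<and> (\<forall>z\<in>set ys. r rC + z < L) \<and>
      t' + 8 * length ys \<le> t + 8 * length zs \<and> (\<forall>y < r rC. A' aBL y = A aBL y) \<and>
      marked (A' aBL) (r rC) \<union> set ys = marked (A aBL) (r rC) \<union> set zs"
  show ?thesis unfolding walk_loop_def
  proof (rule wp_While[where xs = zs and I = ?I], goal_cases)
    case 1
    show ?case using assms by auto
  next
    case (2 y ys t' r' A')
    then have "r' rE < L" "\<exists>b\<le>L. chain (A aNX) (A aNB) b (A aNX (r' rE)) ys"
      using less_le_trans by (auto intro!: exI[of _ "r' rE"])
    with 2 assms(3) show ?case by (auto simp: frame_def valid_index_def)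
  next
    case (3 t' r' A')
    then show ?case by auto
  qed
qed

definition greedy_loop :: com where
  "greedy_loop = CWhile rX (Ld rU aIN rVP ;; CAdd rA rC rU ;; Ld rB aEX rA ;; Ld rV aBL rA ;;
     CAdd rB rB rV ;; incr rVP ;; decr rX ;;
     CIf rB CSkip (St aOUT rQ rU ;; incr rQ ;; incr rCnt ;; Ld rE aHD rA ;; walk_loop))"

text \<open>A list is walked only if its vertex is selected, at 8 units per node. The lists also
  contain pins, so the walk records which pins acquire a selected neighbour.\<close>

lemma wp_greedy_loop:
  assumes "seg (A aIN) (r rVP) vs" "r rVP + length vs \<le> L" "r rX = length vs" "r rOne = 1"
    "chains A (r rC) b G" "b \<le> L" "\<forall>u\<in>set vs. r rC + u < L \<and> (\<forall>z\<in>set (G u). r rC + z < L)"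
    "greedy G (marked (A aEX) (r rC)) vs (marked (A aBL) (r rC)) = (S, Y)"
  shows "wp L greedy_loop (\<lambda>t' r' A'.
     t' \<le> t + 20 * length vs + 8 * (\<Sum>u\<leftarrow>vs. length (G u)) + 1 \<and>
     (\<forall>y < r rC. A' aBL y = A aBL y) \<and> marked (A' aBL) (r rC) = Y \<and>
     r' rCnt = r rCnt + length S \<and> r' rQ = r rQ + length S \<and> seg (A' aOUT) (r rQ) S \<and>
     (\<forall>y < r rQ. A' aOUT y = A aOUT y)) t r A"
proof -
  let ?X = "marked (A aEX) (r rC)"
  let ?I = "\<lambda>ys t' r' A'.
      seg (A aIN) (r' rVP) ys \<and> r' rX = length ys \<and> r' rVP + length ys \<le> L \<and>
      (\<forall>u\<in>set ys. r rC + u < L \<and> (\<forall>z\<in>set (G u). r rC + z < L)) \<and>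
      t' + (20 * length ys + 8 * (\<Sum>u\<leftarrow>ys. length (G u))) \<le>
        t + (20 * length vs + 8 * (\<Sum>u\<leftarrow>vs. length (G u))) \<and>
      (\<forall>y < r rC. A' aBL y = A aBL y) \<and>
      (\<exists>os. snd (greedy G ?X ys (marked (A' aBL) (r rC))) = Y \<and>
        os @ fst (greedy G ?X ys (marked (A' aBL) (r rC))) = S \<and>
        r' rCnt = r rCnt + length os \<and> r' rQ = r rQ + length os \<and> seg (A' aOUT) (r rQ) os) \<and>
      (\<forall>y < r rQ. A' aOUT y = A aOUT y)"
  show ?thesis unfolding greedy_loop_def
  proof (rule wp_While[where xs = vs and I = ?I], goal_cases)
    case 1
    show ?case using assms by auto
  next
    case (2 u ys t' r' A')
    have frame: "r' rC = r rC" "r' rOne = 1" "A' aIN = A aIN" "A' aEX = A aEX" "A' aHD = A aHD"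
      "A' aNX = A aNX" "A' aNB = A aNB"
      using 2(2) assms(4) by (simp_all add: frame_def walk_loop_def)
    note inv = 2(1)
    let ?M = "marked (A' aBL) (r rC)"
    from inv obtain os where os: "snd (greedy G ?X (u # ys) ?M) = Y"
      "os @ fst (greedy G ?X (u # ys) ?M) = S" "r' rCnt = r rCnt + length os"
      "r' rQ = r rQ + length os" "seg (A' aOUT) (r rQ) os" by blast
    from inv have P: "A aIN (r' rVP) = u" "seg (A aIN) (Suc (r' rVP)) ys" "r' rVP < L"
      "Suc (r' rVP) + length ys \<le> L" "r rC + u < L" "\<forall>z\<in>set (G u). r rC + z < L"
      by auto
    \<comment> \<open>One test of the sum of the two flags decides whether either of them is
      set.\<close>
    have mem: "A aEX (r rC + u) + A' aBL (r rC + u) \<noteq> 0 \<longleftrightarrow> u \<in> ?X \<union> ?M"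
      by (auto simp: marked_def)
    define Q where "Q = ?I ys"
    define r1 where "r1 = r'(rU := u, rA := r rC + u, rV := A' aBL (r rC + u),
      rB := A aEX (r rC + u) + A' aBL (r rC + u), rVP := Suc (r' rVP), rX := length ys)"
    have "wp L (CIf rB CSkip (St aOUT rQ rU ;; incr rQ ;; incr rCnt ;; Ld rE aHD rA ;; walk_loop))
        Q T r1 A'" if T: "T \<le> t' + 12" for T
    proof (cases "u \<in> ?X \<union> ?M")
      case True
      have "Q (T + 2) r1 A'" unfolding Q_def using True inv P os T
        by (auto simp: r1_def intro!: exI[of _ os])
      then show ?thesis using mem True by (simp add: r1_def)
    next
      case False
      define r2 where "r2 = r1(rQ := Suc (r' rQ), rCnt := Suc (r' rCnt), rE := A aHD (r rC + u))"
      define A2 where "A2 = A'(aOUT := (A' aOUT)(r' rQ := u))"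
      have chain: "chain (A2 aNX) (A2 aNB) b (r2 rE) (G u)"
        using assms(5) frame by (simp add: chains_def r2_def A2_def)
      have "wp L walk_loop Q T' r2 A2" if T': "T' \<le> T + 7" for T'
      proof (rule wp_mono[OF wp_walk_loop[where A = A2 and r = r2 and zs = "G u" and b = b]], goal_cases)
        case (5 t3 r3 A3)
        have r3: "r3 rVP = Suc (r' rVP)" "r3 rX = length ys" "r3 rCnt = Suc (r' rCnt)"
          "r3 rQ = Suc (r' rQ)" "A3 aOUT = (A' aOUT)(r' rQ := u)" "r2 rC = r rC"
          using 5(2) frame by (simp_all add: frame_def walk_loop_def r2_def r1_def A2_def)
        have m: "marked (A3 aBL) (r rC) = ?M \<union> set (G u)"
          "\<forall>y < r rC. A3 aBL y = A' aBL y" "t3 \<le> T' + 8 * length (G u) + 1"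
          using 5(1) by (simp_all add: r3 A2_def)
        show ?case unfolding Q_def using inv P os T T' m False
          by (auto simp: r3 intro!: exI[of _ "os @ [u]"])
      qed (use chain assms(6) frame P in \<open>simp_all add: r2_def r1_def\<close>)
      then show ?thesis using mem False frame P
        by (simp add: r1_def r2_def A2_def valid_index_def)
    qed
    then show ?case unfolding Q_def[symmetric] using inv P frame
      by (simp add: valid_index_def r1_def del: wp_If)
  next
    case (3 t' r' A')
    then show ?case by auto
  qed
qed

section \<open>Output of a cell\<close>

definition emit_loop :: com where
  "emit_loop = CWhile rX (Ld rV aIN rTP ;; incr rTP ;; Ld rJ aIN rTP ;; incr rTP ;;
     Ld rK aIN rTP ;; incr rTP ;; CAdd rTP rTP rK ;; Ld rA aCN rJ ;; decr rX ;;
     CIf rA (St aOUT rQ rV ;; incr rQ ;; St aOUT rQ rJ ;; incr rQ ;; St aOUT rQ rZ ;; incr rQ)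
       CSkip)"

lemma wp_emit_loop:
  assumes "seg (A aIN) (r rTP) (enc_nonterms ts)" "r rTP + length (enc_nonterms ts) \<le> L"
    "r rX = length ts" "r rOne = 1" "r rZ = 0" "\<forall>(v, j, xs)\<in>set ts. j < L \<and> A aCN j = n j"
  shows "wp L emit_loop (\<lambda>t' r' A'. t' \<le> t + 8 * length (enc_nonterms ts) + 1 \<and>
     r' rQ = r rQ + length (enc_nonterms (kept n ts)) \<and>
     seg (A' aOUT) (r rQ) (enc_nonterms (kept n ts)) \<and>
     (\<forall>y < r rQ. A' aOUT y = A aOUT y)) t r A"
proof -
  let ?I = "\<lambda>ys t' r' A'.
      seg (A aIN) (r' rTP) (enc_nonterms ys) \<and> r' rX = length ys \<and>
      r' rTP + length (enc_nonterms ys) \<le> L \<and> (\<forall>(v, j, xs)\<in>set ys. j < L \<and> A aCN j = n j) \<and>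
      t' + 8 * length (enc_nonterms ys) \<le> t + 8 * length (enc_nonterms ts) \<and>
      (\<exists>os. os @ enc_nonterms (kept n ys) = enc_nonterms (kept n ts) \<and>
        r' rQ = r rQ + length os \<and> seg (A' aOUT) (r rQ) os) \<and>
      (\<forall>y < r rQ. A' aOUT y = A aOUT y)"
  show ?thesis unfolding emit_loop_def
  proof (rule wp_While[where xs = ts and I = ?I], goal_cases)
    case 1
    show ?case using assms by auto
  next
    case (2 y ys t' r' A')
    obtain v j xs where y: "y = (v, j, xs)" by (cases y)
    have frame: "r' rOne = 1" "r' rZ = 0" "A' aIN = A aIN" "A' aCN = A aCN"
      using 2(2) assms(4,5) by (simp_all add: frame_def)
    note inv = 2(1)[unfolded y]
    then obtain os where os: "os @ enc_nonterms (kept n ((v, j, xs) # ys)) = enc_nonterms (kept n ts)"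
      "r' rQ = r rQ + length os" "seg (A' aOUT) (r rQ) os" by blast
    from inv have P: "A aIN (r' rTP) = v" "A aIN (Suc (r' rTP)) = j"
      "A aIN (Suc (Suc (r' rTP))) = length xs" "A aCN j = n j" "j < L"
      "seg (A aIN) (Suc (Suc (Suc (r' rTP))) + length xs) (enc_nonterms ys)"
      "Suc (Suc (Suc (r' rTP))) + length xs + length (enc_nonterms ys) \<le> L"
      by auto
    let ?out = "(A' aOUT)(r' rQ := v, Suc (r' rQ) := j, Suc (Suc (r' rQ)) := 0)"
    have "\<exists>os'. os' @ enc_nonterms (kept n ys) = enc_nonterms (kept n ts) \<and>
        Suc (Suc (Suc (r' rQ))) = r rQ + length os' \<and> seg ?out (r rQ) os'" if "n j \<noteq> 0"
      using os that by (intro exI[of _ "os @ [v, j, 0]"]) simp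
    moreover have "\<exists>os'. os' @ enc_nonterms (kept n ys) = enc_nonterms (kept n ts) \<and>
        r' rQ = r rQ + length os' \<and> seg (A' aOUT) (r rQ) os'" if "n j = 0"
      using os that by (intro exI[of _ os]) simp
    ultimately show ?case using inv P frame os(2)
      by (simp add: y valid_index_def add_ac)
  next
    case (3 t' r' A')
    then show ?case by auto
  qed
qed

record code =
  cvs :: "nat list"
  cps :: "nat list"
  cts :: nonterms
  ces :: "(nat \<times> nat) list"

definition enc_cell :: "code \<Rightarrow> nat list" where
  "enc_cell d = [length (cvs d), length (cps d), length (cts d), length (ces d)] @ cvs d @ cps d @
     enc_nonterms (cts d) @ enc_edges (ces d)"

text \<open>\<open>[1, 0, 0, 0, 0]\<close> is the dummy cell: one vertex, no pins, nonterminals or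
  edges, and the vertex is named 0.\<close>

definition out_cell :: "(nat \<Rightarrow> nat) \<Rightarrow> nonterms \<Rightarrow> nat list \<Rightarrow> nat \<Rightarrow> nat list" where
  "out_cell n ts S m = (if m = 0 then [1, 0, 0, 0, 0]
     else [length (kept n ts) + length S, 0, length (kept n ts), 0] @
       map fst (kept n ts) @ S @ enc_nonterms (kept n ts))"

text \<open>The header is known only after the vertices have been written. Its place was left free
  at \<open>rH\<close>, so the number of vertices is the distance from \<open>rH\<close> to
  \<open>rQ\<close> minus 4.\<close>

definition finish_cell :: com where
  "finish_cell = (CIf rCnt
     (CConst rB 4 ;; CSub rN rQ rH ;; CSub rN rN rB ;; St aOUT rH rN ;; incr rH ;;
      St aOUT rH rZ ;; incr rH ;; St aOUT rH rKT ;; incr rH ;; St aOUT rH rZ ;;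
      copy rX rNT ;; emit_loop)
     (St aOUT rH rOne ;; incr rH ;; St aOUT rH rZ ;; incr rH ;; St aOUT rH rZ ;; incr rH ;;
      St aOUT rH rZ ;; incr rH ;; St aOUT rH rZ ;; CAdd rQ rH rOne) ;;
     St aCN rI rCnt ;; incr rI)"

lemma wp_finish_cell:
  assumes "seg (A aOUT) (r rH + 4) (map fst (kept n ts) @ S)"
    "r rQ = r rH + 4 + length (kept n ts) + length S" "r rKT = length (kept n ts)"
    "seg (A aIN) (r rTP) (enc_nonterms ts)" "r rTP + length (enc_nonterms ts) \<le> L"
    "r rNT = length ts" "r rOne = 1" "r rZ = 0" "r rI < L"
    "\<forall>(v, j, xs)\<in>set ts. j < L \<and> A aCN j = n j"
  shows "wp L finish_cell (\<lambda>t' r' A'. t' \<le> t + 8 * length (enc_nonterms ts) + 30 \<and>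
     r' rQ = r rH + length (out_cell n ts S (r rCnt)) \<and>
     seg (A' aOUT) (r rH) (out_cell n ts S (r rCnt)) \<and> (\<forall>y < r rH. A' aOUT y = A aOUT y) \<and>
     A' aCN = (A aCN)(r rI := r rCnt) \<and> r' rI = Suc (r rI)) t r A"
proof (cases "r rCnt = 0")
  case True
  then show ?thesis using assms
    by (simp add: finish_cell_def out_cell_def valid_index_def)
next
  case False
  define r1 where "r1 = r(rB := 4, rN := length (kept n ts) + length S,
    rH := Suc (Suc (Suc (r rH))), rX := length ts)"
  define A1 where "A1 = A(aOUT := (A aOUT)(r rH := length (kept n ts) + length S,
    Suc (r rH) := 0, Suc (Suc (r rH)) := length (kept n ts), Suc (Suc (Suc (r rH))) := 0))"
  define Q where "Q = (\<lambda>t' r' A'. t' \<le> t + 8 * length (enc_nonterms ts) + 30 \<and>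
     r' rQ = r rH + length (out_cell n ts S (r rCnt)) \<and>
     seg (A' aOUT) (r rH) (out_cell n ts S (r rCnt)) \<and> (\<forall>y < r rH. A' aOUT y = A aOUT y) \<and>
     A' aCN = (A aCN)(r rI := r rCnt) \<and> r' rI = Suc (r rI))"
  have "wp L emit_loop (wp L (St aCN rI rCnt ;; incr rI) Q) T r1 A1" if T: "T \<le> t + 20" for T
  proof (rule wp_mono[OF wp_emit_loop[where ts = ts and n = n]], goal_cases)
    case (7 t2 r2 A2)
    have frame: "r2 rI = r rI" "r2 rCnt = r rCnt" "A2 aCN = A aCN" "r2 rOne = 1" "r1 rQ = r rQ"
      using 7(2) assms(7) by (simp_all add: frame_def emit_loop_def r1_def A1_def)
    have below: "A2 aOUT y = A1 aOUT y" if "y < r rQ" for y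
      using 7(1) that by (simp add: frame)
    \<comment> \<open>\<open>emit_loop\<close> writes from \<open>rQ\<close> on, behind the
      vertices, and the header lies in front of them.\<close>
    have "seg (A2 aOUT) (r rH + 4) (map fst (kept n ts) @ S) =
      seg (A1 aOUT) (r rH + 4) (map fst (kept n ts) @ S)"
      by (rule seg_cong) (use assms(2) in \<open>auto intro: below\<close>)
    also have "\<dots> = seg (A aOUT) (r rH + 4) (map fst (kept n ts) @ S)"
      by (rule seg_cong) (simp add: A1_def)
    finally have "seg (A2 aOUT) (r rH + 4) (map fst (kept n ts) @ S)" using assms(1) by simp
    moreover have "seg (A2 aOUT) (r rH)
        [length (kept n ts) + length S, 0, length (kept n ts), 0]"
      using assms(2) below by (simp add: A1_def)
    moreover have "seg (A2 aOUT) (r rQ) (enc_nonterms (kept n ts))"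
      using 7(1) by (simp add: frame)
    ultimately have "seg (A2 aOUT) (r rH) (out_cell n ts S (r rCnt))"
      using False assms(2) by (simp add: out_cell_def numeral_eq_Suc add_ac)
    moreover have "\<forall>y < r rH. A2 aOUT y = A aOUT y"
      using assms(2) below by (simp add: A1_def)
    ultimately show ?case using 7(1) T False assms(2,9)
      by (simp add: Q_def frame valid_index_def out_cell_def)
  qed (use assms in \<open>auto simp: r1_def A1_def\<close>)
  then show ?thesis unfolding Q_def[symmetric] using False assms(2,3,6-8)
    by (simp add: finish_cell_def valid_index_def r1_def A1_def)
qed

section \<open>Processing one cell\<close>

definition wf_code :: "code \<Rightarrow> bool" where
  "wf_code d \<longleftrightarrow> (let n = length (cvs d) in set (cvs d) \<subseteq> {..<n} \<and> set (cps d) \<subseteq> {..<n} \<and>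
     (\<forall>(v, j, xs)\<in>set (cts d). v < n \<and> set xs \<subseteq> {..<n}) \<and> (\<forall>(u, v)\<in>set (ces d). u < n \<and> v < n))"

lemma set_adjacency:
  "set (adjacency es G x) = set (G x) \<union> {y. (x, y) \<in> set es \<or> (y, x) \<in> set es}"
proof (induction es arbitrary: G)
  case (Cons e es)
  obtain u v where "e = (u, v)" by (cases e)
  then show ?case by (auto simp: Cons.IH Let_def)
qed simp

text \<open>An edge adds one list entry at each end and occupies two numbers in the code. This
  bounds the cost of all walks by the length of the code.\<close>

lemma sum_length_adjacency:
  assumes "finite V" "\<forall>(u, v)\<in>set es. u \<in> V \<and> v \<in> V"
  shows "(\<Sum>x\<in>V. length (adjacency es G x)) = (\<Sum>x\<in>V. length (G x)) + length (enc_edges es)"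
  using assms(2)
proof (induction es arbitrary: G)
  case (Cons e es)
  have add: "(\<Sum>x\<in>V. length ((G(u := w # G u)) x)) = Suc (\<Sum>x\<in>V. length (G x))"
    if "u \<in> V" for u w and G :: "nat \<Rightarrow> nat list"
    using assms(1) that by (simp add: sum.remove[of V u])
  obtain u v where e: "e = (u, v)" by (cases e)
  with Cons.prems have "u \<in> V" "v \<in> V" by auto
  then show ?case using Cons.prems
    by (simp add: e Cons.IH Let_def add del: fun_upd_apply)
qed simp

lemma greedy_blocked_subset:
  "snd (greedy G X vs Y) \<subseteq> Y \<union> (\<Union>u\<in>set vs. set (G u))"
proof (induction vs arbitrary: Y)
  case (Cons u vs)
  from Cons.IH[of Y] Cons.IH[of "Y \<union> set (G u)"] show ?case by auto
qed simp

text \<open>The last cell is recognised by \<open>rRem\<close> dropping to 0;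
  \<open>exclude_loop\<close> then runs on an empty list of pins. Adding 4 to \<open>rQ\<close>
  leaves room for the header.\<close>

definition cell_prog :: com where
  "cell_prog = (copy rC rP ;; St aCP rI rC ;;
     Ld rN aIN rP ;; incr rP ;; Ld rNP aIN rP ;; incr rP ;; Ld rNT aIN rP ;; incr rP ;;
     Ld rM aIN rP ;; incr rP ;;
     copy rVP rP ;; CAdd rPP rP rN ;; CAdd rP rPP rNP ;; copy rTP rP ;;
     copy rH rQ ;; CConst rB 4 ;; CAdd rQ rQ rB ;; CConst rCnt 0 ;; CConst rKT 0 ;; decr rRem ;;
     CIf rRem (copy rX rNP) (CConst rX 0) ;; exclude_loop ;;
     copy rX rNT ;; nonterm_loop ;; copy rX rM ;; edge_loop ;; copy rX rN ;; greedy_loop ;;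
     finish_cell)"

lemma cell_prog_mods:
  "25 \<notin> reg_mods cell_prog" "0 \<notin> reg_mods cell_prog" "0 \<notin> array_mods cell_prog"
  by (simp_all add: cell_prog_def finish_cell_def emit_loop_def greedy_loop_def walk_loop_def
      edge_loop_def insert_node_def nonterm_loop_def block_loop_def exclude_loop_def)

text \<open>The hypothesis that all marks and heads from \<open>c\<close> on are 0 replaces any
  initialisation. The conclusion restores it for the next cell, since all marks fall inside the code
  of the present one.\<close>

lemma wp_cell_prog:
  fixes d :: code and r :: "nat \<Rightarrow> nat" and A :: "nat \<Rightarrow> nat \<Rightarrow> nat"
  defines "c \<equiv> r rP"
  assumes inp: "seg (A aIN) c (enc_cell d)" "c + length (enc_cell d) \<le> L" "wf_code d"
    and regs: "r rI < L" "r rRem = Suc m" "r rOne = 1" "r rZ = 0" "0 < c"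
    and zero: "\<forall>x\<ge>c. A aEX x = 0 \<and> A aBL x = 0 \<and> A aHD x = 0"
    and fin: "\<forall>(v, j, xs)\<in>set (cts d). j < r rI \<and> finished_cell L c A j (qs j) (F j) (n j) \<and>
      length xs = length (qs j)"
    and greedy: "greedy (adjacency (ces d) (\<lambda>_. []))
      ((if m = 0 then {} else set (cps d)) \<union> fst ` set (cts d)) (cvs d)
      (blocked_by qs F (cts d)) = (S, Y)"
    and dist: "distinct (cvs d)"
  defines "k \<equiv> count_nonterms n (cts d) + length S"
  shows "wp L cell_prog (\<lambda>t' r' A'. t' \<le> t + 40 * length (enc_cell d) \<and>
     r' rP = c + length (enc_cell d) \<and> r' rI = Suc (r rI) \<and> r' rRem = m \<and>
     r' rQ = r rQ + length (out_cell n (cts d) S k) \<and>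
     seg (A' aOUT) (r rQ) (out_cell n (cts d) S k) \<and> (\<forall>y < r rQ. A' aOUT y = A aOUT y) \<and>
     A' aCP = (A aCP)(r rI := c) \<and> A' aCN = (A aCN)(r rI := k) \<and>
     (\<forall>y < c. A' aBL y = A aBL y) \<and> marked (A' aBL) c = Y \<and> r' rCnt = k \<and>
     (\<forall>x \<ge> c + length (enc_cell d). A' aEX x = 0 \<and> A' aBL x = 0 \<and> A' aHD x = 0)) t r A"
proof -
  let ?vs = "cvs d" and ?ps = "cps d" and ?ts = "cts d" and ?es = "ces d"
  let ?n = "length ?vs"
  define a where "a = c + 4 + ?n + length ?ps"
  define b where "b = a + length (enc_nonterms ?ts)"
  have len: "length (enc_cell d) = 4 + ?n + length ?ps + length (enc_nonterms ?ts) +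
    length (enc_edges ?es)" by (simp add: enc_cell_def)
  have L: "b + length (enc_edges ?es) \<le> L" using inp(2) by (simp add: len a_def b_def)
  have hd: "A aIN c = ?n" "A aIN (Suc c) = length ?ps" "A aIN (Suc (Suc c)) = length ?ts"
    "A aIN (Suc (Suc (Suc c))) = length ?es" and
    segs: "seg (A aIN) (c + 4) ?vs" "seg (A aIN) (c + 4 + ?n) ?ps"
      "seg (A aIN) a (enc_nonterms ?ts)" "seg (A aIN) b (enc_edges ?es)"
    using inp(1) by (simp_all add: enc_cell_def numeral_eq_Suc add_ac a_def b_def)
  have wf: "set ?vs \<subseteq> {..<?n}" "set ?ps \<subseteq> {..<?n}"
    "\<And>v j xs. (v, j, xs) \<in> set ?ts \<Longrightarrow> v < ?n \<and> set xs \<subseteq> {..<?n}"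
    "\<And>u v. (u, v) \<in> set ?es \<Longrightarrow> u < ?n \<and> v < ?n"
    using inp(3) by (auto simp: wf_code_def Let_def)
  have less: "c + x < L" if "x < ?n" for x using L that by (simp add: a_def b_def)
  define ps where "ps = (if m = 0 then [] else ?ps)"
  define X where "X = set ps \<union> fst ` set ?ts"
  define G where "G = adjacency ?es (\<lambda>_. [])"
  have X: "X \<subseteq> {..<?n}"
    using wf(2) by (auto simp: X_def ps_def dest: wf(3) split: if_splits)
  have G: "set (G x) = {y. (x, y) \<in> set ?es \<or> (y, x) \<in> set ?es}" for x
    by (simp add: G_def set_adjacency)
  have bl: "blocked_by qs F ?ts \<subseteq> {..<?n}"
    unfolding blocked_by_def by (auto dest!: wf(3) set_zip_leftD)
  have "Y \<subseteq> blocked_by qs F ?ts \<union> (\<Union>u\<in>set ?vs. set (G u))"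
    using greedy_blocked_subset[of G _ ?vs "blocked_by qs F ?ts"] greedy
    unfolding G_def by (metis snd_conv)
  moreover have "set (G u) \<subseteq> {..<?n}" for u by (auto simp: G dest: wf(4))
  \<comment> \<open>Blocked marks do not reach beyond the vertices, and hence not into the entries
    of the next cell.\<close>
  ultimately have Y: "Y \<subseteq> {..<?n}" using bl by blast
  define Q where "Q = (\<lambda>t' r' A'. t' \<le> t + 40 * length (enc_cell d) \<and>
     r' rP = c + length (enc_cell d) \<and> r' rI = Suc (r rI) \<and> r' rRem = m \<and>
     r' rQ = r rQ + length (out_cell n (cts d) S k) \<and>
     seg (A' aOUT) (r rQ) (out_cell n (cts d) S k) \<and> (\<forall>y < r rQ. A' aOUT y = A aOUT y) \<and>
     A' aCP = (A aCP)(r rI := c) \<and> A' aCN = (A aCN)(r rI := k) \<and>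
     (\<forall>y < c. A' aBL y = A aBL y) \<and> marked (A' aBL) c = Y \<and> r' rCnt = k \<and>
     (\<forall>x \<ge> c + length (enc_cell d). A' aEX x = 0 \<and> A' aBL x = 0 \<and> A' aHD x = 0))"
  define r1 where "r1 = r(rC := c, rN := ?n, rNP := length ?ps, rNT := length ?ts,
    rM := length ?es, rVP := c + 4, rPP := c + 4 + ?n, rP := a, rTP := a, rH := r rQ, rB := 4,
    rQ := r rQ + 4, rCnt := 0, rKT := 0, rRem := m, rX := length ps)"
  define A1 where "A1 = A(aCP := (A aCP)(r rI := c))"
  \<comment> \<open>\<open>r1\<close> and \<open>A1\<close> are the state after the straight-line
    prologue, for which 40 units are ample.\<close>
  have "wp L exclude_loop (wp L (copy rX rNT ;; nonterm_loop ;; copy rX rM ;; edge_loop ;;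
      copy rX rN ;; greedy_loop ;; finish_cell) Q) T1 r1 A1" if T1: "T1 \<le> t + 40" for T1
  proof (rule wp_mono[OF wp_exclude_loop[where ps = ps]], goal_cases)
    case (6 t2 r2 A2)
    have f2: "A2 x = A1 x" if "x \<noteq> aEX" for x
      using 6(2) that by (simp add: frame_def exclude_loop_def)
    have r2: "r2 x = r1 x" if "x \<notin> {rX, rPP, rU}" for x
      using 6(2) that by (simp add: frame_def exclude_loop_def)
    have t2: "t2 \<le> T1 + 8 * length ps + 1" using 6(1) by simp
    have "marked (A aEX) c = {}" using zero by (simp add: marked_def)
    then have m2: "marked (A2 aEX) c = set ps"
      using 6(1) by (simp add: A1_def r1_def)
    have b2: "marked (A2 aBL) c = {}" using zero f2 by (simp add: marked_def A1_def)
    have fin2: "finished_cell L c A2 j (qs j) (F j) (n j)" if "(v, j, xs) \<in> set ?ts" for v j xs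
    proof -
      have "finished_cell L c A2 j (qs j) (F j) (n j) = finished_cell L c A j (qs j) (F j) (n j)"
        by (rule finished_cell_cong) (use fin that f2 in \<open>auto simp: A1_def\<close>)
      with fin that show ?thesis by auto
    qed
    let ?r2 = "r2(rX := length ?ts)"
    have "wp L nonterm_loop (wp L (copy rX rM ;; edge_loop ;; copy rX rN ;; greedy_loop ;;
      finish_cell) Q) (t2 + 1) ?r2 A2"
    proof (rule wp_mono[OF wp_nonterm_loop[where ts = ?ts and qs = qs and F = F and n = n]],
        goal_cases)
      case 6
      have "finished_cell L c A2 j (qs j) (F j) (n j) \<and> length xs = length (qs j) \<and>
          c + v < L \<and> (\<forall>x\<in>set xs. c + x < L)" if mem: "(v, j, xs) \<in> set ?ts" for v j xs
        using fin2[OF mem] bspec[OF fin mem] wf(3)[OF mem] less by auto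
      then show ?case by (auto simp: r2 r1_def)
    next
      case (7 t3 r3 A3)
      have f3: "A3 x = A2 x" if "x \<notin> {aEX, aBL, aOUT}" for x
        using 7(2) that by (simp add: frame_def nonterm_loop_def block_loop_def)
      have r3: "r3 x = r1 x" if "x \<in> {rOne, rI, rRem, rC, rN, rNT, rM, rVP, rTP, rH, rZ}" for x
        using 7(2) that r2 by (auto simp: frame_def nonterm_loop_def block_loop_def)
      have t3: "t3 \<le> t2 + 1 + 15 * length (enc_nonterms ?ts) + 1" and P3: "r3 rP = b"
        and m3: "marked (A3 aEX) c = X" "marked (A3 aBL) c = blocked_by qs F ?ts"
        and c3: "r3 rCnt = count_nonterms n ?ts" "r3 rKT = length (kept n ?ts)"
          "r3 rQ = r rQ + 4 + length (kept n ?ts)"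
        and o3: "seg (A3 aOUT) (r rQ + 4) (map fst (kept n ?ts))"
          "\<forall>y < r rQ + 4. A3 aOUT y = A aOUT y" "\<forall>y < c. A3 aBL y = A aBL y"
        using 7(1) m2 b2 f2 by (simp_all add: r2 r1_def A1_def b_def X_def)
      let ?r3 = "r3(rX := length ?es)"
      have "wp L edge_loop (wp L (copy rX rN ;; greedy_loop ;; finish_cell) Q) (t3 + 1) ?r3 A3"
      proof (rule wp_mono[OF wp_edge_loop[where es = ?es and G = "\<lambda>_. []"]], goal_cases)
        case 6
        then show ?case using zero f3 f2 by (simp add: chains_def r3 r1_def A1_def)
      next
        case 7
        then show ?case using wf(4) less by (auto simp: r3 r1_def)
      next
        case (8 t4 r4 A4)
        have f4: "A4 x = A3 x" if "x \<notin> {aHD, aNX, aNB}" for x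
          using 8(2) that by (simp add: frame_def edge_loop_def insert_node_def)
        have r4: "r4 x = r3 x" if "x \<notin> {rX, rJ, rU, rV, rA, rB, rP}" for x
          using 8(2) that by (simp add: frame_def edge_loop_def insert_node_def)
        have t4: "t4 \<le> t3 + 1 + 13 * length (enc_edges ?es) + 1"
          and P4: "r4 rP = b + length (enc_edges ?es)"
          and ch4: "chains A4 c (b + length (enc_edges ?es)) G"
          using 8(1) P3 by (auto simp: r3 r1_def G_def)
        \<comment> \<open>Beyond the vertices \<open>G\<close> is empty, and the head of an empty
          list is 0.\<close>
        have hd4: "A4 aHD x = 0" if "c + ?n \<le> x" for x
        proof -
          have "set (G (x - c)) = {}" using that by (auto simp: G dest: wf(4))
          then have "G (x - c) = []" by simp
          with ch4 that show ?thesis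
            unfolding chains_def by (metis add_leD1 chain.simps(1) le_add_diff_inverse)
        qed
        let ?r4 = "r4(rX := ?n)"
        have "wp L greedy_loop (wp L finish_cell Q) (t4 + 1) ?r4 A4"
        proof (rule wp_mono[OF wp_greedy_loop[where vs = ?vs and G = G
              and b = "b + length (enc_edges ?es)" and S = S
              and Y = Y]], goal_cases)
          case 7
          have "set (G u) \<subseteq> {..<?n}" for u by (auto simp: G dest: wf(4))
          then show ?case using wf(1) less by (auto simp: r4 r3 r1_def)
        next
          case 8
          have "marked (A4 aEX) c = X" "marked (A4 aBL) c = blocked_by qs F ?ts"
            using m3 by (simp_all add: f4)
          then show ?case using greedy
            by (cases "m = 0") (simp_all add: r4 r3 r1_def G_def X_def ps_def)
        next
          case (9 t5 r5 A5)
          have f5: "A5 x = A4 x" if "x \<notin> {aBL, aOUT}" for x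
            using 9(2) that by (simp add: frame_def greedy_loop_def walk_loop_def)
          have r5: "r5 x = r4 x" if "x \<in> {rOne, rI, rRem, rP, rTP, rNT, rKT, rH, rZ}" for x
            using 9(2) that by (auto simp: frame_def greedy_loop_def walk_loop_def)
          \<comment> \<open>The vertices are listed without repetition, so the walks together visit
            each list at most once.\<close>
          have "(\<Sum>u\<leftarrow>?vs. length (G u)) = (\<Sum>u\<in>set ?vs. length (G u))"
            using dist by (simp add: sum_list_distinct_conv_sum_set)
          also have "\<dots> \<le> (\<Sum>u\<in>{..<?n}. length (G u))"
            using wf(1) by (intro sum_mono2) auto
          also have "\<dots> = length (enc_edges ?es)"
            unfolding G_def using wf(4) by (subst sum_length_adjacency) auto
          finally have t5: "t5 \<le> t4 + 1 + 20 * ?n + 8 * length (enc_edges ?es) + 1"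
            using 9(1) by linarith
          have c5: "r5 rCnt = k" "r5 rQ = r rQ + 4 + length (kept n ?ts) + length S"
            and m5: "marked (A5 aBL) c = Y" "\<forall>y < c. A5 aBL y = A aBL y"
            and s5: "seg (A5 aOUT) (r rQ + 4 + length (kept n ?ts)) S"
            and o5: "\<forall>y < r rQ + 4 + length (kept n ?ts). A5 aOUT y = A4 aOUT y"
            using 9(1) c3 o3 by (simp_all add: r4 r3 r1_def f4 k_def)
          have "seg (A5 aOUT) (r rQ + 4) (map fst (kept n ?ts)) =
              seg (A3 aOUT) (r rQ + 4) (map fst (kept n ?ts))"
            by (rule seg_cong) (use o5 f4 in auto)
          with o3 s5 have seg5: "seg (A5 aOUT) (r rQ + 4) (map fst (kept n ?ts) @ S)" by simp
          have low5: "\<forall>y < r rQ. A5 aOUT y = A aOUT y" using o5 o3 f4 by simp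
          have reg5: "r5 rH = r rQ" "r5 rKT = length (kept n ?ts)" "r5 rTP = a"
            "r5 rNT = length ?ts" "r5 rOne = 1" "r5 rZ = 0" "r5 rI = r rI" "r5 rRem = m"
            "r5 rP = c + length (enc_cell d)"
            using c3 P4 regs by (simp_all add: r5 r4 r3 r1_def len a_def b_def)
          have arr5: "A5 aIN = A aIN" "A5 aCN = A aCN" "A5 aCP = (A aCP)(r rI := c)"
            "A5 aEX = A3 aEX" "A5 aHD = A4 aHD"
            by (simp_all add: f5 f4 f3 f2 A1_def)
          note arr5 = arr5 arr5(3)[unfolded One_nat_def]
          have zero5: "A5 aEX x = 0 \<and> A5 aBL x = 0 \<and> A5 aHD x = 0"
            if x: "c + length (enc_cell d) \<le> x" for x
          proof -
            have "x - c \<notin> X" "x - c \<notin> Y" using X Y x by (auto simp: len)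
            then have "A3 aEX (c + (x - c)) = 0" "A5 aBL (c + (x - c)) = 0"
              unfolding m3(1)[symmetric] m5(1)[symmetric] by (simp_all add: marked_def)
            moreover have "c + (x - c) = x" using x by simp
            ultimately show ?thesis using hd4[of x] x by (simp add: arr5 len)
          qed
          show ?case
          proof (rule wp_mono[OF wp_finish_cell[where n = n and ts = ?ts and S = S]], goal_cases)
            case (11 t6 r6 A6)
            have f6: "A6 x = A5 x" if "x \<notin> {aCN, aOUT}" for x
              using 11(2) that by (simp add: frame_def finish_cell_def emit_loop_def)
            have r6: "r6 rRem = m" "r6 rP = c + length (enc_cell d)" "r6 rCnt = k"
              using 11(2) c5 reg5 by (simp_all add: frame_def finish_cell_def emit_loop_def)
            \<comment> \<open>Cost per number: 20 for vertices, 8 for pins, \<open>15 + 8\<close>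
              for nonterminals, \<open>13 + 8\<close> for edges. The remaining constants sum to 77
              and are paid by the four header numbers at 40 each.\<close>
            have "length ps \<le> length ?ps" by (simp add: ps_def)
            then have "t6 \<le> t + 40 * length (enc_cell d)"
              using 11(1) T1 t2 t3 t4 t5 by (simp add: len)
            then show ?case using 11(1) low5 m5 zero5
              by (simp add: Q_def r6 f6 reg5 arr5 c5)
          next
            case 10
            show ?case using fin fin2 by (auto simp: arr5 finished_cell_def)
          qed (use seg5 c5 reg5 arr5 segs L regs in \<open>simp_all add: a_def b_def\<close>)
        qed (use segs L regs ch4 P4 in
          \<open>simp_all add: r4 r3 r1_def f4 f3 f2 A1_def a_def b_def\<close>)
        then show ?case by (simp add: r4 r3 r1_def regs)
      qed (use segs L regs P3 in \<open>simp_all add: r3 r1_def f3 f2 A1_def b_def a_def\<close>)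
      then show ?case by (simp add: r3 r1_def regs)
    qed (use segs L regs in \<open>simp_all add: r2 r1_def f2 A1_def b_def a_def\<close>)
    then show ?case by (simp add: r2 r1_def regs)
  qed (use segs L regs wf less in \<open>auto simp: r1_def A1_def a_def b_def ps_def\<close>)
  moreover have four: "Suc (Suc (Suc (Suc x))) = x + 4" for x by simp
  ultimately show ?thesis unfolding Q_def[symmetric]
    using hd L regs by (cases "m = 0") (simp_all add: four cell_prog_def valid_index_def r1_def
        A1_def a_def b_def ps_def c_def[symmetric])
qed

section \<open>Correctness of the whole run\<close>

text \<open>
  The selected vertices of cell \<open>i\<close>, its blocked vertices, and the number of selected vertices of
  its expansion.  The guard \<open>j < i\<close> serves termination only.
\<close>

fun cell_result :: "code list \<Rightarrow> nat \<Rightarrow> nat list \<times> nat set \<times> nat" where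
  "cell_result ds i =
    (let R = (\<lambda>j. if j < i then cell_result ds j else ([], {}, 0)); d = ds ! i;
       (S, Y) = greedy (adjacency (ces d) (\<lambda>_. []))
         ((if Suc i = length ds then {} else set (cps d)) \<union> fst ` set (cts d)) (cvs d)
         (blocked_by (\<lambda>j. cps (ds ! j)) (\<lambda>j. fst (snd (R j))) (cts d))
     in (S, Y, count_nonterms (\<lambda>j. snd (snd (R j))) (cts d) + length S))"

declare cell_result.simps [simp del]

definition sel :: "code list \<Rightarrow> nat \<Rightarrow> nat list" where "sel ds i = fst (cell_result ds i)"
definition blocked :: "code list \<Rightarrow> nat \<Rightarrow> nat set" where "blocked ds i = fst (snd (cell_result ds i))"
definition sel_count :: "code list \<Rightarrow> nat \<Rightarrow> nat" where "sel_count ds i = snd (snd (cell_result ds i))"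

definition codes_ok :: "code list \<Rightarrow> bool" where
  "codes_ok ds \<longleftrightarrow> ds \<noteq> [] \<and> (\<forall>i < length ds. wf_code (ds ! i) \<and> distinct (cvs (ds ! i)) \<and>
     (\<forall>(v, j, xs)\<in>set (cts (ds ! i)). j < i \<and> length xs = length (cps (ds ! j))))"

text \<open>Types smaller than \<open>i\<close> never meet the default value of the guard, which
  leaves the plain recursion.\<close>

lemma cell_result_eqs:
  assumes "\<forall>(v, j, xs)\<in>set (cts (ds ! i)). j < i"
  shows "greedy (adjacency (ces (ds ! i)) (\<lambda>_. []))
      ((if Suc i = length ds then {} else set (cps (ds ! i))) \<union> fst ` set (cts (ds ! i)))
      (cvs (ds ! i)) (blocked_by (\<lambda>j. cps (ds ! j)) (blocked ds) (cts (ds ! i))) =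
      (sel ds i, blocked ds i)"
    and "sel_count ds i = count_nonterms (sel_count ds) (cts (ds ! i)) + length (sel ds i)"
proof -
  let ?R = "\<lambda>j. if j < i then cell_result ds j else ([], {}, 0)"
  have lt: "j < i" if "(v, j, xs) \<in> set (cts (ds ! i))" for v j xs
    using assms that by auto
  have "blocked_by qs (\<lambda>j. fst (snd (?R j))) (cts (ds ! i)) =
      blocked_by qs (blocked ds) (cts (ds ! i))" for qs
    unfolding blocked_by_def
  proof (rule SUP_cong, goal_cases)
    case (2 y)
    obtain v j xs where "y = (v, j, xs)" by (cases y)
    with 2 lt show ?case by (simp add: blocked_def)
  qed simp
  moreover have "count_nonterms (\<lambda>j. snd (snd (?R j))) (cts (ds ! i)) =
      count_nonterms (sel_count ds) (cts (ds ! i))"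
    unfolding count_nonterms_def
    by (rule arg_cong[where f = sum_list], rule map_cong)
      (auto simp: sel_count_def dest: lt)
  moreover note cell_result.simps[of ds i]
  ultimately show "greedy (adjacency (ces (ds ! i)) (\<lambda>_. []))
      ((if Suc i = length ds then {} else set (cps (ds ! i))) \<union> fst ` set (cts (ds ! i)))
      (cvs (ds ! i)) (blocked_by (\<lambda>j. cps (ds ! j)) (blocked ds) (cts (ds ! i))) =
      (sel ds i, blocked ds i)"
    "sel_count ds i = count_nonterms (sel_count ds) (cts (ds ! i)) + length (sel ds i)"
    by (simp_all add: Let_def sel_def blocked_def[of ds i] sel_count_def[of ds i]
        split: prod.splits)
qed

text \<open>The leading 1 accounts for the number of cells at address 0; it makes every address
  inside a cell positive, as list nodes have to be.\<close>

definition cell_pos :: "code list \<Rightarrow> nat \<Rightarrow> nat" where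
  "cell_pos ds i = 1 + length (concat (map enc_cell (take i ds)))"

lemma cell_pos_Suc:
  "i < length ds \<Longrightarrow> cell_pos ds (Suc i) = cell_pos ds i + length (enc_cell (ds ! i))"
  by (simp add: cell_pos_def take_Suc_conv_app_nth)

definition result_cell :: "code list \<Rightarrow> nat \<Rightarrow> nat list" where
  "result_cell ds i = out_cell (sel_count ds) (cts (ds ! i)) (sel ds i) (sel_count ds i)"

section \<open>The loop over all cells\<close>

definition main_prog :: com where
  "main_prog = (CConst rOne 1 ;; Ld rRem aIN rZ ;; CConst rP 1 ;; CConst rQ 1 ;;
     St aOUT rQ rRem ;; CConst rQ 2 ;; CWhile rRem cell_prog ;; St aOUT rZ rCnt)"

definition enc_codes :: "code list \<Rightarrow> nat list" where
  "enc_codes ds = length ds # concat (map enc_cell ds)"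

text \<open>Makes cell numbers valid indices of the tables indexed by cells, and lets additive
  constants be absorbed by the input length.\<close>

lemma length_codes_le: "length ds + 1 \<le> length (enc_codes ds)"
  unfolding enc_codes_def by (induction ds) (auto simp: enc_cell_def)

text \<open>The invariant says that all earlier cells are finished, with the marks of their pins
  below the current position, and that everything from there on is untouched. Both are what the next
  cell needs.\<close>

lemma wp_main_loop:
  assumes ok: "codes_ok ds" and L: "L = length (enc_codes ds)"
    and inp: "seg (A aIN) 0 (enc_codes ds)"
    and regs: "r rRem = length ds" "r rOne = 1" "r rZ = 0" "r rI = 0" "r rP = 1" "r rQ = 2"
    and zero: "\<forall>x. A aEX x = 0 \<and> A aBL x = 0 \<and> A aHD x = 0"
  shows "wp L (CWhile rRem cell_prog) (\<lambda>t' r' A'. t' \<le> t + 41 * length (enc_codes ds) + 1 \<and>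
     r' rCnt = sel_count ds (length ds - 1) \<and> A' aOUT 1 = A aOUT 1 \<and>
     r' rQ = 2 + length (concat (map (result_cell ds) [0..<length ds])) \<and>
     seg (A' aOUT) 2 (concat (map (result_cell ds) [0..<length ds]))) t r A"
proof -
  let ?outs = "\<lambda>i. concat (map (result_cell ds) [0..<i])"
  let ?size = "\<lambda>ds. 40 * length (concat (map enc_cell ds)) + length ds"
  let ?I = "\<lambda>ys t' r' A'. \<exists>i. i + length ys = length ds \<and> ys = drop i ds \<and>
      r' rRem = length ys \<and> r' rI = i \<and> r' rP = cell_pos ds i \<and>
      (\<forall>j < i. finished_cell L (cell_pos ds i) A' j (cps (ds ! j)) (blocked ds j) (sel_count ds j)) \<and>
      (\<forall>x\<ge>cell_pos ds i. A' aEX x = 0 \<and> A' aBL x = 0 \<and> A' aHD x = 0) \<and>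
      r' rQ = 2 + length (?outs i) \<and> seg (A' aOUT) 2 (?outs i) \<and> A' aOUT 1 = A aOUT 1 \<and>
      (0 < i \<longrightarrow> r' rCnt = sel_count ds (i - 1)) \<and> t' + ?size ys \<le> t + ?size ds"
  show ?thesis
  proof (rule wp_While[where xs = ds and I = ?I], goal_cases)
    case 1
    show ?case using regs zero by (auto simp: cell_pos_def)
  next
    case (2 y ys t' r' A')
    then obtain i where i: "i + length (y # ys) = length ds" "y # ys = drop i ds"
      and r': "r' rRem = length (y # ys)" "r' rI = i" "r' rP = cell_pos ds i"
      and fin: "\<forall>j < i. finished_cell L (cell_pos ds i) A' j (cps (ds ! j)) (blocked ds j)
        (sel_count ds j)"
      and zero': "\<forall>x\<ge>cell_pos ds i. A' aEX x = 0 \<and> A' aBL x = 0 \<and> A' aHD x = 0"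
      and out: "r' rQ = 2 + length (?outs i)" "seg (A' aOUT) 2 (?outs i)" "A' aOUT 1 = A aOUT 1"
      and t': "t' + ?size (y # ys) \<le> t + ?size ds"
      by blast
    have frame: "r' rOne = 1" "r' rZ = 0" "A' aIN = A aIN"
      using 2(2) cell_prog_mods regs by (simp_all add: frame_def)
    have ids: "i < length ds" using i(1) by simp
    have y: "y = ds ! i" "ys = drop (Suc i) ds"
      using i(2) ids by (simp_all add: Cons_nth_drop_Suc[symmetric])
    have ds: "ds = take i ds @ ds ! i # drop (Suc i) ds" using ids by (rule id_take_nth_drop)
    let ?c = "cell_pos ds i"
    have "enc_codes ds = length ds # concat (map enc_cell (take i ds)) @ enc_cell (ds ! i) @
        concat (map enc_cell (drop (Suc i) ds))"
      unfolding enc_codes_def by (subst (2) ds) simp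
    then have seg: "seg (A aIN) ?c (enc_cell (ds ! i))"
      and pos: "cell_pos ds (Suc i) \<le> L"
      using inp L ids by (simp_all add: cell_pos_Suc) (simp_all add: cell_pos_def)
    have nt: "\<forall>(v, j, xs)\<in>set (cts (ds ! i)). j < i \<and> length xs = length (cps (ds ! j))"
      and wf: "wf_code (ds ! i)" "distinct (cvs (ds ! i))"
      using ok ids by (auto simp: codes_ok_def)
    then have ltd: "\<forall>(v, j, xs)\<in>set (cts (ds ! i)). j < i" by auto
    note eqs = cell_result_eqs[OF ltd]
    have last: "Suc i = length ds \<longleftrightarrow> length ys = 0"
      using i(1)[unfolded list.size] by arith
    have len: "4 + length (cvs (ds ! i)) + length (cps (ds ! i)) \<le> length (enc_cell (ds ! i))"
      by (simp add: enc_cell_def)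
    have iL: "i < L"
      using L ids length_codes_le[of ds] by simp
    have "wp L cell_prog (?I ys) (t' + 1) r' A'"
    proof (rule wp_mono[OF wp_cell_prog[where d = "ds ! i" and m = "length ys" and
            qs = "\<lambda>j. cps (ds ! j)" and F = "blocked ds" and n = "sel_count ds" and
            S = "sel ds i" and Y = "blocked ds i"]], goal_cases)
      case 10
      then show ?case using nt fin r' by auto
    next
      case 11
      then show ?case using eqs(1) last by simp
    next
      case (13 t2 r2 A2)
      have A2: "A2 aIN = A' aIN"
        using 13(2) cell_prog_mods by (simp add: frame_def)
      note post = 13(1)[unfolded r' eqs(2)[symmetric]]
      have below: "\<forall>y < ?c. A2 aBL y = A' aBL y" and CP: "A2 aCP = (A' aCP)(i := ?c)"
        and CN: "A2 aCN = (A' aCN)(i := sel_count ds i)"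
        and m2: "marked (A2 aBL) ?c = blocked ds i" using post by blast+
      have "finished_cell L (cell_pos ds (Suc i)) A2 j (cps (ds ! j)) (blocked ds j)
          (sel_count ds j)" if "j < Suc i" for j
      proof (cases "j = i")
        \<comment> \<open>The cell just processed becomes a finished one: its pins are smaller than
          the length of its code, so their marks lie below the next position.\<close>
        case True
        have "A aIN ?c = length (cvs (ds ! i))"
          "seg (A aIN) (?c + 4 + length (cvs (ds ! i))) (cps (ds ! i))"
          using seg by (simp_all add: enc_cell_def numeral_eq_Suc)
        moreover have "p < length (enc_cell (ds ! i))" if "p \<in> set (cps (ds ! i))" for p
          using wf(1) that len by (force simp: wf_code_def Let_def)
        moreover have "A2 aBL (?c + p) \<noteq> 0 \<longleftrightarrow> p \<in> blocked ds i" for p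
          using m2 by (auto simp: marked_def)
        ultimately show ?thesis using True iL pos len ids
          by (auto simp: finished_cell_def A2 frame CP CP[unfolded One_nat_def] CN cell_pos_Suc)
      next
        case False
        with that fin have "finished_cell L ?c A' j (cps (ds ! j)) (blocked ds j) (sel_count ds j)"
          by simp
        moreover have "finished_cell L ?c A2 j (cps (ds ! j)) (blocked ds j) (sel_count ds j) =
            finished_cell L ?c A' j (cps (ds ! j)) (blocked ds j) (sel_count ds j)"
          by (rule finished_cell_cong) (use False A2 CP CN below in auto)
        ultimately show ?thesis using finished_cell_mono ids by (simp add: cell_pos_Suc)
      qed
      moreover have "seg (A2 aOUT) 2 (?outs i) = seg (A' aOUT) 2 (?outs i)"
        by (rule seg_cong) (use post out(1) in simp)
      moreover have "A2 aOUT 1 = A' aOUT 1" using post out(1) by simp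
      moreover have "t2 + ?size ys \<le> t + ?size ds" using post t' y by simp
      ultimately show ?case using post out i y ids
        by (intro exI[of _ "Suc i"]) (simp add: cell_pos_Suc result_cell_def)
    qed (use seg pos wf r' frame iL zero' ids in \<open>simp_all add: cell_pos_Suc\<close>,
        simp_all add: cell_pos_def)
    then show ?case using r' by simp
  next
    case (3 t' r' A')
    have "0 < length ds" using ok by (simp add: codes_ok_def)
    \<comment> \<open>The tests of the outer loop cost one unit per cell, and a cell has at least
      one number in its code; this turns 40 into 41.\<close>
    moreover have "?size ds + 41 \<le> 41 * length (enc_codes ds)"
      using length_codes_le[of ds] by (simp add: enc_codes_def)
    ultimately show ?case using 3 by auto
  qed
qed

lemma map_upt_seg:
  assumes "seg f 2 xs"
  shows "map (f(0 := a)) [0..<2 + length xs] = a # f 1 # xs"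
proof -
  have "[0..<2 + length xs] = 0 # 1 # [2..<2 + length xs]"
    by (simp add: upt_conv_Cons numeral_2_eq_2 del: upt_Suc)
  moreover have "map (f(0 := a)) [2..<2 + length xs] = xs"
    using assms by (intro nth_equalityI) (auto simp: seg_def simp del: upt_Suc)
  moreover have "(f(0 := a)) 0 = a" "(f(0 := a)) 1 = f 1" by simp_all
  ultimately show ?thesis by (simp only: list.map)
qed

lemma computes_result:
  assumes "codes_ok ds"
  shows "\<exists>t \<le> 41 * length (enc_codes ds) + 30.
    computes (run_on_arrays main_prog rQ) (enc_codes ds) t
      (sel_count ds (length ds - 1) # length ds # concat (map (result_cell ds) [0..<length ds]))"
proof -
  let ?w = "enc_codes ds" and ?outs = "concat (map (result_cell ds) [0..<length ds])"
  let ?L = "length ?w"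
  define r where "r = (\<lambda>_. 0 :: nat)(rOne := 1, rRem := length ds, rP := 1, rQ := 2)"
  define A where "A = (start_arrays ?w)(aOUT := (start_arrays ?w aOUT)(1 := length ds))"
  define Q where "Q = (\<lambda>t r A. t \<le> 41 * ?L + 20 \<and>
     map (A aOUT) [0..<r rQ] = sel_count ds (length ds - 1) # length ds # ?outs)"
  have "wp ?L (CWhile rRem cell_prog) (wp ?L (St aOUT rZ rCnt) Q) T r A" if T: "T \<le> 10" for T
  proof (rule wp_mono[OF wp_main_loop[OF assms]], goal_cases)
    case (10 t' r' A')
    have rZ: "r' rZ = 0" using 10(2) cell_prog_mods by (simp add: frame_def r_def)
    have post: "t' \<le> T + 41 * ?L + 1" "r' rCnt = sel_count ds (length ds - 1)"
      "A' aOUT 1 = length ds" "r' rQ = 2 + length ?outs" "seg (A' aOUT) 2 ?outs"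
      using 10(1) by (simp_all add: A_def)
    have "map ((A' aOUT)(0 := sel_count ds (length ds - 1))) [0..<2 + length ?outs] =
        sel_count ds (length ds - 1) # length ds # ?outs"
      using map_upt_seg[OF post(5)] unfolding post(3) .
    then have "Q (t' + 2) r' (A'(aOUT := (A' aOUT)(0 := r' rCnt)))"
      using post(1) T unfolding Q_def post(2,4) by (simp only: fun_upd_same) simp
    then show ?case using rZ by (simp add: valid_index_def)
  qed (auto simp: r_def A_def seg_def start_arrays_def)
  then have "wp ?L main_prog Q 0 (\<lambda>_. 0) (start_arrays ?w)"
    by (simp add: main_prog_def valid_index_def enc_codes_def r_def A_def start_arrays_def)
  \<comment> \<open>The transfer to the machine expects an exact time, so the bound in
    \<open>Q\<close> is exchanged for the time of the actual run.\<close>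
  then obtain T r' A' where run: "hexec ?L main_prog (\<lambda>_. 0, start_arrays ?w) T (r', A')"
    and post: "Q (0 + T) r' A'"
    unfolding wp_def by blast
  have "wp ?L main_prog (\<lambda>t r A. t = T \<and> map (A 8) [0..<r rQ] =
      sel_count ds (length ds - 1) # length ds # ?outs) 0 (\<lambda>_. 0) (start_arrays ?w)"
    unfolding wp_def using run post
    by (intro exI[of _ T] exI[of _ r'] exI[of _ A']) (simp add: Q_def del: upt_Suc)
  from computes_run_on_arrays[OF this] post show ?thesis
    unfolding Q_def by (intro exI[of _ "T + 10"]) (simp del: upt_Suc)
qed

section \<open>From specifications to codes and back\<close>

text \<open>A vertex is skipped only when excluded or already blocked, which gives maximality.
  Symmetry of adjacency makes blocking later vertices suffice for independence.\<close>

lemma greedy_spec: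
  assumes "greedy G X vs Y0 = (S, Y)" "distinct vs"
    and sym: "\<And>u v. v \<in> set (G u) \<Longrightarrow> u \<in> set (G v)" and irrefl: "\<And>u. u \<notin> set (G u)"
  shows "distinct S \<and> set S \<subseteq> set vs - X \<and> Y = Y0 \<union> (\<Union>u\<in>set S. set (G u)) \<and>
    set vs - X - set S \<subseteq> Y \<and> set S \<inter> Y = {}"
  using assms(1,2)
proof (induction vs arbitrary: Y0 S)
  case (Cons u vs)
  show ?case
  proof (cases "u \<in> X \<union> Y0")
    case True
    with Cons.prems Cons.IH[of Y0 S] show ?thesis by auto
  next
    case False
    with Cons.prems obtain S' where S': "greedy G X vs (Y0 \<union> set (G u)) = (S', Y)" "S = u # S'"
      by (cases "greedy G X vs (Y0 \<union> set (G u))") auto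
    with Cons have IH: "distinct S'" "set S' \<subseteq> set vs - X"
      "Y = Y0 \<union> set (G u) \<union> (\<Union>w\<in>set S'. set (G w))" "set vs - X - set S' \<subseteq> Y"
      "set S' \<inter> Y = {}" by auto
    \<comment> \<open>If \<open>u\<close> were a neighbour of a later choice \<open>w\<close>, then
      \<open>w\<close> would be a neighbour of \<open>u\<close> and hence blocked.\<close>
    have "u \<notin> set (G w)" if "w \<in> set S'" for w
      using sym[of u w] IH(3,5) that by auto
    then have "u \<notin> Y" using False irrefl IH(3) by auto
    with IH S'(2) Cons.prems(2) False show ?thesis by auto
  qed
qed auto

text \<open>The greedy choice depends on the order in which the input lists the vertices, so the
  results are attached to a fixed listing rather than to the cell.\<close>

definition code_of :: "cell \<Rightarrow> code \<Rightarrow> bool" where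
  "code_of c d \<longleftrightarrow> distinct (cvs d) \<and> set (cvs d) = verts (graph c) \<and> cps d = pins c \<and>
     distinct (map fst (cts d)) \<and> map_of (cts d) = nonterm c \<and>
     distinct (map (\<lambda>(u, v). {u, v}) (ces d)) \<and>
     (\<lambda>(u, v). {u, v}) ` set (ces d) = edges (graph c)"

lemma cell_code_iff: "cell_code c w \<longleftrightarrow> (\<exists>d. code_of c d \<and> w = enc_cell d)"
proof
  assume "cell_code c w"
  then obtain vs ts es where *: "distinct vs" "set vs = verts (graph c)" "distinct (map fst ts)"
    "map_of ts = nonterm c" "distinct (map (\<lambda>(u, v). {u, v}) es)"
    "(\<lambda>(u, v). {u, v}) ` set es = edges (graph c)"
    "w = [length vs, length (pins c), length ts, length es] @ vs @ pins c @
         concat (map (\<lambda>(v, j, xs). [v, j, length xs] @ xs) ts) @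
         concat (map (\<lambda>(u, v). [u, v]) es)"
    unfolding cell_code_def by blast
  then have "code_of c \<lparr>cvs = vs, cps = pins c, cts = ts, ces = es\<rparr>"
    "w = enc_cell \<lparr>cvs = vs, cps = pins c, cts = ts, ces = es\<rparr>"
    by (simp_all add: code_of_def enc_cell_def enc_nonterms_def enc_edges_def)
  then show "\<exists>d. code_of c d \<and> w = enc_cell d" by blast
next
  assume "\<exists>d. code_of c d \<and> w = enc_cell d"
  then obtain d where d: "code_of c d" "w = enc_cell d" by blast
  then have "w = [length (cvs d), length (pins c), length (cts d), length (ces d)] @ cvs d @
      pins c @ concat (map (\<lambda>(v, j, xs). [v, j, length xs] @ xs) (cts d)) @
         concat (map (\<lambda>(u, v). [u, v]) (ces d))"
    by (simp add: code_of_def enc_cell_def enc_nonterms_def enc_edges_def)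
  with d(1) show "cell_code c w" unfolding cell_code_def code_of_def by blast
qed

lemma spec_code_iff: "spec_code \<Gamma> w \<longleftrightarrow> (\<exists>ds. list_all2 code_of \<Gamma> ds \<and> w = enc_codes ds)"
proof -
  have "list_all2 cell_code \<Gamma> ws \<longleftrightarrow> (\<exists>ds. list_all2 code_of \<Gamma> ds \<and> ws = map enc_cell ds)" for ws
  proof (induction \<Gamma> arbitrary: ws)
    case (Cons c \<Gamma>)
    show ?case
    proof
      assume "list_all2 cell_code (c # \<Gamma>) ws"
      then obtain w ws' where "ws = w # ws'" "cell_code c w" "list_all2 cell_code \<Gamma> ws'"
        by (auto simp: list_all2_Cons1)
      then obtain d ds where "code_of c d" "list_all2 code_of \<Gamma> ds" "ws = map enc_cell (d # ds)"
        unfolding Cons.IH cell_code_iff by auto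
      then show "\<exists>ds. list_all2 code_of (c # \<Gamma>) ds \<and> ws = map enc_cell ds"
        by (intro exI[of _ "d # ds"]) simp
    next
      assume "\<exists>ds. list_all2 code_of (c # \<Gamma>) ds \<and> ws = map enc_cell ds"
      then obtain d ds where "code_of c d" "list_all2 code_of \<Gamma> ds" "ws = map enc_cell (d # ds)"
        by (auto simp: list_all2_Cons1)
      moreover from this have "list_all2 cell_code \<Gamma> (map enc_cell ds)" using Cons.IH by blast
      ultimately show "list_all2 cell_code (c # \<Gamma>) ws" by (auto simp: cell_code_iff)
    qed
  qed simp
  moreover have "length \<Gamma> = length ds" if "list_all2 code_of \<Gamma> ds" for ds
    using that by (rule list_all2_lengthD)
  ultimately show ?thesis unfolding spec_code_def enc_codes_def by fastforce
qed

text \<open>A cell without selected vertices cannot be empty or be omitted: graphs need a vertex,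
  and types are positions. No kept nonterminal refers to its replacement.\<close>

definition result_spec_cell :: "code list \<Rightarrow> nat \<Rightarrow> cell" where
  "result_spec_cell ds i = (let ts = kept (sel_count ds) (cts (ds ! i)) in
     if sel_count ds i = 0 then \<lparr>graph = ({0}, {}), pins = [], nonterm = Map.empty\<rparr>
     else \<lparr>graph = (fst ` set ts \<union> set (sel ds i), {}), pins = [], nonterm = map_of ts\<rparr>)"

definition result_spec :: "code list \<Rightarrow> cell list" where
  "result_spec ds = map (result_spec_cell ds) [0..<length ds]"

lemma in_Union_Collect:
  "x \<in> \<Union>{f a b c | a b c. P a b c} \<longleftrightarrow> (\<exists>a b c. P a b c \<and> x \<in> f a b c)"
  by blast

lemma map_fst_kept: "map fst (kept n ts) = map fst (filter (\<lambda>(v, j, xs). n j \<noteq> 0) ts)"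
  by (induction ts) auto

lemma in_kept_iff: "(v, j, ys) \<in> set (kept n ts) \<longleftrightarrow> ys = [] \<and> n j \<noteq> 0 \<and> (\<exists>xs. (v, j, xs) \<in> set ts)"
  by (induction ts) (auto split: if_splits)

section \<open>The computed selection is maximal and correctly counted\<close>

context
  fixes \<Gamma> ds
  assumes hier: "hier_spec \<Gamma>" and simple: "simple_spec \<Gamma>" and num: "numbered \<Gamma>"
    and codes: "list_all2 code_of \<Gamma> ds"
begin

lemma length_codes: "length ds = length \<Gamma>"
  using list_all2_lengthD[OF codes] by simp

lemma codeD:
  assumes "i < length \<Gamma>"
  shows "distinct (cvs (ds ! i))" "set (cvs (ds ! i)) = verts (graph (\<Gamma> ! i))"
    "cps (ds ! i) = pins (\<Gamma> ! i)" "distinct (map fst (cts (ds ! i)))"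
    "map_of (cts (ds ! i)) = nonterm (\<Gamma> ! i)"
    "distinct (map (\<lambda>(u, v). {u, v}) (ces (ds ! i)))"
    "(\<lambda>(u, v). {u, v}) ` set (ces (ds ! i)) = edges (graph (\<Gamma> ! i))"
  using list_all2_nthD[OF codes assms] by (simp_all add: code_of_def)

lemma in_cts_iff:
  assumes "i < length \<Gamma>"
  shows "(v, j, xs) \<in> set (cts (ds ! i)) \<longleftrightarrow> nonterm (\<Gamma> ! i) v = Some (j, xs)"
  using codeD(4,5)[OF assms] by (metis map_of_eq_Some_iff)

lemma fst_cts: "i < length \<Gamma> \<Longrightarrow> fst ` set (cts (ds ! i)) = dom (nonterm (\<Gamma> ! i))"
  using codeD(5)[of i] by (metis dom_map_of_conv_image_fst)

lemma in_ces_iff: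
  assumes "i < length \<Gamma>"
  shows "(u, v) \<in> set (ces (ds ! i)) \<or> (v, u) \<in> set (ces (ds ! i)) \<longleftrightarrow>
    {u, v} \<in> edges (graph (\<Gamma> ! i))"
  unfolding codeD(7)[OF assms, symmetric] by (auto simp: image_iff doubleton_eq_iff)

text \<open>The convention on vertex names enters here: it makes each vertex an offset inside the
  code of its cell.\<close>

lemma verts_numbered:
  assumes "i < length \<Gamma>"
  shows "verts (graph (\<Gamma> ! i)) = {..<length (cvs (ds ! i))}"
proof -
  have "verts (graph (\<Gamma> ! i)) = {..<card (verts (graph (\<Gamma> ! i)))}"
    using num assms unfolding numbered_def by (metis nth_mem)
  moreover have "card (verts (graph (\<Gamma> ! i))) = length (cvs (ds ! i))"
    using codeD(1,2)[OF assms] by (metis distinct_card)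
  ultimately show ?thesis by simp
qed

lemma codes_ok: "codes_ok ds"
proof -
  have "wf_code (ds ! i) \<and> distinct (cvs (ds ! i)) \<and>
     (\<forall>(v, j, xs)\<in>set (cts (ds ! i)). j < i \<and> length xs = length (cps (ds ! j)))"
    if i: "i < length \<Gamma>" for i
  proof (intro conjI)
    show "wf_code (ds ! i)"
      unfolding wf_code_def Let_def lessThan_iff[symmetric] verts_numbered[OF i, symmetric]
    proof (intro conjI ballI)
      show "set (cvs (ds ! i)) \<subseteq> verts (graph (\<Gamma> ! i))" using codeD(2)[OF i] by simp
      show "set (cps (ds ! i)) \<subseteq> verts (graph (\<Gamma> ! i))"
        using cell_okD(3)[OF hier i] codeD(3)[OF i] by simp
    next
      fix y assume y: "y \<in> set (cts (ds ! i))"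
      obtain v j xs where "y = (v, j, xs)" by (cases y)
      with y in_cts_iff[OF i] have nt: "nonterm (\<Gamma> ! i) v = Some (j, xs)" by simp
      then have "v \<in> verts (graph (\<Gamma> ! i))" using cell_okD(4)[OF hier i] by blast
      with nontermD(4)[OF hier i nt] show "case y of (v, j, xs) \<Rightarrow>
          v \<in> verts (graph (\<Gamma> ! i)) \<and> set xs \<subseteq> verts (graph (\<Gamma> ! i))"
        using \<open>y = (v, j, xs)\<close> by auto
    next
      fix e assume e: "e \<in> set (ces (ds ! i))"
      obtain u v where "e = (u, v)" by (cases e)
      with e in_ces_iff[OF i] have "{u, v} \<in> edges (graph (\<Gamma> ! i))" by blast
      from edge_vertsD[OF cell_okD(1)[OF hier i] this] \<open>e = (u, v)\<close>
      show "case e of (u, v) \<Rightarrow> u \<in> verts (graph (\<Gamma> ! i)) \<and> v \<in> verts (graph (\<Gamma> ! i))" by simp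
    qed
    show "distinct (cvs (ds ! i))" by (rule codeD(1)[OF i])
    show "\<forall>(v, j, xs)\<in>set (cts (ds ! i)). j < i \<and> length xs = length (cps (ds ! j))"
    proof clarify
      fix v j xs assume "(v, j, xs) \<in> set (cts (ds ! i))"
      then have nt: "nonterm (\<Gamma> ! i) v = Some (j, xs)" using in_cts_iff[OF i] by simp
      from nontermD(1,3)[OF hier i nt] codeD(3)[of j] i
      show "j < i \<and> length xs = length (cps (ds ! j))" by simp
    qed
  qed
  moreover have "ds \<noteq> []" using hier length_codes unfolding hier_spec_def by auto
  ultimately show ?thesis by (simp add: codes_ok_def length_codes)
qed

lemma cell_result_greedy:
  assumes "i < length \<Gamma>"
  shows "greedy (adjacency (ces (ds ! i)) (\<lambda>_. [])) (excluded \<Gamma> i) (cvs (ds ! i))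
      (blocked_through \<Gamma> (blocked ds) i) = (sel ds i, blocked ds i)"
    and "sel_count ds i = count_nonterms (sel_count ds) (cts (ds ! i)) + length (sel ds i)"
proof -
  have lt: "\<forall>(v, j, xs)\<in>set (cts (ds ! i)). j < i"
    using codes_ok assms by (auto simp: codes_ok_def length_codes)
  \<comment> \<open>Pairs of neighbour and pin produced by \<open>zip\<close> correspond to common
    positions, as both lists have the same length.\<close>
  have "blocked_by (\<lambda>j. cps (ds ! j)) (blocked ds) (cts (ds ! i)) =
      blocked_through \<Gamma> (blocked ds) i"
  proof (rule set_eqI)
    fix x
    have pins: "cps (ds ! j) = pins (\<Gamma> ! j)" "length xs = length (pins (\<Gamma> ! j))"
      if "nonterm (\<Gamma> ! i) v = Some (j, xs)" for v j xs
      using nontermD(1,3)[OF hier assms that] codeD(3)[of j] assms by auto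
    have "x \<in> blocked_by (\<lambda>j. cps (ds ! j)) (blocked ds) (cts (ds ! i)) \<longleftrightarrow>
        (\<exists>v j xs. nonterm (\<Gamma> ! i) v = Some (j, xs) \<and>
          (\<exists>p. (x, p) \<in> set (zip xs (cps (ds ! j))) \<and> p \<in> blocked ds j))"
      by (simp add: blocked_by_def Bex_def split_paired_Ex in_cts_iff[OF assms])
    also have "\<dots> \<longleftrightarrow> (\<exists>v j xs. nonterm (\<Gamma> ! i) v = Some (j, xs) \<and>
          (\<exists>l. l < length xs \<and> pins (\<Gamma> ! j) ! l \<in> blocked ds j \<and> x = xs ! l))"
    proof -
      have "(\<exists>p. (x, p) \<in> set (zip xs (cps (ds ! j))) \<and> p \<in> blocked ds j) \<longleftrightarrow>
          (\<exists>l. l < length xs \<and> pins (\<Gamma> ! j) ! l \<in> blocked ds j \<and> x = xs ! l)"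
        if "nonterm (\<Gamma> ! i) v = Some (j, xs)" for v j xs
        using pins[OF that] by (auto simp: set_zip)
      then show ?thesis by (rule_tac ex_cong1, rule_tac ex_cong1, rule_tac ex_cong1, rule_tac conj_cong[OF refl])
    qed
    also have "\<dots> \<longleftrightarrow> x \<in> blocked_through \<Gamma> (blocked ds) i"
      unfolding blocked_through_def by auto
    finally show "x \<in> blocked_by (\<lambda>j. cps (ds ! j)) (blocked ds) (cts (ds ! i)) \<longleftrightarrow>
        x \<in> blocked_through \<Gamma> (blocked ds) i" .
  qed
  with cell_result_eqs(1)[OF lt] show "greedy (adjacency (ces (ds ! i)) (\<lambda>_. [])) (excluded \<Gamma> i)
      (cvs (ds ! i)) (blocked_through \<Gamma> (blocked ds) i) = (sel ds i, blocked ds i)"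
    by (cases "Suc i = length \<Gamma>")
      (simp_all add: excluded_def length_codes fst_cts[OF assms] codeD(3)[OF assms])
  show "sel_count ds i = count_nonterms (sel_count ds) (cts (ds ! i)) + length (sel ds i)"
    by (rule cell_result_eqs(2)[OF lt])
qed

lemma sel_spec:
  assumes "i < length \<Gamma>"
  shows "distinct (sel ds i)" "set (sel ds i) \<subseteq> verts (graph (\<Gamma> ! i)) - excluded \<Gamma> i"
    "blocked ds i = blocked_through \<Gamma> (blocked ds) i \<union>
      {x. \<exists>u\<in>set (sel ds i). {u, x} \<in> edges (graph (\<Gamma> ! i))}"
    "verts (graph (\<Gamma> ! i)) - excluded \<Gamma> i - set (sel ds i) \<subseteq> blocked ds i"
    "set (sel ds i) \<inter> blocked ds i = {}"
proof -
  have adj: "set (adjacency (ces (ds ! i)) (\<lambda>_. []) u) = {x. {u, x} \<in> edges (graph (\<Gamma> ! i))}" for u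
    by (simp add: set_adjacency in_ces_iff[OF assms])
  have "distinct (sel ds i) \<and> set (sel ds i) \<subseteq> set (cvs (ds ! i)) - excluded \<Gamma> i \<and>
    blocked ds i = blocked_through \<Gamma> (blocked ds) i \<union>
      (\<Union>u\<in>set (sel ds i). set (adjacency (ces (ds ! i)) (\<lambda>_. []) u)) \<and>
    set (cvs (ds ! i)) - excluded \<Gamma> i - set (sel ds i) \<subseteq> blocked ds i \<and>
    set (sel ds i) \<inter> blocked ds i = {}"
  proof (rule greedy_spec[OF cell_result_greedy(1)[OF assms] codeD(1)[OF assms]])
    show "u \<in> set (adjacency (ces (ds ! i)) (\<lambda>_. []) v)"
      if "v \<in> set (adjacency (ces (ds ! i)) (\<lambda>_. []) u)" for u v
      using that by (simp add: adj insert_commute)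
    show "u \<notin> set (adjacency (ces (ds ! i)) (\<lambda>_. []) u)" for u
      using edge_vertsD(3)[OF cell_okD(1)[OF hier assms], of u u] by (auto simp: adj)
  qed
  note * = this[unfolded adj codeD(2)[OF assms]]
  show "distinct (sel ds i)" by (rule conjunct1[OF *])
  note * = conjunct2[OF *]
  show "set (sel ds i) \<subseteq> verts (graph (\<Gamma> ! i)) - excluded \<Gamma> i" by (rule conjunct1[OF *])
  note * = conjunct2[OF *]
  show "verts (graph (\<Gamma> ! i)) - excluded \<Gamma> i - set (sel ds i) \<subseteq> blocked ds i"
    by (rule conjunct1[OF conjunct2[OF *]])
  show "set (sel ds i) \<inter> blocked ds i = {}" by (rule conjunct2[OF conjunct2[OF *]])
  have "(\<Union>u\<in>set (sel ds i). {x. {u, x} \<in> edges (graph (\<Gamma> ! i))}) =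
      {x. \<exists>u\<in>set (sel ds i). {u, x} \<in> edges (graph (\<Gamma> ! i))}" by auto
  with * show "blocked ds i = blocked_through \<Gamma> (blocked ds) i \<union>
      {x. \<exists>u\<in>set (sel ds i). {u, x} \<in> edges (graph (\<Gamma> ! i))}" by simp
qed

lemma maximal_selection: "maximal_selection \<Gamma> (\<lambda>i. set (sel ds i)) (blocked ds)"
  unfolding maximal_selection_def using sel_spec by blast

abbreviation chosen :: "nat \<Rightarrow> nat list set" where
  "chosen \<equiv> selected \<Gamma> (\<lambda>i. set (sel ds i))"

lemma count_nonterms_eq_sum:
  assumes "i < length \<Gamma>"
  shows "count_nonterms n (cts (ds ! i)) =
    (\<Sum>v\<in>dom (nonterm (\<Gamma> ! i)). n (fst (the (nonterm (\<Gamma> ! i) v))))"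
proof -
  have dist: "distinct (cts (ds ! i))" "inj_on fst (set (cts (ds ! i)))"
    using codeD(4)[OF assms] by (simp_all add: distinct_map)
  have "count_nonterms n (cts (ds ! i)) = (\<Sum>y\<in>set (cts (ds ! i)). case y of (v, j, xs) \<Rightarrow> n j)"
    unfolding count_nonterms_def using dist(1) by (rule sum_list_distinct_conv_sum_set)
  also have "\<dots> = (\<Sum>y\<in>set (cts (ds ! i)). n (fst (the (nonterm (\<Gamma> ! i) (fst y)))))"
    by (rule sum.cong) (auto simp: in_cts_iff[OF assms])
  also have "\<dots> = (\<Sum>v\<in>fst ` set (cts (ds ! i)). n (fst (the (nonterm (\<Gamma> ! i) v))))"
    using dist(2) by (simp add: sum.reindex)
  finally show ?thesis by (simp add: fst_cts[OF assms])
qed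

text \<open>Counts and cardinalities satisfy the same recursion over the nonterminals.\<close>

lemma sel_count_eq_card: "i < length \<Gamma> \<Longrightarrow> sel_count ds i = card (chosen i)"
proof (induction i rule: less_induct)
  case (less i)
  have "sel_count ds (fst (the (nonterm (\<Gamma> ! i) v))) = card (chosen (fst (the (nonterm (\<Gamma> ! i) v))))"
    if "v \<in> dom (nonterm (\<Gamma> ! i))" for v
  proof -
    from that obtain a where a: "nonterm (\<Gamma> ! i) v = Some a" by blast
    obtain j xs where "a = (j, xs)" by (cases a)
    with a nontermD(1)[OF hier less.prems, of v j xs] less show ?thesis by simp
  qed
  then show ?case
    unfolding cell_result_greedy(2)[OF less.prems] count_nonterms_eq_sum[OF less.prems]
      card_selected[OF hier simple maximal_selection less.prems]
    using sel_spec(1)[OF less.prems] by (simp add: distinct_card)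
qed

lemma finite_chosen: "i < length \<Gamma> \<Longrightarrow> finite (chosen i)"
  using selected_subset(1)[OF hier simple maximal_selection] finite_verts_expansion[OF hier]
    finite_subset by blast

section \<open>Expansion, validity and size of the output\<close>

lemma result_spec_nth: "i < length \<Gamma> \<Longrightarrow> result_spec ds ! i = result_spec_cell ds i"
  by (simp add: result_spec_def length_codes)

lemma pins_result_spec: "i < length \<Gamma> \<Longrightarrow> pins (result_spec ds ! i) = []"
  by (simp add: result_spec_nth result_spec_cell_def Let_def)

lemma nonterm_result_spec:
  assumes "i < length \<Gamma>" "sel_count ds i \<noteq> 0"
  shows "nonterm (result_spec ds ! i) v = Some (j, ys) \<longleftrightarrow>
    ys = [] \<and> sel_count ds j \<noteq> 0 \<and> (\<exists>xs. nonterm (\<Gamma> ! i) v = Some (j, xs))"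
proof -
  have "distinct (map fst (kept (sel_count ds) (cts (ds ! i))))"
    unfolding map_fst_kept by (rule distinct_map_filter[OF codeD(4)[OF assms(1)]])
  then have "map_of (kept (sel_count ds) (cts (ds ! i))) v = Some (j, ys) \<longleftrightarrow>
      (v, j, ys) \<in> set (kept (sel_count ds) (cts (ds ! i)))"
    by (rule map_of_eq_Some_iff)
  then show ?thesis using assms(2)
    by (simp add: result_spec_nth[OF assms(1)] result_spec_cell_def Let_def in_kept_iff
        in_cts_iff[OF assms(1)])
qed

lemma kept_subset:
  assumes "i < length \<Gamma>"
  shows "fst ` set (kept (sel_count ds) (cts (ds ! i))) \<subseteq> dom (nonterm (\<Gamma> ! i))"
proof -
  have "set (map fst (kept n ts)) \<subseteq> set (map fst ts)" for n ts
    unfolding map_fst_kept by auto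
  then show ?thesis unfolding fst_cts[OF assms, symmetric] by simp
qed

lemma sel_disjoint:
  assumes "i < length \<Gamma>"
  shows "set (sel ds i) \<inter> dom (nonterm (\<Gamma> ! i)) = {}"
  using sel_spec(2)[OF assms] by (auto simp: excluded_def)

text \<open>Without pins, gluing prepends the nonterminal, just as in the definition of
  \<open>selected\<close>. A nonzero count is required because a dummy cell does not expand to the
  empty set.\<close>

lemma expansion_at_result_spec:
  assumes "i < length \<Gamma>" "sel_count ds i \<noteq> 0"
  shows "expansion_at (result_spec ds) i = (chosen i, {})"
  using assms
proof (induction i rule: less_induct)
  case (less i)
  let ?ts = "kept (sel_count ds) (cts (ds ! i))" and ?c = "result_spec ds ! i"
  let ?E = "\<lambda>j. if j < i then expansion_at (result_spec ds) j else ({}, {})"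
  have glue_Nil: "glue [] xs v = (#) v" for xs v by (simp add: glue_def fun_eq_iff)
  have inner: "pins (result_spec ds ! j) = [] \<and> ?E j = (chosen j, {})"
    if "nonterm ?c v = Some (j, ys)" for v j ys
  proof -
    from that obtain xs where *: "nonterm (\<Gamma> ! i) v = Some (j, xs)" "sel_count ds j \<noteq> 0"
      unfolding nonterm_result_spec[OF less.prems] by blast
    have "j < i" by (rule nontermD(1)[OF hier less.prems(1) *(1)])
    with less *(2) show ?thesis by (simp add: pins_result_spec)
  qed
  have c: "verts (graph ?c) = fst ` set ?ts \<union> set (sel ds i)" "edges (graph ?c) = {}"
    "dom (nonterm ?c) = fst ` set ?ts"
    using less.prems by (simp_all add: result_spec_nth result_spec_cell_def Let_def dom_map_of_conv_image_fst)
  have here: "verts (graph ?c) - dom (nonterm ?c) = set (sel ds i)"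
    unfolding c using sel_disjoint[OF less.prems(1)] kept_subset[OF less.prems(1)] by blast
  have verts: "verts (expansion_at (result_spec ds) i) = (\<lambda>u. [u]) ` set (sel ds i) \<union>
      \<Union>{glue (pins (result_spec ds ! j)) ys v ` verts (?E j) | v j ys. nonterm ?c v = Some (j, ys)}"
    by (subst expansion_at.simps) (simp add: expand_cell_def here)
  have "x \<in> verts (expansion_at (result_spec ds) i) \<longleftrightarrow> x \<in> chosen i" for x
  proof -
    have "x \<in> verts (expansion_at (result_spec ds) i) \<longleftrightarrow> x \<in> (\<lambda>u. [u]) ` set (sel ds i) \<or>
        (\<exists>v j ys. nonterm ?c v = Some (j, ys) \<and>
          x \<in> glue (pins (result_spec ds ! j)) ys v ` verts (?E j))"
      unfolding verts Un_iff in_Union_Collect ..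
    also have "\<dots> \<longleftrightarrow> x \<in> (\<lambda>u. [u]) ` set (sel ds i) \<or>
        (\<exists>v j ys. nonterm ?c v = Some (j, ys) \<and> x \<in> (#) v ` chosen j)"
      by (intro arg_cong2[where f = "(\<or>)"] refl ex_cong1 conj_cong) (simp add: inner glue_Nil)
    also have "\<dots> \<longleftrightarrow> x \<in> (\<lambda>u. [u]) ` set (sel ds i) \<or>
        (\<exists>v j xs. nonterm (\<Gamma> ! i) v = Some (j, xs) \<and> x \<in> (#) v ` chosen j)"
    proof -
      \<comment> \<open>A dropped nonterminal contributes no chosen vertex, so dropping it does not
        change the union.\<close>
      have "sel_count ds j \<noteq> 0" if "nonterm (\<Gamma> ! i) v = Some (j, xs)" "x \<in> (#) v ` chosen j"
        for v j xs
      proof -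
        have j: "j < length \<Gamma>" using nontermD(1)[OF hier less.prems(1) that(1)] less.prems by simp
        with that(2) show ?thesis using sel_count_eq_card[OF j] finite_chosen[OF j] by auto
      qed
      then show ?thesis unfolding nonterm_result_spec[OF less.prems] by blast
    qed
    also have "\<dots> \<longleftrightarrow> x \<in> chosen i"
      unfolding selected_iff[OF hier simple maximal_selection less.prems(1)]
      by (simp only: image_iff Bex_def) blast
    finally show ?thesis .
  qed
  then have "verts (expansion_at (result_spec ds) i) = chosen i" by (rule set_eqI)
  moreover have "edges (expansion_at (result_spec ds) i) = {}"
  proof -
    have eq: "edges (expansion_at (result_spec ds) i) =
        \<Union>{image (glue (pins (result_spec ds ! j)) ys v) ` edges (?E j) | v j ys.
          nonterm ?c v = Some (j, ys)}"
      by (subst expansion_at.simps) (simp add: expand_cell_def c(2))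
    have "e \<notin> image (glue (pins (result_spec ds ! j)) ys v) ` edges (?E j)"
      if "nonterm ?c v = Some (j, ys)" for e v j ys
      using inner[OF that] by (simp split del: if_split)
    then have "e \<notin> edges (expansion_at (result_spec ds) i)" for e
      unfolding eq in_Union_Collect by metis
    then show ?thesis by (simp add: all_not_in_conv[symmetric])
  qed
  ultimately show ?case by (simp add: prod_eq_iff)
qed

text \<open>The top cell is the one cell that no nonterminal refers to, so being a dummy there would
  put a wrong vertex into the result.\<close>

lemma last_count_nonzero: "sel_count ds (length \<Gamma> - 1) \<noteq> 0"
proof -
  have i: "length \<Gamma> - 1 < length \<Gamma>" using hier by (simp add: hier_spec_def)
  show ?thesis using selected_nonempty[OF hier simple maximal_selection]
      sel_count_eq_card[OF i] finite_chosen[OF i] by simp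
qed

lemma expansion_result_spec: "expansion (result_spec ds) = (chosen (length \<Gamma> - 1), {})"
proof -
  have "length \<Gamma> - 1 < length \<Gamma>" using hier by (simp add: hier_spec_def)
  from expansion_at_result_spec[OF this last_count_nonzero] show ?thesis
    by (simp add: expansion_def result_spec_def length_codes)
qed

lemma verts_result_spec:
  assumes "i < length \<Gamma>"
  shows "card (verts (graph (result_spec ds ! i))) \<le> card (verts (graph (\<Gamma> ! i)))"
    "verts (graph (result_spec ds ! i)) \<noteq> {}" "finite (verts (graph (result_spec ds ! i)))"
    "edges (graph (result_spec ds ! i)) = {}"
proof -
  have fin: "finite (verts (graph (\<Gamma> ! i)))" "verts (graph (\<Gamma> ! i)) \<noteq> {}"
    using cell_okD(1)[OF hier assms] by (simp_all add: simple_graph_def)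
  let ?V = "fst ` set (kept (sel_count ds) (cts (ds ! i))) \<union> set (sel ds i)"
  have V: "?V \<subseteq> verts (graph (\<Gamma> ! i))"
    using kept_subset[OF assms] cell_okD(4)[OF hier assms] sel_spec(2)[OF assms] by blast
  \<comment> \<open>A positive count comes from a vertex selected in the cell or from a nonterminal
    with a positive count, and the latter is kept.\<close>
  have ne: "?V \<noteq> {}" if "sel_count ds i \<noteq> 0"
  proof
    assume "?V = {}"
    then have "kept (sel_count ds) (cts (ds ! i)) = []" "sel ds i = []" by auto
    moreover have "count_nonterms n ts = 0" if "kept n ts = []" for n ts
      using that by (induction ts) (auto split: if_splits)
    ultimately show False using that cell_result_greedy(2)[OF assms] by simp
  qed
  \<comment> \<open>The single vertex of a dummy is matched by a vertex of the original cell, so the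
    output does not exceed \<open>N\<close>.\<close>
  have "1 \<le> card (verts (graph (\<Gamma> ! i)))" using fin by (simp add: Suc_leI card_gt_0_iff)
  with V ne card_mono[OF fin(1) V]
  show "card (verts (graph (result_spec ds ! i))) \<le> card (verts (graph (\<Gamma> ! i)))"
    "verts (graph (result_spec ds ! i)) \<noteq> {}" "finite (verts (graph (result_spec ds ! i)))"
    "edges (graph (result_spec ds ! i)) = {}"
    by (simp_all add: result_spec_nth[OF assms] result_spec_cell_def Let_def)
qed

text \<open>Without edges a nonterminal has no neighbours, and its type has no pins, so the empty
  list is the correct correspondence.\<close>

lemma hier_result_spec: "hier_spec (result_spec ds)"
proof -
  have "cell_ok (result_spec ds) i (result_spec ds ! i)" if i: "i < length \<Gamma>" for i
  proof (cases "sel_count ds i = 0")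
    case True
    then show ?thesis
      by (simp add: result_spec_nth[OF i] result_spec_cell_def Let_def cell_ok_def simple_graph_def)
  next
    case False
    have "simple_graph (graph (result_spec ds ! i))"
      using verts_result_spec[OF i] by (simp add: simple_graph_def)
    moreover have "dom (nonterm (result_spec ds ! i)) \<subseteq> verts (graph (result_spec ds ! i))"
      using False by (simp add: result_spec_nth[OF i] result_spec_cell_def Let_def
          dom_map_of_conv_image_fst)
    moreover have "j < i \<and> ys = [] \<and> distinct ys \<and> pins (result_spec ds ! j) = []"
      if "nonterm (result_spec ds ! i) v = Some (j, ys)" for v j ys
    proof -
      from that obtain xs where "ys = []" and nt: "nonterm (\<Gamma> ! i) v = Some (j, xs)"
        unfolding nonterm_result_spec[OF i False] by blast
      with nontermD(1)[OF hier i nt] i show ?thesis by (simp add: pins_result_spec)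
    qed
    moreover have "nbrs (graph (result_spec ds ! i)) v = {}" for v
      using verts_result_spec(4)[OF i] by (simp add: nbrs_def)
    ultimately show ?thesis
      unfolding cell_ok_def pins_result_spec[OF i] by simp
  qed
  moreover have "\<Gamma> \<noteq> []" using hier by (simp add: hier_spec_def)
  ultimately show ?thesis by (simp add: hier_spec_def result_spec_def length_codes)
qed

lemma size_result_spec: "vsize (result_spec ds) + esize (result_spec ds) \<le> vsize \<Gamma>"
proof -
  have len: "length (result_spec ds) = length \<Gamma>" by (simp add: result_spec_def length_codes)
  have "esize (result_spec ds) = 0"
    using verts_result_spec(4) by (simp add: esize_def len sum_list_sum_nth)
  moreover have "vsize (result_spec ds) \<le> vsize \<Gamma>"
    unfolding vsize_def by (simp add: sum_list_sum_nth len)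
      (rule sum_mono, use verts_result_spec(1) in simp)
  ultimately show ?thesis by simp
qed

lemma code_result_spec: "spec_code (result_spec ds)
    (length ds # concat (map (result_cell ds) [0..<length ds]))"
proof -
  have "cell_code (result_spec_cell ds i) (result_cell ds i)" if i: "i < length \<Gamma>" for i
  proof (cases "sel_count ds i = 0")
    case True
    then show ?thesis unfolding cell_code_def
      by (intro exI[of _ "[0]"] exI[of _ "[]"])
        (simp add: result_spec_cell_def result_cell_def out_cell_def Let_def)
  next
    case False
    let ?ts = "kept (sel_count ds) (cts (ds ! i))"
    have "distinct (map fst ?ts)"
      unfolding map_fst_kept by (rule distinct_map_filter[OF codeD(4)[OF i]])
    \<comment> \<open>The format demands a vertex list without repetition; selected vertices are
      terminals and so differ from the kept nonterminals.\<close>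
    moreover have "fst ` set ?ts \<inter> set (sel ds i) = {}"
      using kept_subset[OF i] sel_disjoint[OF i] by blast
    ultimately show ?thesis using False sel_spec(1)[OF i] unfolding cell_code_def
      by (intro exI[of _ "map fst ?ts @ sel ds i"] exI[of _ "?ts"] exI[of _ "[]"])
        (simp add: result_spec_cell_def result_cell_def out_cell_def Let_def enc_nonterms_def)
  qed
  then have "list_all2 cell_code (result_spec ds) (map (result_cell ds) [0..<length ds])"
    by (simp add: result_spec_def list_all2_conv_all_nth length_codes)
  then show ?thesis unfolding spec_code_def
    by (auto simp: result_spec_def)
qed

text \<open>Header, vertices, pins and the fixed parts of nonterminals give at most
  \<open>4 + 1 + 1 + 3 = 9\<close> numbers per vertex; edges give two numbers each and at most one
  more inside a neighbour list.\<close>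

lemma length_enc_cell:
  assumes i: "i < length \<Gamma>"
  shows "length (enc_cell (ds ! i)) \<le>
    9 * card (verts (graph (\<Gamma> ! i))) + 3 * card (edges (graph (\<Gamma> ! i)))"
proof -
  let ?c = "\<Gamma> ! i" and ?d = "ds ! i"
  let ?n = "card (verts (graph ?c))" and ?m = "card (edges (graph ?c))"
  have fin: "finite (verts (graph ?c))" "verts (graph ?c) \<noteq> {}"
    using cell_okD(1)[OF hier i] by (simp_all add: simple_graph_def)
  then have n: "1 \<le> ?n" by (simp add: Suc_leI card_gt_0_iff)
  have vs: "length (cvs ?d) = ?n" using codeD(1,2)[OF i] by (metis distinct_card)
  have "card (set (pins ?c)) \<le> ?n" by (rule card_mono[OF fin(1) cell_okD(3)[OF hier i]])
  then have ps: "length (cps ?d) \<le> ?n"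
    using codeD(3)[OF i] cell_okD(2)[OF hier i] by (simp add: distinct_card)
  have "card (dom (nonterm ?c)) \<le> ?n" by (rule card_mono[OF fin(1) cell_okD(4)[OF hier i]])
  moreover have "card (dom (nonterm ?c)) = length (cts ?d)"
    using distinct_card[OF codeD(4)[OF i]] by (simp add: fst_cts[OF i])
  ultimately have ts: "length (cts ?d) \<le> ?n" by simp
  have es: "length (ces ?d) = ?m"
    using distinct_card[OF codeD(6)[OF i]] by (simp add: codeD(7)[OF i])
  have fin_e: "finite (edges (graph ?c))"
    unfolding codeD(7)[OF i, symmetric] by simp
  have "(\<Sum>(v, j, xs)\<leftarrow>cts ?d. length xs) = (\<Sum>(v, j, xs)\<in>set (cts ?d). length xs)"
    using codeD(4)[OF i] by (intro sum_list_distinct_conv_sum_set) (simp add: distinct_map)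
  also have "\<dots> = (\<Sum>y\<in>set (cts ?d). card (set (snd (snd y))))"
  proof (rule sum.cong)
    fix y assume y: "y \<in> set (cts ?d)"
    obtain v j xs where "y = (v, j, xs)" by (cases y)
    with y in_cts_iff[OF i] nontermD(2)[OF hier i, of v j xs]
    show "(case y of (v, j, xs) \<Rightarrow> length xs) = card (set (snd (snd y)))"
      by (simp add: distinct_card)
  qed simp
  also have "\<dots> = card (SIGMA y:set (cts ?d). set (snd (snd y)))"
    by (rule card_SigmaI[symmetric]) simp_all
  also have "\<dots> \<le> ?m"
  proof (rule card_inj_on_le[OF _ _ fin_e])
    \<comment> \<open>Each entry of a neighbour list is charged to the edge from the nonterminal to
      it. Exactly one end of that edge is a nonterminal, so the edge determines both.\<close>
    let ?f = "\<lambda>(y :: nat \<times> nat \<times> nat list, x :: nat). {fst y, x}"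
    have nt: "nonterm ?c (fst y) = Some (snd y) \<and> x \<in> nbrs (graph ?c) (fst y) \<and>
        x \<notin> dom (nonterm ?c)" if "y \<in> set (cts ?d)" "x \<in> set (snd (snd y))" for x y
    proof -
      obtain v j xs where y: "y = (v, j, xs)" by (cases y)
      with that in_cts_iff[OF i] have nt: "nonterm ?c v = Some (j, xs)" by simp
      then have "set xs = nbrs (graph ?c) v"
        using hier i unfolding hier_spec_def cell_ok_def by blast
      with nt nontermD(4)[OF hier i nt] that y show ?thesis by auto
    qed
    show "?f ` (SIGMA y:set (cts ?d). set (snd (snd y))) \<subseteq> edges (graph ?c)"
      using nt by (auto simp: nbrs_def)
    show "inj_on ?f (SIGMA y:set (cts ?d). set (snd (snd y)))"
    proof (rule inj_onI)
      fix a b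
      assume "a \<in> (SIGMA y:set (cts ?d). set (snd (snd y)))"
        "b \<in> (SIGMA y:set (cts ?d). set (snd (snd y)))" and eq: "?f a = ?f b"
      then obtain y x y' x' where ab: "a = (y, x)" "b = (y', x')"
        and *: "y \<in> set (cts ?d)" "x \<in> set (snd (snd y))"
          "y' \<in> set (cts ?d)" "x' \<in> set (snd (snd y'))"
        by (auto elim!: SigmaE)
      from nt[OF *(1,2)] nt[OF *(3,4)] have
        "nonterm ?c (fst y) = Some (snd y)" "x \<notin> dom (nonterm ?c)"
        "nonterm ?c (fst y') = Some (snd y')" "x' \<notin> dom (nonterm ?c)" by simp_all
      moreover from this eq have "fst y = fst y' \<and> x = x'"
        by (auto simp: ab doubleton_eq_iff)
      ultimately show "a = b" by (simp add: ab prod_eq_iff)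
    qed
  qed
  finally have xs: "(\<Sum>(v, j, xs)\<leftarrow>cts ?d. length xs) \<le> ?m" .
  have "length (enc_nonterms zs) = 3 * length zs + (\<Sum>(v, j, xs)\<leftarrow>zs. length xs)" for zs
    by (induction zs) auto
  moreover have "length (enc_edges zs) = 2 * length zs" for zs by (induction zs) auto
  ultimately show ?thesis using n vs ps ts es xs by (simp add: enc_cell_def)
qed

text \<open>The number in front of all cells is paid for by the existence of a vertex, which turns 9
  into 10.\<close>

lemma length_enc_codes: "length (enc_codes ds) \<le> 10 * (vsize \<Gamma> + esize \<Gamma>)"
proof -
  have "1 \<le> card (verts (graph (\<Gamma> ! 0)))" and ne: "0 < length \<Gamma>"
    using cell_okD(1)[OF hier, of 0] hier by (simp_all add: simple_graph_def hier_spec_def Suc_leI card_gt_0_iff)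
  moreover have "card (verts (graph (\<Gamma> ! 0))) \<le> vsize \<Gamma>"
    unfolding vsize_def using ne elem_le_sum_list[of 0 "map (\<lambda>c. card (verts (graph c))) \<Gamma>"] by simp
  ultimately have "1 \<le> vsize \<Gamma>" by simp
  moreover have "length (concat (map enc_cell ds)) \<le> 9 * vsize \<Gamma> + 3 * esize \<Gamma>"
  proof -
    have "length (concat (map enc_cell ds)) = (\<Sum>i<length \<Gamma>. length (enc_cell (ds ! i)))"
      by (simp add: length_concat sum_list_sum_nth length_codes atLeast0LessThan)
    also have "\<dots> \<le> (\<Sum>i<length \<Gamma>. 9 * card (verts (graph (\<Gamma> ! i))) + 3 * card (edges (graph (\<Gamma> ! i))))"
      using length_enc_cell by (intro sum_mono) simp
    also have "\<dots> = 9 * vsize \<Gamma> + 3 * esize \<Gamma>"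
      by (simp add: vsize_def esize_def sum_list_sum_nth atLeast0LessThan sum.distrib sum_distrib_left)
    finally show ?thesis .
  qed
  ultimately show ?thesis by (simp add: enc_codes_def)
qed

end

theorem theorem5p5:
  fixes B :: nat
  assumes "B \<ge> 1"
  shows "\<exists>(prog :: ram) (C :: nat) (D :: nat). \<forall>\<Gamma> w.
    hier_spec \<Gamma> \<longrightarrow> simple_spec \<Gamma> \<longrightarrow>
    (\<forall>v \<in> verts (expansion \<Gamma>). degree (expansion \<Gamma>) v \<le> B) \<longrightarrow>
    numbered \<Gamma> \<longrightarrow> spec_code \<Gamma> w \<longrightarrow>
    (\<exists>t I \<Delta> w'.
       computes prog w t (card I # w') \<and> spec_code \<Delta> w' \<and>
       t \<le> C * (vsize \<Gamma> + esize \<Gamma>) \<and>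
       independent_set (expansion \<Gamma>) I \<and>
       real (card I) \<ge> real (independence_number (expansion \<Gamma>)) / real B \<and>
       hier_spec \<Delta> \<and> expansion \<Delta> = (I, {}) \<and>
       vsize \<Delta> + esize \<Delta> \<le> D * vsize \<Gamma>)"
proof (rule exI[of _ "run_on_arrays main_prog rQ"], rule exI[of _ 710], rule exI[of _ 1],
    intro allI impI)
  fix \<Gamma> w
  assume hier: "hier_spec \<Gamma>" and simple: "simple_spec \<Gamma>"
    and deg: "\<forall>v \<in> verts (expansion \<Gamma>). degree (expansion \<Gamma>) v \<le> B"
    and num: "numbered \<Gamma>" and "spec_code \<Gamma> w"
  then obtain ds where codes: "list_all2 code_of \<Gamma> ds" and w: "w = enc_codes ds"
    unfolding spec_code_iff by blast
  note ctxt = hier simple num codes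
  let ?S = "\<lambda>i. set (sel ds i)"
  let ?I = "selected \<Gamma> ?S (length \<Gamma> - 1)"
  let ?w' = "length ds # concat (map (result_cell ds) [0..<length ds])"
  have i: "length \<Gamma> - 1 < length \<Gamma>" using hier by (simp add: hier_spec_def)
  note max = maximal_selection[OF ctxt]
  obtain t where t: "t \<le> 41 * length w + 30"
    and run: "computes (run_on_arrays main_prog rQ) w t (sel_count ds (length ds - 1) # ?w')"
    using computes_result[OF codes_ok[OF ctxt]] w by blast
  have "sel_count ds (length ds - 1) = card ?I"
    using sel_count_eq_card[OF ctxt i] length_codes[OF ctxt] by simp
  with run have "computes (run_on_arrays main_prog rQ) w t (card ?I # ?w')" by simp
  \<comment> \<open>\<open>710 = (41 + 30) * 10\<close>: the additive 30 is absorbed since the code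
    is not empty, and the code has at most ten numbers per unit of size.\<close>
  moreover have "t \<le> 710 * (vsize \<Gamma> + esize \<Gamma>)"
    using t length_enc_codes[OF ctxt] length_codes_le[of ds] unfolding w by linarith
  moreover have "real (independence_number (expansion \<Gamma>)) / real B \<le> real (card ?I)"
  proof -
    have "real (independence_number (expansion \<Gamma>)) \<le> real (B * card ?I)"
      using independence_number_le[OF hier simple max deg assms] by (rule of_nat_mono)
    with assms show ?thesis by (simp add: divide_le_eq mult.commute)
  qed
  ultimately show "\<exists>t I \<Delta> w'.
       computes (run_on_arrays main_prog rQ) w t (card I # w') \<and> spec_code \<Delta> w' \<and>
       t \<le> 710 * (vsize \<Gamma> + esize \<Gamma>) \<and>
       independent_set (expansion \<Gamma>) I \<and>
       real (card I) \<ge> real (independence_number (expansion \<Gamma>)) / real B \<and>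
       hier_spec \<Delta> \<and> expansion \<Delta> = (I, {}) \<and>
       vsize \<Delta> + esize \<Delta> \<le> 1 * vsize \<Gamma>"
    using code_result_spec[OF ctxt] independent_selected[OF hier simple max]
      hier_result_spec[OF ctxt] expansion_result_spec[OF ctxt] size_result_spec[OF ctxt]
    by (intro exI[of _ t] exI[of _ ?I] exI[of _ "result_spec ds"] exI[of _ ?w']) simp
qed

end
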